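(* Let $p$ be an odd prime, $G=\mathrm{Gal}(\mathbb{Q}(\mu_{p^\infty})/\mathbb{Q})$, $\Lambda=\mathbb{Z}_p[[G]]$, and let $h=1-(1+p)\sigma_{1+p}^{-1}\in\Lambda$, which is a regular element (non-zero-divisor) of $\Lambda$. Then there exists a unique element $\mu\in\Lambda[1/h]$ such that $$\kappa^{1-n}(\mu)=(1-p^{n-1})\,\zeta(1-n)\qquad\text{for every integer } n\ge 1,$$ where $\zeta$ is the Riemann zeta function.
   Context: $\mathbb{Q}(\mu_{p^\infty})$ is the field generated over $\mathbb{Q}$ by all $p$-power roots of unity. $\mathbb{Z}_p[[G]]=\varprojlim_U\mathbb{Z}_p[G/U]$ is the profinite group ring ($U$ running over open normal subgroups). $\kappa\colon G\to\mathbb{Z}_p^\times$ is the cyclotomic character, an isomorphism, characterised by $g(\xi)=\xi^{\kappa(g)}$ for all $p$-power roots of unity $\xi$. $\sigma_{1+p}\in G$ is the element with $\kappa(\sigma_{1+p})=1+p$. For $n\ge1$ the continuous character $\kappa^{1-n}\colon G\to\mathbb{Z}_p^\times$ extends uniquely to a continuous $\mathbb{Z}_p$-algebra morphism $\kappa^{1-n}\colon\Lambda\to\mathbb{Z}_p$; since $\kappa^{1-n}(h)=1-(1+p)^n\neq0$, it extends to $\Lambda[1/h]\to\mathbb{Q}_p$. The values $\zeta(1-n)$, $n\ge1$, of the meromorphically continued Riemann zeta function are rational numbers and are regarded as elements of $\mathbb{Q}_p$. *)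

theory Defs
  imports
    "HOL-Algebra.Algebra"
    "HOL-Algebra.Algebraic_Closure_Type"
    "HOL-Complex_Analysis.Complex_Analysis"
begin

section \<open>Localisation of commutative rings\<close>

definition regular_element :: "('a, 'm) ring_scheme \<Rightarrow> 'a \<Rightarrow> bool" where
  "regular_element R a \<longleftrightarrow> a \<in> carrier R \<and>
     (\<forall>x\<in>carrier R. (a \<otimes>\<^bsub>R\<^esub> x = \<zero>\<^bsub>R\<^esub> \<longrightarrow> x = \<zero>\<^bsub>R\<^esub>) \<and> (x \<otimes>\<^bsub>R\<^esub> a = \<zero>\<^bsub>R\<^esub> \<longrightarrow> x = \<zero>\<^bsub>R\<^esub>))"

definition loc_rel :: "('a, 'm) ring_scheme \<Rightarrow> 'a set \<Rightarrow> (('a \<times> 'a) \<times> ('a \<times> 'a)) set" where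
  "loc_rel R S = {((a, s), (b, t)). a \<in> carrier R \<and> b \<in> carrier R \<and> s \<in> S \<and> t \<in> S \<and>
     (\<exists>u\<in>S. u \<otimes>\<^bsub>R\<^esub> (a \<otimes>\<^bsub>R\<^esub> t \<ominus>\<^bsub>R\<^esub> b \<otimes>\<^bsub>R\<^esub> s) = \<zero>\<^bsub>R\<^esub>)}"

definition loc_frac :: "('a, 'm) ring_scheme \<Rightarrow> 'a set \<Rightarrow> 'a \<Rightarrow> 'a \<Rightarrow> ('a \<times> 'a) set" where
  "loc_frac R S a s = loc_rel R S `` {(a, s)}"

text \<open>The ring of fractions of \<open>R\<close> with denominators in the multiplicative set \<open>S\<close>; the operations
  are defined on equivalence classes in the style of \<^theory>\<open>HOL.Equiv_Relations\<close>.\<close>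

definition localization :: "('a, 'm) ring_scheme \<Rightarrow> 'a set \<Rightarrow> ('a \<times> 'a) set ring" where
  "localization R S = \<lparr>
     carrier = (carrier R \<times> S) // loc_rel R S,
     monoid.mult = (\<lambda>A B. \<Union>(a, s)\<in>A. \<Union>(b, t)\<in>B.
              loc_frac R S (a \<otimes>\<^bsub>R\<^esub> b) (s \<otimes>\<^bsub>R\<^esub> t)),
     one = loc_frac R S \<one>\<^bsub>R\<^esub> \<one>\<^bsub>R\<^esub>,
     ring.zero = loc_frac R S \<zero>\<^bsub>R\<^esub> \<one>\<^bsub>R\<^esub>,
     add = (\<lambda>A B. \<Union>(a, s)\<in>A. \<Union>(b, t)\<in>B.
              loc_frac R S (a \<otimes>\<^bsub>R\<^esub> t \<oplus>\<^bsub>R\<^esub> b \<otimes>\<^bsub>R\<^esub> s) (s \<otimes>\<^bsub>R\<^esub> t))\<rparr>"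

text \<open>The extension to rings of fractions of a ring homomorphism \<open>f\<close> into \<open>R'\<close> that maps the
  denominators into \<open>S'\<close>.\<close>

definition loc_map :: "('b, 'm) ring_scheme \<Rightarrow> 'b set \<Rightarrow> ('a \<Rightarrow> 'b) \<Rightarrow> ('a \<times> 'a) set \<Rightarrow> ('b \<times> 'b) set"
  where "loc_map R' S' f A = (\<Union>(a, s)\<in>A. loc_frac R' S' (f a) (f s))"


section \<open>The rings of \<open>p\<close>-adic integers and \<open>p\<close>-adic numbers\<close>

text \<open>A \<open>p\<close>-adic integer is a coherent sequence whose \<open>m\<close>-th entry is the least non-negative
  residue modulo \<open>p ^ m\<close>.\<close>

definition Zp :: "nat \<Rightarrow> (nat \<Rightarrow> int) ring" where
  "Zp p = \<lparr>
     carrier = {x. (\<forall>m. x m \<in> {0..<int p ^ m}) \<and> (\<forall>m. x (Suc m) mod int p ^ m = x m)},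
     monoid.mult = (\<lambda>x y m. (x m * y m) mod int p ^ m),
     one = (\<lambda>m. 1 mod int p ^ m),
     ring.zero = (\<lambda>m. 0),
     add = (\<lambda>x y m. (x m + y m) mod int p ^ m)\<rparr>"

definition Zp_top :: "nat \<Rightarrow> (nat \<Rightarrow> int) topology" where
  "Zp_top p = subtopology (product_topology (\<lambda>_. discrete_topology UNIV) UNIV) (carrier (Zp p))"

definition Zp_of_int :: "nat \<Rightarrow> int \<Rightarrow> nat \<Rightarrow> int" where
  "Zp_of_int p k = (\<lambda>m. k mod int p ^ m)"

abbreviation Zp_nonzero :: "nat \<Rightarrow> (nat \<Rightarrow> int) set" where
  "Zp_nonzero p \<equiv> carrier (Zp p) - {\<zero>\<^bsub>Zp p\<^esub>}"

definition Qp :: "nat \<Rightarrow> ((nat \<Rightarrow> int) \<times> (nat \<Rightarrow> int)) set ring" where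
  "Qp p = localization (Zp p) (Zp_nonzero p)"

definition Qp_of_rat :: "nat \<Rightarrow> rat \<Rightarrow> ((nat \<Rightarrow> int) \<times> (nat \<Rightarrow> int)) set" where
  "Qp_of_rat p q = (case quotient_of q of (a, b) \<Rightarrow>
     loc_frac (Zp p) (Zp_nonzero p) (Zp_of_int p a) (Zp_of_int p b))"


section \<open>Galois groups\<close>

text \<open>Automorphisms of a subfield \<open>L\<close> of the complex numbers fixing \<open>K\<close> pointwise, represented as
  functions that are \<^term>\<open>undefined\<close> outside \<open>L\<close>.\<close>

definition gal_group :: "complex set \<Rightarrow> complex set \<Rightarrow> (complex \<Rightarrow> complex) monoid" where
  "gal_group L K = (BijGroup L)\<lparr>carrier := {g \<in> Bij L.
     g \<in> ring_hom (ring_of_type_algebra\<lparr>carrier := L\<rparr>) (ring_of_type_algebra\<lparr>carrier := L\<rparr>) \<and>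
     (\<forall>x\<in>K. g x = x)}\<rparr>"

text \<open>The Krull topology is the topology of pointwise convergence for the discrete topology on \<open>L\<close>.\<close>

definition krull_top :: "complex set \<Rightarrow> complex set \<Rightarrow> (complex \<Rightarrow> complex) topology" where
  "krull_top L K = subtopology (product_topology (\<lambda>_. discrete_topology L) L) (carrier (gal_group L K))"

definition p_power_roots :: "nat \<Rightarrow> complex set" where
  "p_power_roots p = {\<xi>. \<exists>m. \<xi> ^ (p ^ m) = 1}"

definition cyc_field :: "nat \<Rightarrow> complex set" where
  "cyc_field p = generate_field ring_of_type_algebra (p_power_roots p)"

abbreviation G_cyc :: "nat \<Rightarrow> (complex \<Rightarrow> complex) monoid" where
  "G_cyc p \<equiv> gal_group (cyc_field p) \<rat>"

abbreviation G_top :: "nat \<Rightarrow> (complex \<Rightarrow> complex) topology" where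
  "G_top p \<equiv> krull_top (cyc_field p) \<rat>"

text \<open>If \<open>\<xi> ^ (p ^ m) = 1\<close>, then \<open>\<xi>\<close> to the power of a \<open>p\<close>-adic integer \<open>a\<close> only depends on the
  residue \<open>a m\<close> of \<open>a\<close> modulo \<open>p ^ m\<close>.\<close>

definition kappa :: "nat \<Rightarrow> (complex \<Rightarrow> complex) \<Rightarrow> nat \<Rightarrow> int" where
  "kappa p g = (THE a. a \<in> Units (Zp p) \<and>
     (\<forall>m \<xi>. \<xi> ^ (p ^ m) = 1 \<longrightarrow> g \<xi> = \<xi> ^ nat (a m)))"

definition sigma_1p :: "nat \<Rightarrow> complex \<Rightarrow> complex" where
  "sigma_1p p = (THE g. g \<in> carrier (G_cyc p) \<and> kappa p g = Zp_of_int p (1 + int p))"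


section \<open>Profinite group rings\<close>

definition group_ring ::
  "('a, 'm) ring_scheme \<Rightarrow> ('g, 'n) monoid_scheme \<Rightarrow> ('a, 'g \<Rightarrow> 'a) module" where
  "group_ring R H = \<lparr>
     carrier = {f \<in> carrier H \<rightarrow>\<^sub>E carrier R. finite {x \<in> carrier H. f x \<noteq> \<zero>\<^bsub>R\<^esub>}},
     monoid.mult = (\<lambda>f g. \<lambda>x\<in>carrier H.
       (\<Oplus>\<^bsub>R\<^esub>y\<in>{y \<in> carrier H. f y \<noteq> \<zero>\<^bsub>R\<^esub>}. f y \<otimes>\<^bsub>R\<^esub> g (inv\<^bsub>H\<^esub> y \<otimes>\<^bsub>H\<^esub> x))),
     one = (\<lambda>x\<in>carrier H. if x = \<one>\<^bsub>H\<^esub> then \<one>\<^bsub>R\<^esub> else \<zero>\<^bsub>R\<^esub>),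
     ring.zero = (\<lambda>x\<in>carrier H. \<zero>\<^bsub>R\<^esub>),
     add = (\<lambda>f g. \<lambda>x\<in>carrier H. f x \<oplus>\<^bsub>R\<^esub> g x),
     module.smult = (\<lambda>a f. \<lambda>x\<in>carrier H. a \<otimes>\<^bsub>R\<^esub> f x)\<rparr>"

definition group_ring_map ::
  "('a, 'm) ring_scheme \<Rightarrow> ('g, 'n) monoid_scheme \<Rightarrow> ('k, 'l) monoid_scheme \<Rightarrow>
     ('g \<Rightarrow> 'k) \<Rightarrow> ('g \<Rightarrow> 'a) \<Rightarrow> 'k \<Rightarrow> 'a" where
  "group_ring_map R H H' \<pi> f =
     (\<lambda>y\<in>carrier H'. \<Oplus>\<^bsub>R\<^esub>x\<in>{x \<in> carrier H. \<pi> x = y \<and> f x \<noteq> \<zero>\<^bsub>R\<^esub>}. f x)"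

definition open_normal :: "('g, 'n) monoid_scheme \<Rightarrow> 'g topology \<Rightarrow> 'g set set" where
  "open_normal G T = {U. U \<lhd> G \<and> openin T U}"

text \<open>Inverse limit of the rings \<open>\<int>\<^sub>p[G/U]\<close>. For \<open>U \<subseteq> V\<close> the canonical map from \<open>G/U\<close> to \<open>G/V\<close>
  sends a coset \<open>C\<close> of \<open>U\<close> to the coset \<open>V <#> C\<close> of \<open>V\<close>.\<close>

definition profinite_group_ring ::
  "nat \<Rightarrow> ('g, 'n) monoid_scheme \<Rightarrow> 'g topology \<Rightarrow>
     (nat \<Rightarrow> int, 'g set \<Rightarrow> 'g set \<Rightarrow> nat \<Rightarrow> int) module" where
  "profinite_group_ring p G T = \<lparr>
     carrier = {x \<in> (\<Pi>\<^sub>E U\<in>open_normal G T. carrier (group_ring (Zp p) (G Mod U))).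
       \<forall>U\<in>open_normal G T. \<forall>V\<in>open_normal G T. U \<subseteq> V \<longrightarrow>
         group_ring_map (Zp p) (G Mod U) (G Mod V) (\<lambda>C. V <#>\<^bsub>G\<^esub> C) (x U) = x V},
     monoid.mult = (\<lambda>x y. \<lambda>U\<in>open_normal G T. x U \<otimes>\<^bsub>group_ring (Zp p) (G Mod U)\<^esub> y U),
     one = (\<lambda>U\<in>open_normal G T. \<one>\<^bsub>group_ring (Zp p) (G Mod U)\<^esub>),
     ring.zero = (\<lambda>U\<in>open_normal G T. \<zero>\<^bsub>group_ring (Zp p) (G Mod U)\<^esub>),
     add = (\<lambda>x y. \<lambda>U\<in>open_normal G T. x U \<oplus>\<^bsub>group_ring (Zp p) (G Mod U)\<^esub> y U),
     module.smult = (\<lambda>a x. \<lambda>U\<in>open_normal G T. a \<odot>\<^bsub>group_ring (Zp p) (G Mod U)\<^esub> x U)\<rparr>"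

definition profinite_group_ring_top ::
  "nat \<Rightarrow> ('g, 'n) monoid_scheme \<Rightarrow> 'g topology \<Rightarrow>
     ('g set \<Rightarrow> 'g set \<Rightarrow> nat \<Rightarrow> int) topology" where
  "profinite_group_ring_top p G T =
     subtopology
       (product_topology (\<lambda>U. product_topology (\<lambda>_. Zp_top p) (carrier (G Mod U))) (open_normal G T))
       (carrier (profinite_group_ring p G T))"

definition group_elem ::
  "nat \<Rightarrow> ('g, 'n) monoid_scheme \<Rightarrow> 'g topology \<Rightarrow> 'g \<Rightarrow> 'g set \<Rightarrow> 'g set \<Rightarrow> nat \<Rightarrow> int" where
  "group_elem p G T g = (\<lambda>U\<in>open_normal G T. \<lambda>C\<in>carrier (G Mod U).
     if C = U #>\<^bsub>G\<^esub> g then \<one>\<^bsub>Zp p\<^esub> else \<zero>\<^bsub>Zp p\<^esub>)"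

type_synonym iwasawa =
  "(complex \<Rightarrow> complex) set \<Rightarrow> (complex \<Rightarrow> complex) set \<Rightarrow> nat \<Rightarrow> int"

definition Lambda :: "nat \<Rightarrow> (nat \<Rightarrow> int, iwasawa) module" where
  "Lambda p = profinite_group_ring p (G_cyc p) (G_top p)"

definition Lambda_top :: "nat \<Rightarrow> iwasawa topology" where
  "Lambda_top p = profinite_group_ring_top p (G_cyc p) (G_top p)"

definition Lambda_elem :: "nat \<Rightarrow> (complex \<Rightarrow> complex) \<Rightarrow> iwasawa" where
  "Lambda_elem p = group_elem p (G_cyc p) (G_top p)"

definition h_elem :: "nat \<Rightarrow> iwasawa" where
  "h_elem p = \<one>\<^bsub>Lambda p\<^esub> \<ominus>\<^bsub>Lambda p\<^esub>
     Zp_of_int p (1 + int p) \<odot>\<^bsub>Lambda p\<^esub> Lambda_elem p (inv\<^bsub>G_cyc p\<^esub> (sigma_1p p))"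

definition Lambda_h :: "nat \<Rightarrow> (iwasawa \<times> iwasawa) set ring" where
  "Lambda_h p = localization (Lambda p) (range (\<lambda>k::nat. h_elem p [^]\<^bsub>Lambda p\<^esub> k))"

text \<open>The unique continuous \<open>\<int>\<^sub>p\<close>-algebra morphism extending the character \<open>\<kappa>\<^sup>k\<close>, and its
  extension to \<open>\<Lambda>[1/h]\<close>. The latter is meaningful for those \<open>k\<close> for which the former does not
  vanish at \<open>h\<close>, that is for \<open>k \<noteq> 1\<close>.\<close>

definition kappa_pow :: "nat \<Rightarrow> int \<Rightarrow> iwasawa \<Rightarrow> nat \<Rightarrow> int" where
  "kappa_pow p k = (THE \<phi>.
     \<phi> \<in> extensional (carrier (Lambda p)) \<and>
     \<phi> \<in> ring_hom (Lambda p) (Zp p) \<and>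
     (\<forall>a\<in>carrier (Zp p). \<forall>x\<in>carrier (Lambda p). \<phi> (a \<odot>\<^bsub>Lambda p\<^esub> x) = a \<otimes>\<^bsub>Zp p\<^esub> \<phi> x) \<and>
     continuous_map (Lambda_top p) (Zp_top p) \<phi> \<and>
     (\<forall>g\<in>carrier (G_cyc p). \<phi> (Lambda_elem p g) = kappa p g [^]\<^bsub>Zp p\<^esub> k))"

definition kappa_pow_h ::
  "nat \<Rightarrow> int \<Rightarrow> (iwasawa \<times> iwasawa) set \<Rightarrow> ((nat \<Rightarrow> int) \<times> (nat \<Rightarrow> int)) set" where
  "kappa_pow_h p k = loc_map (Zp p) (Zp_nonzero p) (kappa_pow p k)"


section \<open>The Riemann zeta function\<close>

text \<open>The value at the pole \<open>1\<close> is fixed by convention, so that the continuation is unique as a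
  function on the whole complex plane.\<close>

definition riemann_zeta :: "complex \<Rightarrow> complex" where
  "riemann_zeta = (THE f. f holomorphic_on (- {1}) \<and>
     (\<forall>s. Re s > 1 \<longrightarrow> f s = suminf (\<lambda>n. of_nat (Suc n) powr (- s))) \<and> f 1 = 0)"

definition rat_of_complex :: "complex \<Rightarrow> rat" where
  "rat_of_complex z = (THE q. of_rat q = z)"

end

theory Submission
  imports Defs "HOL-Number_Theory.Residues"
begin

text \<open>An element of \<open>\<Lambda>\<close> is a measure on \<open>\<int>\<^sub>p\<^sup>\<times>\<close>, once \<open>G\<close> is identified with \<open>\<int>\<^sub>p\<^sup>\<times>\<close> by \<open>y = \<kappa>(g) ^ (- 1)\<close>;
  this choice of sign turns \<open>\<kappa> ^ (1 - n)\<close> into the moment \<open>\<integral> y ^ (n - 1)\<close>. The whole theorem is then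
  a statement about moments of measures.

  \<^emph>\<open>Uniqueness and regularity.\<close> A measure all of whose moments vanish is zero, because characteristic
  functions of residue classes are limits of polynomials with \<open>p\<close>-adic coefficients
  (\<open>moments_separate\<close>). Hence the moments embed \<open>\<Lambda>\<close> into a product of copies of the domain \<open>\<int>\<^sub>p\<close>.
  The moments of \<open>h\<close> are \<open>1 - (1 + p) ^ n\<close> (\<open>phi_h\<close>) and do not vanish, so \<open>h\<close> is regular, and an
  element of \<open>\<Lambda>[1/h]\<close> is determined by its values under the characters (\<open>kappa_pow_h_inj\<close>).

  \<^emph>\<open>Existence.\<close> The quotient of the Bernoulli measure regularised by \<open>1 + p\<close> by \<open>h\<close> has the required
  values. Its moments are computed from sums of \<open>n\<close>-th powers of units modulo \<open>p ^ m\<close>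
  (\<open>bern_meas_moment\<close>), whose linear term is a Bernoulli number (\<open>lin_approx_power_sum\<close>). The same
  Bernoulli number is \<open>- n \<zeta>(1 - n)\<close> (\<open>riemann_zeta_nonpos_int\<close>): expanding \<open>(m + 1) powr (1 - s)\<close>
  around \<open>m\<close> and summing over \<open>m\<close> continues \<open>(s - 1) \<zeta>(s)\<close> to the plane and yields at \<open>s = 1 - n\<close>
  the recursion that telescoping yields for the power sums.

  \<^emph>\<open>Identification of \<open>\<Lambda>\<close>.\<close> The exponents by which an automorphism acts on roots of unity of order
  \<open>p ^ m\<close> reach all units modulo \<open>p ^ m\<close>, by irreducibility of the cyclotomic polynomials
  (\<open>conjugate_root\<close>), and their stabilisers form a basis of the open normal subgroups (\<open>tower\<close>).
  Elements of the inverse limit thus correspond to coherent families of masses of residue classes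
  (\<open>carrier_rep\<close>, \<open>represents_ex\<close>), with convolution as product (\<open>represents_mult\<close>). The moments are
  continuous, and by density of the span of group elements they are the unique continuous extensions
  of the characters (\<open>kappa_pow_eq\<close>).\<close>

section \<open>Values of the Riemann zeta function at non-positive integers\<close>

text \<open>Taylor remainder of order \<open>K\<close> of \<open>(x + 1) powr (1 - s)\<close> at the integer \<open>x = n + 1\<close>.
  Summing over \<open>n\<close> telescopes the left-hand power and turns the Taylor terms into values
  \<open>\<zeta>(s + k - 1)\<close>; this expresses \<open>\<zeta>(s)\<close> through \<open>\<zeta>\<close> further to the right, up to a
  series of remainders that converges on a larger half plane.\<close>

definition zeta_rem :: "nat \<Rightarrow> complex \<Rightarrow> nat \<Rightarrow> complex" where
  "zeta_rem K s n = of_nat (Suc (Suc n)) powr (1 - s)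
     - (\<Sum>k\<le>K. ((1 - s) gchoose k) * of_nat (Suc n) powr (1 - s - of_nat k))"

lemma gbinomial_Suc_absorb:
  fixes a :: "'a :: field_char_0"
  shows "of_nat (Suc k) * (a gchoose Suc k) = (a - of_nat k) * (a gchoose k)"
  by (simp only: gbinomial_absorb_comp gbinomial_absorption)

lemma zeta_rem_bound:
  assumes "Re s > - real K"
  shows "norm (zeta_rem K s n) \<le>
    norm (fact (Suc K) * ((1 - s) gchoose Suc K)) * real (Suc n) powr (- Re s - real K)"
proof -
  define S :: "complex set" where "S = of_real ` {real (Suc n)..real (Suc (Suc n))}"
  define f :: "nat \<Rightarrow> complex \<Rightarrow> complex" where
    "f = (\<lambda>i x. fact i * ((1 - s) gchoose i) * x powr (1 - s - of_nat i))"
  let ?B = "norm (fact (Suc K) * ((1 - s) gchoose Suc K)) * real (Suc n) powr (- Re s - real K)"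
  have S: "x \<in> S \<Longrightarrow> x \<in> \<real> \<and> Re x \<ge> real (Suc n)" for x by (auto simp: S_def)
  have nS: "of_nat (Suc n) \<in> S" "of_nat (Suc (Suc n)) \<in> S" 
    by (auto simp: S_def image_iff intro: bexI[of _ "real (Suc n)"] bexI[of _ "real (Suc (Suc n))"])
  have "norm (f 0 (of_nat (Suc (Suc n))) - (\<Sum>i\<le>K. f i (of_nat (Suc n)) * (of_nat (Suc (Suc n)) - of_nat (Suc n)) ^ i / fact i))
     \<le> ?B * cmod (of_nat (Suc (Suc n)) - of_nat (Suc n)) ^ Suc K / fact K"
  proof (rule complex_Taylor[of S])
    show "convex S" unfolding S_def
      by (intro convex_linear_image) (auto intro: bounded_linear.linear bounded_linear_of_real)
    fix i x assume x: "x \<in> S"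
    have nz: "x \<notin> \<real>\<^sub>\<le>\<^sub>0" using S[OF x] by (auto simp: complex_nonpos_Reals_iff)
    have "(f i has_field_derivative fact i * ((1 - s) gchoose i) * ((1 - s - of_nat i) * x powr (1 - s - of_nat i - 1))) (at x within S)"
      unfolding f_def using nz by (auto intro!: derivative_eq_intros)
    also have "fact i * ((1 - s) gchoose i) * ((1 - s - of_nat i) * x powr (1 - s - of_nat i - 1)) = f (Suc i) x"
    proof -
      have "f (Suc i) x = fact i * (of_nat (Suc i) * ((1 - s) gchoose Suc i)) * x powr (1 - s - of_nat i - 1)"
        by (simp add: f_def algebra_simps)
      then show ?thesis by (simp only: gbinomial_Suc_absorb mult_ac)
    qed
    finally show "(f i has_field_derivative f (Suc i) x) (at x within S)" .
    have "norm (x powr (1 - s - of_nat (Suc K))) = Re x powr (- Re s - real K)"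
      using S[OF x] by (simp add: norm_powr_real_powr)
    also have "\<dots> \<le> real (Suc n) powr (- Re s - real K)"
      using S[OF x] assms by (intro powr_mono2') auto
    finally show "norm (f (Suc K) x) \<le> ?B"
      unfolding f_def norm_mult by (intro mult_left_mono) (auto simp: norm_mult[symmetric])
  qed (use nS in auto)
  also have "(of_nat (Suc (Suc n)) - of_nat (Suc n) :: complex) = 1" by simp
  also have "?B * cmod 1 ^ Suc K / fact K \<le> ?B"
    using fact_ge_1[of K, where ?'a = real] mult_left_mono[of 1 "fact K" ?B]
    by (simp add: divide_le_eq del: of_nat_Suc fact_Suc)
  finally show ?thesis by (simp add: f_def zeta_rem_def)
qed

definition zeta_rem_sum :: "nat \<Rightarrow> complex \<Rightarrow> complex" where
  "zeta_rem_sum K s = suminf (zeta_rem K s)"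

lemma holomorphic_zeta_rem [holomorphic_intros]: "(\<lambda>s. zeta_rem K s n) holomorphic_on A"
  unfolding zeta_rem_def gbinomial_prod_rev
  by (intro holomorphic_intros holomorphic_on_powr_right) auto

lemma holomorphic_gchoose [holomorphic_intros]:
  "(\<lambda>s::complex. (1 - s) gchoose k) holomorphic_on A"
  unfolding gbinomial_prod_rev by (intro holomorphic_intros) auto

lemma holomorphic_zeta_rem_sum: "zeta_rem_sum K holomorphic_on {s. Re s > 1 - real K}"
proof (rule holomorphic_uniform_sequence[where f = "\<lambda>N s. \<Sum>n<N. zeta_rem K s n"])
  show "open {s. Re s > 1 - real K}" by (simp add: open_halfspace_Re_gt)
  show "(\<lambda>s. \<Sum>n<N. zeta_rem K s n) holomorphic_on {s. 1 - real K < Re s}" for N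
    by (intro holomorphic_intros)
  fix s0 assume "s0 \<in> {s. Re s > 1 - real K}"
  define d where "d = (Re s0 - (1 - real K)) / 2"
  have d: "d > 0" using \<open>s0 \<in> _\<close> by (simp add: d_def)
  have ge: "Re s \<ge> 1 - real K + d" if "s \<in> cball s0 d" for s
    using that abs_Re_le_cmod[of "s0 - s"] by (auto simp: dist_norm d_def field_simps)
  have "compact ((\<lambda>s. fact (Suc K) * ((1 - s) gchoose Suc K)) ` cball s0 d)"
    by (intro compact_continuous_image holomorphic_on_imp_continuous_on holomorphic_intros) auto
  then obtain B where B: "B > 0" "\<And>s. s \<in> cball s0 d \<Longrightarrow> norm (fact (Suc K) * ((1 - s) gchoose Suc K)) \<le> B"
    using compact_imp_bounded bounded_pos by (metis (no_types, lifting) image_eqI)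
  have "uniform_limit (cball s0 d) (\<lambda>N s. \<Sum>n<N. zeta_rem K s n) (\<lambda>s. suminf (zeta_rem K s)) sequentially"
  proof (rule Weierstrass_m_test)
    show "summable (\<lambda>n. B * real (Suc n) powr (- 1 - d))"
      using d by (intro summable_mult) (subst summable_Suc_iff, simp add: summable_real_powr_iff)
    fix n s assume s: "s \<in> cball s0 d"
    have "norm (zeta_rem K s n) \<le> norm (fact (Suc K) * ((1 - s) gchoose Suc K)) * real (Suc n) powr (- Re s - real K)"
      using ge[OF s] d by (intro zeta_rem_bound) auto
    also have "\<dots> \<le> B * real (Suc n) powr (- 1 - d)"
      using ge[OF s] d B(2)[OF s] B(1) by (intro mult_mono powr_mono) auto
    finally show "norm (zeta_rem K s n) \<le> B * real (Suc n) powr (- 1 - d)" .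
  qed
  moreover have "cball s0 d \<subseteq> {s. Re s > 1 - real K}" using ge d by force
  ultimately show "\<exists>d>0. cball s0 d \<subseteq> {s. 1 - real K < Re s} \<and>
       uniform_limit (cball s0 d) (\<lambda>N s. \<Sum>n<N. zeta_rem K s n) (zeta_rem_sum K) sequentially"
    unfolding zeta_rem_sum_def using d by blast
qed

definition zeta_series :: "complex \<Rightarrow> complex" where
  "zeta_series s = suminf (\<lambda>n. of_nat (Suc n) powr (- s))"

lemma summable_zeta_series:
  assumes "Re s > 1" shows "summable (\<lambda>n. of_nat (Suc n) powr (- s) :: complex)"
proof (rule summable_norm_cancel)
  show "summable (\<lambda>n. norm (of_nat (Suc n) powr (- s) :: complex))"
  proof -
    have "(\<lambda>n. norm (of_nat (Suc n) powr (- s) :: complex)) = (\<lambda>n. real (Suc n) powr (- Re s))"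
      by (auto simp: norm_powr_real_powr simp del: of_nat_Suc)
    moreover have "summable (\<lambda>n. real (Suc n) powr (- Re s))"
      using assms by (subst summable_Suc_iff) (simp add: summable_real_powr_iff)
    ultimately show ?thesis by simp
  qed
qed

lemma zeta_rem_sum_eq:
  assumes "Re s > 1"
  shows "zeta_rem_sum K s = - 1 - (\<Sum>k=1..K. ((1 - s) gchoose k) * zeta_series (s + of_nat k - 1))"
proof -
  have 1: "(\<lambda>n. of_nat (Suc (Suc n)) powr (1 - s) - of_nat (Suc n) powr (1 - s) :: complex) sums (0 - of_nat (Suc 0) powr (1 - s))"
  proof (rule telescope_sums)
    have "((\<lambda>n. of_nat (Suc n) powr (1 - s)) \<longlongrightarrow> (0::complex)) sequentially"
    proof (rule Lim_null_comparison)
      show "\<forall>\<^sub>F n in sequentially. norm (of_nat (Suc n) powr (1 - s)) \<le> real (Suc n) powr (1 - Re s)"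
        by (intro always_eventually allI) (simp add: norm_powr_real_powr del: of_nat_Suc)
      have "filterlim (\<lambda>n. real (Suc n)) at_top sequentially"
        using filterlim_compose[OF filterlim_real_sequentially filterlim_Suc] .
      then show "(\<lambda>n. real (Suc n) powr (1 - Re s)) \<longlonglongrightarrow> 0"
        using assms by (intro tendsto_neg_powr) auto
    qed
    then show "(\<lambda>n. of_nat (Suc n) powr (1 - s)) \<longlonglongrightarrow> (0::complex)" .
  qed
  have 2: "(\<lambda>n. \<Sum>k=1..K. ((1 - s) gchoose k) * of_nat (Suc n) powr (1 - s - of_nat k)) sums
     (\<Sum>k=1..K. ((1 - s) gchoose k) * zeta_series (s + of_nat k - 1))"
  proof (intro sums_sum sums_mult)
    fix k assume k: "k \<in> {1..K}"
    have "Re (s + of_nat k - 1) > 1" using k assms by auto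
    from summable_sums[OF summable_zeta_series[OF this]]
    show "(\<lambda>n. of_nat (Suc n) powr (1 - s - of_nat k)) sums zeta_series (s + of_nat k - 1)"
      unfolding zeta_series_def by (simp add: algebra_simps del: of_nat_Suc)
  qed
  have "zeta_rem K s = (\<lambda>n. (of_nat (Suc (Suc n)) powr (1 - s) - of_nat (Suc n) powr (1 - s))
     - (\<Sum>k=1..K. ((1 - s) gchoose k) * of_nat (Suc n) powr (1 - s - of_nat k)))"
  proof
    fix n
    have "(\<Sum>k\<le>K. ((1 - s) gchoose k) * of_nat (Suc n) powr (1 - s - of_nat k)) =
      of_nat (Suc n) powr (1 - s) + (\<Sum>k=1..K. ((1 - s) gchoose k) * of_nat (Suc n) powr (1 - s - of_nat k))"
      unfolding atMost_atLeast0 by (subst sum.atLeast_Suc_atMost) auto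
    then show "zeta_rem K s n = (of_nat (Suc (Suc n)) powr (1 - s) - of_nat (Suc n) powr (1 - s))
     - (\<Sum>k=1..K. ((1 - s) gchoose k) * of_nat (Suc n) powr (1 - s - of_nat k))"
      by (simp add: zeta_rem_def)
  qed
  then have "zeta_rem K s sums (0 - of_nat (Suc 0) powr (1 - s) - (\<Sum>k=1..K. ((1 - s) gchoose k) * zeta_series (s + of_nat k - 1)))"
    using sums_diff[OF 1 2] by simp
  then show ?thesis unfolding zeta_rem_sum_def by (auto dest: sums_unique)
qed

text \<open>The function that is continued is \<open>(s - 1) * \<zeta>(s)\<close>, so that no poles occur: the factor
  \<open>s + j - 1\<close> absorbed from \<open>\<zeta>(s + j)\<close> turns the coefficient \<open>(1 - s) gchoose (j + 1)\<close> into
  \<open>- ((1 - s) gchoose j) / (j + 1)\<close>. Each step gains one unit of the half plane.\<close>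

primrec zeta_cont :: "nat \<Rightarrow> complex \<Rightarrow> complex" where
  "zeta_cont 0 s = (s - 1) * zeta_series s"
| "zeta_cont (Suc K) s = 1 + zeta_rem_sum (Suc K) s
     - (\<Sum>j=1..K. ((1 - s) gchoose j) / of_nat (Suc j) * zeta_cont K (s + of_nat j))"

lemma zeta_cont_eq: "Re s > 1 \<Longrightarrow> zeta_cont K s = (s - 1) * zeta_series s"
proof (induction K arbitrary: s)
  case (Suc K)
  have "(\<Sum>j=1..K. ((1 - s) gchoose j) / of_nat (Suc j) * zeta_cont K (s + of_nat j)) =
    (\<Sum>j=1..K. - (((1 - s) gchoose Suc j) * zeta_series (s + of_nat (Suc j) - 1)))"
  proof (rule sum.cong)
    fix j assume "j \<in> {1..K}"
    have "zeta_cont K (s + of_nat j) = (s + of_nat j - 1) * zeta_series (s + of_nat j)"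
      using Suc by simp
    moreover have "((1 - s) gchoose j) / of_nat (Suc j) * (s + of_nat j - 1) = - ((1 - s) gchoose Suc j)"
      using gbinomial_Suc_absorb[of j "1 - s"] 
      by (simp add: field_simps del: of_nat_Suc)
    ultimately show "((1 - s) gchoose j) / of_nat (Suc j) * zeta_cont K (s + of_nat j) =
        - (((1 - s) gchoose Suc j) * zeta_series (s + of_nat (Suc j) - 1))"
      by (simp del: of_nat_Suc add: mult.assoc[symmetric]) simp
  qed simp
  moreover have "(\<Sum>k=1..Suc K. ((1 - s) gchoose k) * zeta_series (s + of_nat k - 1)) =
    (1 - s) * zeta_series s + (\<Sum>j=1..K. ((1 - s) gchoose Suc j) * zeta_series (s + of_nat (Suc j) - 1))"
    by (subst sum.atLeast_Suc_atMost)
      (auto simp: sum.shift_bounds_cl_Suc_ivl simp del: of_nat_Suc sum.cl_ivl_Suc, simp)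
  ultimately show ?case
    using Suc.prems by (simp add: zeta_rem_sum_eq sum_negf del: of_nat_Suc sum.cl_ivl_Suc) (simp add: algebra_simps)
qed simp

lemma holomorphic_zeta_cont: "zeta_cont (Suc K) holomorphic_on {s. Re s > - real K}"
proof (induction K)
  case 0
  have "zeta_cont (Suc 0) = (\<lambda>s. 1 + zeta_rem_sum (Suc 0) s)" by auto
  then show ?case using holomorphic_zeta_rem_sum[of "Suc 0"] by (auto intro!: holomorphic_intros)
next
  case (Suc K)
  have "(\<lambda>s. 1 + zeta_rem_sum (Suc (Suc K)) s
     - (\<Sum>j=1..Suc K. ((1 - s) gchoose j) / of_nat (Suc j) * zeta_cont (Suc K) (s + of_nat j))) holomorphic_on {s. Re s > - real (Suc K)}"
  proof (intro holomorphic_intros)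
    show "zeta_rem_sum (Suc (Suc K)) holomorphic_on {s. - real (Suc K) < Re s}"
      using holomorphic_zeta_rem_sum[of "Suc (Suc K)"] by simp
    fix j assume j: "j \<in> {1..Suc K}"
    have "(zeta_cont (Suc K) \<circ> (\<lambda>s. s + of_nat j)) holomorphic_on {s. - real (Suc K) < Re s}"
      by (rule holomorphic_on_compose_gen[OF _ Suc]) (use j in \<open>auto intro!: holomorphic_intros\<close>)
    then show "(\<lambda>s. zeta_cont (Suc K) (s + of_nat j)) holomorphic_on {s. - real (Suc K) < Re s}"
      by (simp add: o_def)
  qed (auto simp del: of_nat_Suc)
  then show ?case by (simp only: zeta_cont.simps(2)[abs_def])
qed

lemma zeta_cont_unique:
  assumes "Re s > - real K" "K \<le> M"
  shows "zeta_cont (Suc M) s = zeta_cont (Suc K) s"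
proof (rule analytic_continuation_open[of "{s. Re s > 1}" "{s. Re s > - real K}"
      "zeta_cont (Suc M)" "zeta_cont (Suc K)" s])
  show "zeta_cont (Suc M) holomorphic_on {s. - real K < Re s}"
    by (rule holomorphic_on_subset[OF holomorphic_zeta_cont]) (use assms in auto)
  show "zeta_cont (Suc K) holomorphic_on {s. - real K < Re s}" by (rule holomorphic_zeta_cont)
  show "{s. 1 < Re s} \<noteq> {}" by (auto intro: exI[of _ 2])
  show "connected {s. - real K < Re s}"
    by (intro convex_connected convex_halfspace_Re_gt)
qed (use assms in \<open>auto simp: open_halfspace_Re_gt zeta_cont_eq simp del: zeta_cont.simps\<close>)

definition zeta_entire :: "complex \<Rightarrow> complex" where
  "zeta_entire s = zeta_cont (Suc (nat \<lceil>\<bar>Re s\<bar> + 1\<rceil>)) s"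

lemma zeta_entire_eq:
  assumes "Re s > - real K" shows "zeta_entire s = zeta_cont (Suc K) s"
proof -
  define M where "M = nat \<lceil>\<bar>Re s\<bar> + 1\<rceil>"
  have "Re s > - real M" unfolding M_def by linarith
  then show ?thesis unfolding zeta_entire_def M_def[symmetric]
    using zeta_cont_unique[of M s K] zeta_cont_unique[of K s M] assms by (metis nat_le_linear)
qed

lemma holomorphic_zeta_entire: "zeta_entire holomorphic_on UNIV"
proof (rule holomorphic_on_subset[of _ "\<Union>K. {s. Re s > - real K}"])
  show "zeta_entire holomorphic_on (\<Union>K. {s. Re s > - real K})"
  proof (rule holomorphic_on_UN_open)
    fix K show "zeta_entire holomorphic_on {s. Re s > - real K}"
      using holomorphic_zeta_cont[of K] by (rule holomorphic_transform) (auto simp: zeta_entire_eq)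
  qed (auto simp: open_halfspace_Re_gt)
  show "UNIV \<subseteq> (\<Union>K. {s. - real K < Re s})"
  proof
    fix s :: complex
    obtain K where "real K > - Re s" using reals_Archimedean2 by blast
    then show "s \<in> (\<Union>K. {s. - real K < Re s})" by (auto intro!: exI[of _ K])
  qed
qed

theorem riemann_zeta_eq:
  assumes "s \<noteq> 1" shows "riemann_zeta s = zeta_entire s / (s - 1)"
proof -
  define f where "f = (\<lambda>s. if s = 1 then 0 else zeta_entire s / (s - 1))"
  have hol: "f holomorphic_on (- {1})"
  proof -
    have "(\<lambda>s. zeta_entire s / (s - 1)) holomorphic_on (- {1})"
      by (intro holomorphic_intros holomorphic_on_subset[OF holomorphic_zeta_entire]) auto
    then show ?thesis by (rule holomorphic_transform) (auto simp: f_def)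
  qed
  have ser: "f s = suminf (\<lambda>n. of_nat (Suc n) powr (- s))" if "Re s > 1" for s
    using that zeta_entire_eq[of 0 s] zeta_cont_eq[of s 1]
    by (auto simp: f_def zeta_series_def simp del: zeta_cont.simps of_nat_Suc)
  have "riemann_zeta = f"
    unfolding riemann_zeta_def
  proof (rule the_equality)
    show "f holomorphic_on (- {1}) \<and>
     (\<forall>s. Re s > 1 \<longrightarrow> f s = suminf (\<lambda>n. of_nat (Suc n) powr (- s))) \<and> f 1 = 0"
      using hol ser by (auto simp: f_def)
    fix g assume g: "g holomorphic_on (- {1}) \<and>
     (\<forall>s. Re s > 1 \<longrightarrow> g s = suminf (\<lambda>n. of_nat (Suc n) powr (- s))) \<and> g 1 = 0"
    show "g = f"
    proof
      fix z show "g z = f z"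
      proof (cases "z = 1")
        case False
        show ?thesis
        proof (rule analytic_continuation_open[of "{s. Re s > 1}" "- {1}" g f z])
          show "{s. 1 < Re s} \<noteq> {}" by (auto intro: exI[of _ 2])
          show "connected (- {1::complex})"
            by (rule connected_punctured_universe) simp
        qed (use g hol ser False in \<open>auto simp: open_halfspace_Re_gt\<close>)
      qed (use g in \<open>auto simp: f_def\<close>)
    qed
  qed
  then have "riemann_zeta s = f s" by simp
  then show ?thesis using assms by (simp add: f_def)
qed

text \<open>At \<open>s = 1 - n\<close> the power is a polynomial, so its Taylor expansion is exact from order \<open>n\<close> on.\<close>

lemma zeta_rem_sum_nonpos_int: "zeta_rem_sum (Suc n) (1 - of_nat n) = 0"
proof -
  have "zeta_rem (Suc n) (1 - of_nat n) m = 0" for m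
  proof -
    have "of_nat (Suc (Suc m)) powr of_nat n = (of_nat (Suc m) + 1 :: complex) ^ n"
      by (subst powr_nat) (auto simp: add_ac simp del: of_nat_Suc, simp_all add: add_ac)
    also have "\<dots> = (\<Sum>k\<le>n. of_nat (n choose k) * of_nat (Suc m) ^ (n - k))"
      unfolding add.commute[of _ 1] binomial_ring[of 1] by simp
    also have "\<dots> = (\<Sum>k\<le>n. (of_nat n gchoose k) * of_nat (Suc m) powr (of_nat n - of_nat k))"
    proof (rule sum.cong)
      fix k assume "k \<in> {..n}"
      then have "(of_nat n - of_nat k :: complex) = of_nat (n - k)" by (simp add: of_nat_diff)
      then show "of_nat (n choose k) * of_nat (Suc m) ^ (n - k) =
         (of_nat n gchoose k) * (of_nat (Suc m) :: complex) powr (of_nat n - of_nat k)"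
        by (simp only: binomial_gbinomial powr_nat) (simp del: of_nat_Suc)
    qed simp
    also have "\<dots> = (\<Sum>k\<le>Suc n. (of_nat n gchoose k) * of_nat (Suc m) powr (of_nat n - of_nat k))"
      by (simp add: binomial_gbinomial[symmetric] del: of_nat_Suc)
    finally show ?thesis by (simp add: zeta_rem_def)
  qed
  then have "zeta_rem (Suc n) (1 - of_nat n) = (\<lambda>_. 0)" by auto
  then show ?thesis unfolding zeta_rem_sum_def by simp
qed

text \<open>Multiplying the functional recursion at \<open>s = 1 - n\<close> by \<open>n + 1\<close> gives the recursion of the
  Bernoulli numbers (with \<open>1/2\<close> at index 1).\<close>

lemma zeta_entire_recurrence:
  "(\<Sum>j\<le>n. of_nat (Suc n choose j) * zeta_entire (1 - of_nat j)) = of_nat (Suc n)"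
proof -
  have "zeta_entire (1 - of_nat n) = zeta_cont (Suc n) (1 - of_nat n)"
    by (rule zeta_entire_eq) simp
  also have "\<dots> = 1 - (\<Sum>j=1..n. (of_nat n gchoose j) / of_nat (Suc j) * zeta_cont n (1 - of_nat n + of_nat j))"
    by (simp add: zeta_rem_sum_nonpos_int)
  also have "(\<Sum>j=1..n. (of_nat n gchoose j) / of_nat (Suc j) * zeta_cont n (1 - of_nat n + of_nat j)) =
    (\<Sum>j=1..n. of_nat (n choose j) / of_nat (Suc j) * zeta_entire (1 - of_nat (n - j)))"
  proof (rule sum.cong)
    fix j assume j: "j \<in> {1..n}"
    have "1 - of_nat n + of_nat j = (1 - of_nat (n - j) :: complex)" using j by (simp add: of_nat_diff)
    moreover have "zeta_entire (1 - of_nat (n - j)) = zeta_cont (Suc (n - 1)) (1 - of_nat (n - j))"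
      by (rule zeta_entire_eq) (use j in auto)
    ultimately show "(of_nat n gchoose j) / of_nat (Suc j) * zeta_cont n (1 - of_nat n + of_nat j) =
      of_nat (n choose j) / of_nat (Suc j) * zeta_entire (1 - of_nat (n - j))"
      using j by (simp only: binomial_gbinomial) simp
  qed simp
  finally have "(\<Sum>j=0..n. of_nat (n choose j) / of_nat (Suc j) * zeta_entire (1 - of_nat (n - j))) = 1"
    by (subst sum.atLeast_Suc_atMost) auto
  then have "of_nat (Suc n) * (\<Sum>j=0..n. of_nat (n choose j) / of_nat (Suc j) * zeta_entire (1 - of_nat (n - j))) = of_nat (Suc n)"
    by simp
  also have "of_nat (Suc n) * (\<Sum>j=0..n. of_nat (n choose j) / of_nat (Suc j) * zeta_entire (1 - of_nat (n - j))) =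
    (\<Sum>j=0..n. of_nat (Suc n choose (n - j)) * zeta_entire (1 - of_nat (n - j)))"
    unfolding sum_distrib_left
  proof (rule sum.cong)
    fix j assume j: "j \<in> {0..n}"
    have "Suc n choose (n - j) = Suc n choose (Suc j)"
      using j by (subst binomial_symmetric) (auto simp: Suc_diff_le)
    moreover have "of_nat (Suc j) * of_nat (Suc n choose Suc j) = (of_nat (Suc n) * of_nat (n choose j) :: complex)"
      unfolding of_nat_mult[symmetric] by (metis Suc_times_binomial_eq mult.commute)
    ultimately show "of_nat (Suc n) * (of_nat (n choose j) / of_nat (Suc j) * zeta_entire (1 - of_nat (n - j))) =
      of_nat (Suc n choose (n - j)) * zeta_entire (1 - of_nat (n - j))"
      by (simp add: field_simps del: of_nat_Suc binomial_Suc_Suc)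
  qed simp
  also have "\<dots> = (\<Sum>j\<le>n. of_nat (Suc n choose j) * zeta_entire (1 - of_nat j))"
    by (rule sum.reindex_bij_witness[of _ "\<lambda>j. n - j" "\<lambda>j. n - j"]) auto
  finally show ?thesis .
qed

fun bern :: "nat \<Rightarrow> rat" where
  "bern n = 1 - (\<Sum>j<n. of_nat (Suc n choose j) * bern j) / of_nat (Suc n)"
declare bern.simps [simp del]

lemma bern_recurrence: "(\<Sum>j\<le>n. of_nat (Suc n choose j) * bern j) = of_nat (Suc n)"
proof -
  have "of_nat (Suc n) * bern n = of_nat (Suc n) - (\<Sum>j<n. of_nat (Suc n choose j) * bern j)"
    by (subst bern.simps) (simp add: field_simps del: of_nat_Suc binomial_Suc_Suc)
  then show ?thesis by (simp add: lessThan_Suc_atMost[symmetric] del: of_nat_Suc binomial_Suc_Suc)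
qed

lemma zeta_entire_bern: "zeta_entire (1 - of_nat n) = of_rat (bern n)"
proof (induction n rule: less_induct)
  case (less n)
  have 1: "(\<Sum>j<n. of_nat (Suc n choose j) * zeta_entire (1 - of_nat j)) + of_nat (Suc n) * zeta_entire (1 - of_nat n) = of_nat (Suc n)"
    using zeta_entire_recurrence[of n] by (simp add: lessThan_Suc_atMost[symmetric] del: of_nat_Suc binomial_Suc_Suc)
  have "of_rat ((\<Sum>j<n. of_nat (Suc n choose j) * bern j) + of_nat (Suc n) * bern n) = (of_nat (Suc n) :: complex)"
    using bern_recurrence[of n]
    by (simp add: lessThan_Suc_atMost[symmetric] del: of_nat_Suc binomial_Suc_Suc)
  then have 2: "(\<Sum>j<n. of_nat (Suc n choose j) * of_rat (bern j)) + of_nat (Suc n) * of_rat (bern n) = (of_nat (Suc n) :: complex)"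
    by (simp add: of_rat_add of_rat_mult of_rat_sum del: of_nat_Suc binomial_Suc_Suc)
  have "(\<Sum>j<n. of_nat (Suc n choose j) * zeta_entire (1 - of_nat j)) =
      (\<Sum>j<n. of_nat (Suc n choose j) * of_rat (bern j))"
    by (rule sum.cong) (simp_all only: less lessThan_iff)
  with 1 2 have "of_nat (Suc n) * zeta_entire (1 - of_nat n) = of_nat (Suc n) * of_rat (bern n)"
    by (metis add_left_cancel)
  then show ?case by (simp del: of_nat_Suc)
qed

theorem riemann_zeta_nonpos_int:
  assumes "n \<ge> 1" shows "riemann_zeta (1 - of_nat n) = of_rat (- bern n / of_nat n)"
  using assms by (subst riemann_zeta_eq) (auto simp: zeta_entire_bern of_rat_divide of_rat_minus)

section \<open>Sums of powers\<close>

text \<open>\<open>s N\<close> agrees with \<open>r * N\<close> up to a multiple of \<open>N\<^sup>2\<close> and a common denominator, so that \<open>r\<close>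
  plays the role of the derivative of \<open>s\<close> at \<open>0\<close>. For \<open>N = p ^ m\<close> this says that
  \<open>s N / N\<close> tends to \<open>r\<close> in the \<open>p\<close>-adic topology.\<close>

definition lin_approx :: "rat \<Rightarrow> (nat \<Rightarrow> int) \<Rightarrow> bool" where
  "lin_approx r s \<longleftrightarrow> (\<exists>D>0. \<forall>N. \<exists>k. of_int D * (of_int (s N) - r * of_nat N) = of_int (int N ^ 2 * k))"

lemma lin_approx_add:
  assumes "lin_approx r s" "lin_approx r' s'"
  shows "lin_approx (r + r') (\<lambda>N. s N + s' N)"
proof -
  obtain D k where D: "D > 0" "\<And>N. of_int D * (of_int (s N) - r * of_nat N) = of_int (int N ^ 2 * k N)"
    using assms(1) unfolding lin_approx_def by metis
  obtain D' k' where D': "D' > 0" "\<And>N. of_int D' * (of_int (s' N) - r' * of_nat N) = of_int (int N ^ 2 * k' N)"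
    using assms(2) unfolding lin_approx_def by metis
  show ?thesis unfolding lin_approx_def
  proof (rule exI[of _ "D * D'"], intro conjI allI)
    fix N
    have "of_int (D * D') * (of_int (s N + s' N) - (r + r') * of_nat N) =
      of_int D' * (of_int D * (of_int (s N) - r * of_nat N)) + of_int D * (of_int D' * (of_int (s' N) - r' * of_nat N))"
      by (simp add: algebra_simps)
    also have "\<dots> = of_int (int N ^ 2 * (D' * k N + D * k' N))"
      unfolding D D' by (simp add: algebra_simps)
    finally show "\<exists>k. of_int (D * D') * (of_int (s N + s' N) - (r + r') * of_nat N) = of_int (int N ^ 2 * k)" ..
  qed (use D D' in simp)
qed

lemma lin_approx_cmult:
  assumes "lin_approx r s" shows "lin_approx (of_int c * r) (\<lambda>N. c * s N)"
proof -
  obtain D k where D: "D > 0" "\<And>N. of_int D * (of_int (s N) - r * of_nat N) = of_int (int N ^ 2 * k N)"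
    using assms(1) unfolding lin_approx_def by metis
  show ?thesis unfolding lin_approx_def
  proof (rule exI[of _ D], intro conjI allI)
    fix N
    have "of_int D * (of_int (c * s N) - of_int c * r * of_nat N) = of_int c * (of_int D * (of_int (s N) - r * of_nat N))"
      by (simp add: algebra_simps)
    also have "\<dots> = of_int (int N ^ 2 * (c * k N))" unfolding D by simp
    finally show "\<exists>k. of_int D * (of_int (c * s N) - of_int c * r * of_nat N) = of_int (int N ^ 2 * k)" ..
  qed (use D in simp)
qed

lemma lin_approx_cancel:
  assumes "lin_approx (of_int c * r) (\<lambda>N. c * s N)" "c > 0" shows "lin_approx r s"
proof -
  obtain D k where D: "D > 0" "\<And>N. of_int D * (of_int (c * s N) - of_int c * r * of_nat N) = of_int (int N ^ 2 * k N)"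
    using assms(1) unfolding lin_approx_def by metis
  show ?thesis unfolding lin_approx_def
  proof (rule exI[of _ "D * c"], intro conjI allI)
    fix N
    show "\<exists>k. of_int (D * c) * (of_int (s N) - r * of_nat N) = of_int (int N ^ 2 * k)"
      using D(2)[of N] by (intro exI[of _ "k N"]) (simp add: algebra_simps)
  qed (use D assms in simp)
qed

lemma lin_approx_0: "lin_approx 0 (\<lambda>N. 0)"
  unfolding lin_approx_def by (intro exI[of _ 1]) auto

lemma lin_approx_sum:
  assumes "finite A" "\<And>j. j \<in> A \<Longrightarrow> lin_approx (r j) (s j)"
  shows "lin_approx (\<Sum>j\<in>A. r j) (\<lambda>N. \<Sum>j\<in>A. s j N)"
  using assms by (induction A rule: finite_induct) (auto intro: lin_approx_0 lin_approx_add)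

lemma lin_approx_power: "lin_approx (of_nat m) (\<lambda>N. (1 + int N) ^ m - 1)"
proof -
  have "\<exists>k. (1 + x) ^ m = 1 + int m * x + x ^ 2 * k" for x :: int
  proof (induction m)
    case (Suc m)
    then obtain k where "(1 + x) ^ m = 1 + int m * x + x ^ 2 * k" by blast
    then have "(1 + x) ^ Suc m = 1 + int (Suc m) * x + x ^ 2 * (int m + k + x * k)"
      by (simp add: algebra_simps power2_eq_square)
    then show ?case by blast
  qed auto
  then obtain k where k: "\<And>x::int. (1 + x) ^ m = 1 + int m * x + x ^ 2 * k x" by metis
  show ?thesis unfolding lin_approx_def
    by (rule exI[of _ 1], intro conjI allI exI[of _ "k (int _)"]) (auto simp: k algebra_simps)
qed

text \<open>Telescoping \<open>(a + 1) ^ (n + 1) - a ^ (n + 1)\<close> shows that the linear coefficients of the power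
  sums satisfy the same recursion as the values of zeta. No explicit Faulhaber formula is involved.\<close>

lemma lin_approx_power_sum: "lin_approx (bern n) (\<lambda>N. \<Sum>a=1..N. int a ^ n)"
proof (induction n rule: less_induct)
  case (less n)
  define s where "s = (\<lambda>n N. \<Sum>a=1..N. int a ^ n)"
  have tele: "(1 + int N) ^ Suc n - 1 = (\<Sum>j\<le>n. int (Suc n choose j) * s j N)" for N
  proof (induction N)
    case (Suc N)
    have "(1 + int (Suc N)) ^ Suc n = (\<Sum>j\<le>Suc n. int (Suc n choose j) * int (Suc N) ^ j)"
      by (subst add.commute, subst binomial_ring) simp
    also have "\<dots> = int (Suc N) ^ Suc n + (\<Sum>j\<le>n. int (Suc n choose j) * int (Suc N) ^ j)"
      by simp
    finally have "(1 + int (Suc N)) ^ Suc n - 1 = (1 + int N) ^ Suc n - 1 + (\<Sum>j\<le>n. int (Suc n choose j) * int (Suc N) ^ j)"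
      by simp
    also have "\<dots> = (\<Sum>j\<le>n. int (Suc n choose j) * s j (Suc N))"
      unfolding Suc.IH sum.distrib[symmetric] by (intro sum.cong) (auto simp: s_def algebra_simps)
    finally show ?case .
  qed (simp add: s_def)
  have 1: "lin_approx (of_nat (Suc n) + (\<Sum>j<n. of_int (- int (Suc n choose j)) * bern j))
     (\<lambda>N. (1 + int N) ^ Suc n - 1 + (\<Sum>j<n. - int (Suc n choose j) * s j N))"
    using less unfolding s_def
    by (intro lin_approx_add lin_approx_power lin_approx_sum lin_approx_cmult) auto
  have "of_nat (Suc n) + (\<Sum>j<n. of_int (- int (Suc n choose j)) * bern j) = of_int (int (Suc n)) * bern n"
    using bern_recurrence[of n]
    by (simp add: lessThan_Suc_atMost[symmetric] sum_negf del: binomial_Suc_Suc of_nat_Suc)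
  moreover have "(1 + int N) ^ Suc n - 1 + (\<Sum>j<n. - int (Suc n choose j) * s j N) = int (Suc n) * s n N" for N
    unfolding tele by (simp add: lessThan_Suc_atMost[symmetric] sum_negf del: binomial_Suc_Suc)
  ultimately have "lin_approx (of_int (int (Suc n)) * bern n) (\<lambda>N. int (Suc n) * s n N)"
    using 1 by simp
  then show ?case unfolding s_def by (rule lin_approx_cancel) simp
qed

text \<open>Least non-negative representatives of the units modulo \<open>p ^ m\<close>. Level \<open>m = 0\<close> is included:
  there \<open>0\<close> is the only unit.\<close>

definition unit_res :: "nat \<Rightarrow> nat \<Rightarrow> int set" where
  "unit_res p m = {b \<in> {0..<int p ^ m}. coprime b (int p ^ m)}"

lemma finite_unit_res [simp, intro]: "finite (unit_res p m)"
  unfolding unit_res_def by (rule finite_subset[of _ "{0..<int p ^ m}"]) auto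

lemma unit_res_mod:
  assumes "p > 0" "coprime b (int p ^ m)" shows "b mod int p ^ m \<in> unit_res p m"
  using assms by (simp add: unit_res_def del: coprime_power_right_iff)

lemma coprime_prime_power_int:
  assumes "Factorial_Ring.prime p" "m > 0" shows "coprime b (int p ^ m) \<longleftrightarrow> \<not> int p dvd b"
proof -
  have p: "Factorial_Ring.prime (int p)" using assms by simp
  have "coprime b (int p) \<longleftrightarrow> \<not> int p dvd b"
    using prime_imp_coprime[OF p, of b] p
    by (metis coprime_absorb_right coprime_commute not_prime_unit)
  then show ?thesis using assms by simp
qed

lemma sum_unit_res_eq:
  assumes "Factorial_Ring.prime p" "m > 0"
  shows "(\<Sum>b\<in>unit_res p m. b ^ n) = (\<Sum>a=1..p^m. int a ^ n) - int p ^ n * (\<Sum>a=1..p^(m-1). int a ^ n)"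
proof -
  have p: "p > 1" using assms prime_gt_1_nat by blast
  have "(\<Sum>b\<in>unit_res p m. b ^ n) = (\<Sum>a\<in>{a\<in>{1..p^m}. \<not> p dvd a}. int a ^ n)"
  proof (rule sum.reindex_bij_witness[of _ int nat])
    fix b assume b: "b \<in> unit_res p m"
    then have b': "\<not> int p dvd b" "b \<ge> 0" "b < int p ^ m"
      using coprime_prime_power_int[OF assms] by (auto simp: unit_res_def)
    then have "b \<noteq> 0" by auto
    have "nat b < p ^ m" using b' by (simp add: nat_less_iff)
    moreover have "\<not> p dvd nat b" using b' by (simp add: int_dvd_int_iff[symmetric] del: int_dvd_int_iff)
    ultimately show "nat b \<in> {a \<in> {1..p ^ m}. \<not> p dvd a}" using b' \<open>b \<noteq> 0\<close> by auto
    show "int (nat b) = b" "int (nat b) ^ n = b ^ n" using b' by auto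
  next
    fix a assume a: "a \<in> {a \<in> {1..p ^ m}. \<not> p dvd a}"
    have "a \<noteq> p ^ m" using a assms by auto
    then have "a < p ^ m" using a by auto
    then have "int a < int p ^ m" by (simp flip: of_nat_power)
    then show "int a \<in> unit_res p m"
      using a coprime_prime_power_int[OF assms, of "int a"] by (auto simp: unit_res_def)
  qed auto
  moreover have "(\<Sum>a=1..p^m. int a ^ n) = (\<Sum>a\<in>{a\<in>{1..p^m}. \<not> p dvd a}. int a ^ n) + (\<Sum>a\<in>{a\<in>{1..p^m}. p dvd a}. int a ^ n)"
    by (subst sum.union_disjoint[symmetric]) (auto intro: sum.cong)
  moreover have "(\<Sum>a\<in>{a\<in>{1..p^m}. p dvd a}. int a ^ n) = (\<Sum>a=1..p^(m-1). int p ^ n * int a ^ n)"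
  proof (rule sum.reindex_bij_witness[of _ "\<lambda>a. p * a" "\<lambda>a. a div p"])
    have pm: "p ^ m = p * p ^ (m - 1)" using assms by (simp add: power_eq_if)
    fix a assume a: "a \<in> {a\<in>{1..p^m}. p dvd a}"
    then show "p * (a div p) = a" by simp
    from a obtain c where "a = p * c" by auto
    then show "a div p \<in> {1..p ^ (m - 1)}" using a p unfolding pm by auto
    show "int p ^ n * int (a div p) ^ n = int a ^ n"
      using \<open>p * (a div p) = a\<close> by (metis of_nat_mult power_mult_distrib)
  next
    have pm: "p ^ m = p * p ^ (m - 1)" using assms by (simp add: power_eq_if)
    fix a assume "a \<in> {1..p^(m-1)}"
    then show "p * a \<in> {a\<in>{1..p^m}. p dvd a}" using p unfolding pm by auto
    show "p * a div p = a" using p by simp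
  qed
  ultimately show ?thesis by (simp add: sum_distrib_left)
qed

text \<open>The multiples of \<open>p\<close> contribute \<open>p ^ n\<close> times the power sum up to \<open>p ^ (m - 1)\<close>. Their removal
  is the source of the Euler factor \<open>1 - p ^ (n - 1)\<close>.\<close>

lemma unit_power_sum_approx:
  assumes "Factorial_Ring.prime p" "n \<ge> 1"
  shows "\<exists>D>0. \<forall>m\<ge>1. \<exists>k. of_int D * (of_int (\<Sum>b\<in>unit_res p m. b ^ n) - bern n * (1 - of_nat p ^ (n - 1)) * of_nat p ^ m)
      = (of_int (int p ^ (2 * m) * k) :: rat)"
proof -
  obtain D k where D: "D > 0" "\<And>N. of_int D * (of_int (\<Sum>a=1..N. int a ^ n) - bern n * of_nat N) = of_int (int N ^ 2 * k N)"
    using lin_approx_power_sum[of n] unfolding lin_approx_def by metis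
  have p: "p > 0" using assms prime_gt_0_nat by blast
  show ?thesis
  proof (rule exI[of _ "D * int p ^ 2"], intro conjI allI impI)
    fix m :: nat assume m: "m \<ge> 1"
    then obtain l where l: "m = Suc l" by (cases m) auto
    obtain n' where n': "n = Suc n'" using assms by (cases n) auto
    let ?s = "\<lambda>N. of_int (\<Sum>a=1..N. int a ^ n) :: rat"
    have "of_int (D * int p ^ 2) * (of_int (\<Sum>b\<in>unit_res p m. b ^ n) - bern n * (1 - of_nat p ^ (n - 1)) * of_nat p ^ m)
      = of_int (int p ^ 2) * (of_int D * (?s (p ^ m) - bern n * of_nat (p ^ m)))
       - of_int (int p ^ 2) * of_nat p ^ n * (of_int D * (?s (p ^ (m-1)) - bern n * of_nat (p ^ (m-1))))"
      using m by (subst sum_unit_res_eq[OF assms(1)]) (auto simp: algebra_simps l n')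
    also have "\<dots> = of_int (int p ^ (2*m) * (int p ^ 2 * k (p ^ m) - int p ^ n * k (p ^ l)))"
      unfolding D by (simp add: l algebra_simps power2_eq_square power_mult_distrib mult_2_right power_add)
    finally show "\<exists>k. of_int (D * int p ^ 2) * (of_int (\<Sum>b\<in>unit_res p m. b ^ n) - bern n * (1 - of_nat p ^ (n - 1)) * of_nat p ^ m)
      = (of_int (int p ^ (2 * m) * k) :: rat)" ..
  qed (use D p in simp)
qed

lemma unit_power_sum_dvd:
  assumes "Factorial_Ring.prime p"
  shows "\<exists>D>0. \<forall>m\<ge>1. int p ^ m dvd D * (\<Sum>b\<in>unit_res p m. b ^ n)"
proof -
  obtain D k where D: "D > 0" "\<And>N. of_int D * (of_int (\<Sum>a=1..N. int a ^ n) - bern n * of_nat N) = of_int (int N ^ 2 * k N)"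
    using lin_approx_power_sum[of n] unfolding lin_approx_def by metis
  have p: "p > 0" using assms prime_gt_0_nat by blast
  define g where "g = D - k 1"
  have g: "of_int D * bern n = of_int g" using D(2)[of 1] by (simp add: g_def algebra_simps)
  have dv: "int N dvd D * (\<Sum>a=1..N. int a ^ n)" for N
  proof -
    have "(of_int (D * (\<Sum>a=1..N. int a ^ n)) :: rat) = of_int D * bern n * of_nat N + of_int (int N ^ 2 * k N)"
      using D(2)[of N] by (simp add: algebra_simps)
    also have "\<dots> = of_int (int N * (g + int N * k N))"
      unfolding g by (simp add: algebra_simps power2_eq_square)
    finally have "D * (\<Sum>a=1..N. int a ^ n) = int N * (g + int N * k N)"
      by (simp only: of_int_eq_iff)
    then show ?thesis by simp
  qed
  show ?thesis
  proof (rule exI[of _ "D * int p"], intro conjI allI impI)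
    fix m :: nat assume m: "m \<ge> 1"
    then obtain l where l: "m = Suc l" by (cases m) auto
    have "int p ^ l dvd int (p ^ m)" by (simp add: l)
    with dv[of "p ^ m"] have "int p ^ l dvd D * (\<Sum>a=1..p^m. int a ^ n)" by (rule dvd_trans[rotated])
    moreover have "int p ^ l dvd D * (\<Sum>a=1..p^l. int a ^ n)" using dv[of "p ^ l"] by simp
    ultimately have "int p ^ l dvd D * (\<Sum>a=1..p^m. int a ^ n) - int p ^ n * (D * (\<Sum>a=1..p^l. int a ^ n))"
      by (meson dvd_diff dvd_mult)
    also have "\<dots> = D * (\<Sum>b\<in>unit_res p m. b ^ n)"
      using m by (subst sum_unit_res_eq[OF assms(1)]) (auto simp: algebra_simps l)
    finally have "int p * int p ^ l dvd int p * (D * (\<Sum>b\<in>unit_res p m. b ^ n))" by (rule mult_dvd_mono[OF dvd_refl])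
    then show "int p ^ m dvd D * int p * (\<Sum>b\<in>unit_res p m. b ^ n)" by (simp add: l mult_ac)
  qed (use D p in simp)
qed

section \<open>Measures on the \<open>p\<close>-adic units and their moments\<close>

text \<open>A measure on the units of \<open>\<int>\<^sub>p\<close>, recorded at level \<open>m\<close> only modulo \<open>p ^ m\<close>. This is the limit of
  the group rings of \<open>(\<int>/p\<^sup>m)\<^sup>\<times>\<close> over \<open>\<int>/p\<^sup>m\<close>, which is the same as the limit over \<open>\<int>\<^sub>p\<close>.\<close>

definition coherent :: "nat \<Rightarrow> (nat \<Rightarrow> int \<Rightarrow> int) \<Rightarrow> bool" where
  "coherent p e \<longleftrightarrow> (\<forall>m. \<forall>b\<in>unit_res p m.
     [(\<Sum>b'\<in>{b'\<in>unit_res p (Suc m). b' mod int p ^ m = b}. e (Suc m) b') = e m b] (mod int p ^ m))"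

lemma unit_res_mod_le:
  assumes "k \<le> m" "b \<in> unit_res p m" "p > 0" shows "b mod int p ^ k \<in> unit_res p k"
proof (rule unit_res_mod)
  have "int p ^ k dvd int p ^ m" using assms by (simp add: le_imp_power_dvd)
  moreover have "coprime b (int p ^ m)" using assms by (simp add: unit_res_def)
  ultimately show "coprime b (int p ^ k)" by (rule coprime_divisors[OF dvd_refl])
qed fact

lemma mod_power_mod_power:
  assumes "k \<le> m" shows "(b::int) mod int p ^ m mod int p ^ k = b mod int p ^ k"
  using assms by (simp add: mod_mod_cancel le_imp_power_dvd)

lemma coherent_le:
  assumes "coherent p e" "m \<le> M" "b \<in> unit_res p m" "p > 0"
  shows "[(\<Sum>b'\<in>{b'\<in>unit_res p M. b' mod int p ^ m = b}. e M b') = e m b] (mod int p ^ m)"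
  using assms(2)
proof (induction M rule: dec_induct)
  case base
  have "{b' \<in> unit_res p m. b' mod int p ^ m = b} = {b}"
    using assms(3) by (auto simp: unit_res_def)
  then show ?case by simp
next
  case (step M)
  let ?A = "{b'\<in>unit_res p M. b' mod int p ^ m = b}"
  let ?B = "{b'\<in>unit_res p (Suc M). b' mod int p ^ m = b}"
  have "sum (e (Suc M)) ?B = (\<Sum>c\<in>?A. sum (e (Suc M)) {b'\<in>?B. b' mod int p ^ M = c})"
  proof (rule sum.group[symmetric])
    show "(\<lambda>b'. b' mod int p ^ M) ` ?B \<subseteq> ?A"
    proof safe
      fix b' assume "b' \<in> unit_res p (Suc M)"
      then show "b' mod int p ^ M \<in> unit_res p M" using assms(4) by (rule unit_res_mod_le[rotated]) simp
      show "b' mod int p ^ M mod int p ^ m = b' mod int p ^ m"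
        using step by (intro mod_power_mod_power)
    qed
  qed auto
  also have "\<dots> = (\<Sum>c\<in>?A. sum (e (Suc M)) {b'\<in>unit_res p (Suc M). b' mod int p ^ M = c})"
  proof (intro sum.cong refl arg_cong[where f = "sum (e (Suc M))"])
    fix c assume "c \<in> ?A"
    then show "{b'\<in>?B. b' mod int p ^ M = c} = {b'\<in>unit_res p (Suc M). b' mod int p ^ M = c}"
      using mod_power_mod_power[of m M _ p] step by force
  qed
  also have "[\<dots> = (\<Sum>c\<in>?A. e M c)] (mod int p ^ m)"
  proof (rule cong_sum)
    fix c assume "c \<in> ?A"
    then have "[sum (e (Suc M)) {b'\<in>unit_res p (Suc M). b' mod int p ^ M = c} = e M c] (mod int p ^ M)"
      using assms(1) by (auto simp: coherent_def)
    then show "[sum (e (Suc M)) {b'\<in>unit_res p (Suc M). b' mod int p ^ M = c} = e M c] (mod int p ^ m)"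
      by (rule cong_dvd_modulus) (use step in \<open>simp add: le_imp_power_dvd\<close>)
  qed
  also have "[(\<Sum>c\<in>?A. e M c) = e m b] (mod int p ^ m)" by (rule step.IH)
  finally show ?case .
qed

lemma prime_power_dvd_choose:
  assumes "Factorial_Ring.prime p" "q = p ^ m" "q dvd t" "0 < j" "j < q"
  shows "p dvd (t choose j)"
proof (rule ccontr)
  assume "\<not> p dvd (t choose j)"
  then have "coprime q (t choose j)"
    using assms by (simp add: prime_imp_coprime)
  obtain j' where j': "j = Suc j'" using assms by (cases j) auto
  have "j * (t choose j) = t * ((t - 1) choose j')"
    using binomial_absorption[of j' t] by (simp add: j')
  then have "q dvd j * (t choose j)" using assms by simp
  with \<open>coprime q _\<close> have "q dvd j" by (simp add: coprime_dvd_mult_left_iff)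
  then show False using assms by (auto dest: dvd_imp_le)
qed

lemma prime_dvd_choose_pred_iff:
  assumes "Factorial_Ring.prime p" "q = p ^ m" "t > 0"
  shows "p dvd ((t - 1) choose (q - 1)) \<longleftrightarrow> \<not> q dvd t"
proof
  assume "\<not> q dvd t"
  have q: "q > 0" using assms prime_gt_0_nat by simp
  show "p dvd ((t - 1) choose (q - 1))"
  proof (rule ccontr)
    assume "\<not> p dvd ((t - 1) choose (q - 1))"
    then have "coprime q ((t - 1) choose (q - 1))"
      using assms by (simp add: prime_imp_coprime)
    moreover have "q * (t choose q) = t * ((t - 1) choose (q - 1))"
      using binomial_absorption[of "q - 1" t] q by simp
    then have "q dvd t * ((t - 1) choose (q - 1))" by (metis dvd_triv_left)
    ultimately have "q dvd t" by (simp add: coprime_dvd_mult_left_iff)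
    then show False using \<open>\<not> q dvd t\<close> by simp
  qed
next
  assume dv: "p dvd ((t - 1) choose (q - 1))"
  have q: "q > 0" using assms prime_gt_0_nat by simp
  show "\<not> q dvd t"
  proof
    assume "q dvd t"
    have "\<not> p dvd ((t - 1) choose j)" if "j < q" for j
      using that
    proof (induction j)
      case 0
      then show ?case using assms prime_gt_1_nat[of p] by simp
    next
      case (Suc j)
      have "t choose Suc j = ((t - 1) choose j) + ((t - 1) choose Suc j)"
        using assms(3) by (metis binomial_Suc_Suc Suc_pred')
      moreover have "p dvd (t choose Suc j)"
        using prime_power_dvd_choose[OF assms(1,2) \<open>q dvd t\<close>] Suc by simp
      ultimately show ?case using Suc by (metis Suc_lessD dvd_add_left_iff)
    qed
    then show False using dv q by simp
  qed
qed

text \<open>Modulo \<open>p\<close> the polynomial \<open>(t - 1) choose (p ^ m - 1)\<close> in \<open>t\<close> is non-zero exactly on the multiples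
  of \<open>p ^ m\<close>; a large power of it, chosen by Euler's theorem, is the characteristic function of that
  residue class modulo \<open>p ^ m\<close>.\<close>

lemma choose_power_indicator:
  assumes "Factorial_Ring.prime p" "m > 0" "t > 0"
  shows "[int (((t - 1) choose (p ^ m - 1)) ^ (m * totient (p ^ m))) = (if p ^ m dvd t then 1 else 0)] (mod int p ^ m)"
proof -
  have tp: "totient (p ^ m) > 0" using assms prime_gt_0_nat by simp
  let ?B = "(t - 1) choose (p ^ m - 1)"
  have "[?B ^ (m * totient (p ^ m)) = (if p ^ m dvd t then 1 else 0)] (mod p ^ m)"
  proof (cases "p ^ m dvd t")
    case True
    then have "\<not> p dvd ?B" using prime_dvd_choose_pred_iff[OF assms(1) refl assms(3)] by auto
    then have "coprime ?B (p ^ m)"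
      using assms by (simp add: prime_imp_coprime coprime_commute)
    then have "[?B ^ totient (p ^ m) = 1] (mod p ^ m)" by (rule euler_theorem)
    then have "[(?B ^ totient (p ^ m)) ^ m = 1 ^ m] (mod p ^ m)" by (rule cong_pow)
    then show ?thesis using True by (simp add: power_mult[symmetric] mult.commute)
  next
    case False
    then have "p dvd ?B" using prime_dvd_choose_pred_iff[OF assms(1) refl assms(3)] by auto
    then have "p ^ (m * totient (p ^ m)) dvd ?B ^ (m * totient (p ^ m))" by (rule dvd_power_same)
    moreover have "p ^ m dvd p ^ (m * totient (p ^ m))"
    proof (rule le_imp_power_dvd)
      have "1 \<le> totient (p ^ m)" using tp by linarith
      from mult_le_mono2[OF this, of m] show "m \<le> m * totient (p ^ m)" by (simp only: mult_1_right)
    qed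
    ultimately have "p ^ m dvd ?B ^ (m * totient (p ^ m))" by (rule dvd_trans[rotated])
    then show ?thesis using False by (simp add: cong_0_iff)
  qed
  then show ?thesis by (subst (asm) cong_int_iff[symmetric]) (simp split: if_splits)
qed

lemma fact_mult_choose_eq_prod:
  "fact k * int (n choose k) = (\<Prod>i<k. int n - int i)"
proof -
  have "(of_int (fact k * int (n choose k)) :: rat) = fact k * (of_nat n gchoose k)"
    by (simp add: binomial_gbinomial)
  also have "\<dots> = of_int (\<Prod>i<k. int n - int i)"
    by (simp add: gbinomial_prod_rev lessThan_atLeast0)
  finally show ?thesis by (simp only: of_int_eq_iff)
qed

lemma sum_poly_cong_0:
  fixes P :: "int poly"
  assumes "\<And>n. [(\<Sum>b\<in>A. d b * b ^ n) = 0] (mod q)"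
  shows "[(\<Sum>b\<in>A. d b * poly P b) = 0] (mod q)"
proof -
  have "(\<Sum>b\<in>A. d b * poly P b) = (\<Sum>i\<le>degree P. coeff P i * (\<Sum>b\<in>A. d b * b ^ i))"
    unfolding poly_altdef sum_distrib_left by (subst sum.swap) (simp add: mult_ac)
  also have "[\<dots> = (\<Sum>i\<le>degree P. coeff P i * 0)] (mod q)"
    by (intro cong_sum cong_mult cong_refl assms)
  finally show ?thesis by simp
qed

text \<open>Integrating the polynomial approximation of the characteristic function of \<open>b + p ^ m \<int>\<^sub>p\<close>
  recovers \<open>d m b\<close>. The polynomial has denominators, namely the power \<open>c\<close> of a factorial; they are
  harmless because the moments vanish modulo \<open>p ^ M\<close> for every \<open>M\<close>.\<close>

theorem moments_separate:
  assumes p: "Factorial_Ring.prime p" and coh: "coherent p d"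
    and moment: "\<And>n m. [(\<Sum>b\<in>unit_res p m. d m b * b ^ n) = 0] (mod int p ^ m)"
    and b: "b \<in> unit_res p m"
  shows "[d m b = 0] (mod int p ^ m)"
proof (cases "m = 0")
  case False
  have p0: "p > 0" using p prime_gt_0_nat by blast
  define q where "q = p ^ m"
  define w where "w = m * totient q"
  define c :: int where "c = fact (q - 1) ^ w"
  define v where "v = multiplicity (int p) c"
  \<comment> \<open>Deep enough to lose the power \<open>p ^ v\<close> in the denominator and still keep \<open>m\<close> digits.\<close>
  define M where "M = v + m"
  have "c \<noteq> 0" by (simp add: c_def)
  \<comment> \<open>The summand \<open>p ^ M\<close> makes the argument of the binomial coefficient positive.\<close>
  define t where "t = (\<lambda>a. nat (a - b + int p ^ M))"
  have bM: "b < int p ^ M"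
  proof -
    have "int p ^ m \<le> int p ^ M" using p0 by (intro power_increasing) (auto simp: M_def)
    then show ?thesis using b by (auto simp: unit_res_def)
  qed
  have t: "int (t a) = a - b + int p ^ M" "t a > 0" if "a \<in> unit_res p M" for a
    using that bM by (auto simp: t_def unit_res_def)
  have qt: "q dvd t a \<longleftrightarrow> a mod int p ^ m = b" if "a \<in> unit_res p M" for a
  proof -
    have "q dvd t a \<longleftrightarrow> int p ^ m dvd a - b + int p ^ M"
      using t[OF that] by (metis int_dvd_int_iff of_nat_power q_def)
    also have "\<dots> \<longleftrightarrow> int p ^ m dvd a - b"
      by (rule dvd_add_left_iff) (simp add: M_def le_imp_power_dvd)
    also have "\<dots> \<longleftrightarrow> a mod int p ^ m = b mod int p ^ m" by (simp add: mod_eq_dvd_iff)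
    also have "b mod int p ^ m = b" using b by (auto simp: unit_res_def)
    finally show ?thesis .
  qed
  define P :: "int poly" where "P = (\<Prod>i<q - 1. [: - b + int p ^ M - 1 - int i, 1:]) ^ w"
  define I where "I = (\<lambda>a. int (((t a - 1) choose (q - 1)) ^ w))"
  have P: "poly P a = c * I a" if a: "a \<in> unit_res p M" for a
  proof -
    have "int (t a - 1) = a - b + int p ^ M - 1" using t[OF a] by linarith
    then have "poly [: - b + int p ^ M - 1 - int i, 1:] a = int (t a - 1) - int i" for i
      unfolding poly_pCons poly_0 mult_zero_right add_0_right mult_1_right by linarith
    then have "poly P a = (\<Prod>i<q - 1. int (t a - 1) - int i) ^ w"
      by (simp only: P_def poly_power poly_prod)
    also have "(\<Prod>i<q - 1. int (t a - 1) - int i) = fact (q - 1) * int ((t a - 1) choose (q - 1))"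
      by (rule fact_mult_choose_eq_prod[symmetric])
    also have "(fact (q - 1) * int ((t a - 1) choose (q - 1))) ^ w = c * I a"
      unfolding c_def I_def by (simp only: power_mult_distrib of_nat_power)
    finally show ?thesis .
  qed
  have "[(\<Sum>a\<in>unit_res p M. d M a * poly P a) = 0] (mod int p ^ M)"
    by (rule sum_poly_cong_0) (rule moment)
  also have "(\<Sum>a\<in>unit_res p M. d M a * poly P a) = c * (\<Sum>a\<in>unit_res p M. d M a * I a)"
    unfolding sum_distrib_left by (intro sum.cong refl) (simp only: P mult.left_commute)
  finally have dv: "int p ^ M dvd c * (\<Sum>a\<in>unit_res p M. d M a * I a)" by (simp add: cong_0_iff)
  obtain c' where c': "c = int p ^ v * c'" "\<not> int p dvd c'"
  proof -
    have "\<not> is_unit (int p)" using p not_prime_unit[of "int p"] by auto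
    from multiplicity_decompose'[OF \<open>c \<noteq> 0\<close> this] show ?thesis using that unfolding v_def by blast
  qed
  have "int p ^ m dvd c' * (\<Sum>a\<in>unit_res p M. d M a * I a)"
    using dv p0 unfolding c' M_def power_add mult.assoc by simp
  moreover have "coprime (int p ^ m) c'"
    using c' p by (simp add: prime_imp_coprime)
  ultimately have "int p ^ m dvd (\<Sum>a\<in>unit_res p M. d M a * I a)"
    by (simp add: coprime_dvd_mult_right_iff)
  then have "[0 = (\<Sum>a\<in>unit_res p M. d M a * I a)] (mod int p ^ m)"
    by (subst cong_sym_eq) (simp only: cong_0_iff)
  also have "[(\<Sum>a\<in>unit_res p M. d M a * I a) = (\<Sum>a\<in>unit_res p M. d M a * (if q dvd t a then 1 else 0))] (mod int p ^ m)"
    unfolding I_def w_def q_def using False p t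
    by (intro cong_sum cong_mult cong_refl choose_power_indicator) auto
  also have "(\<Sum>a\<in>unit_res p M. d M a * (if q dvd t a then 1 else 0)) = (\<Sum>a\<in>{a\<in>unit_res p M. a mod int p ^ m = b}. d M a)"
    using qt by (subst sum.inter_filter) (auto intro!: sum.cong)
  also have "[\<dots> = d m b] (mod int p ^ m)"
    by (rule coherent_le[OF coh _ b p0]) (simp add: M_def)
  finally show ?thesis by (rule cong_sym)
qed simp

section \<open>The regularised Bernoulli measure\<close>

text \<open>The first Bernoulli distribution regularised by \<open>c = 1 + p\<close>: with \<open>c a = b + p ^ m t\<close> its value at \<open>b\<close> is
  \<open>c B\<^sub>1(a / p ^ m) - B\<^sub>1(b / p ^ m) = t - p / 2\<close>. The integer \<open>(p ^ m + 1) / 2\<close> stands for the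
  \<open>p\<close>-adic integer \<open>1 / 2\<close> modulo \<open>p ^ m\<close>. The sum has a single term; writing it as a sum avoids
  naming the inverse of \<open>c\<close> modulo \<open>p ^ m\<close>.\<close>

definition bern_meas :: "nat \<Rightarrow> nat \<Rightarrow> int \<Rightarrow> int" where
  "bern_meas p m b = (\<Sum>a\<in>{a\<in>unit_res p m. (1 + int p) * a mod int p ^ m = b}.
     (1 + int p) * a div int p ^ m - int p * (int p ^ m + 1) div 2)"

lemma sum_div_hermite:
  assumes "p > 0" shows "(\<Sum>i<p. (x + int i) div int p) = x"
proof -
  have *: "(\<Sum>i<p. (x + 1 + int i) div int p) = (\<Sum>i<p. (x + int i) div int p) + 1" for x
  proof -
    have "(\<Sum>i<p. (x + 1 + int i) div int p) + x div int p = (\<Sum>i<Suc p. (x + int i) div int p)"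
      by (subst sum.lessThan_Suc_shift) (simp add: algebra_simps)
    also have "\<dots> = (\<Sum>i<p. (x + int i) div int p) + (x div int p + 1)" using assms by simp
    finally show ?thesis by simp
  qed
  show ?thesis
  proof (induction x rule: int_induct[where k = 0])
    case base then show ?case by simp
  next
    case (step1 i) then show ?case using *[of i] by simp
  next
    case (step2 i) then show ?case using *[of "i - 1"] by simp
  qed
qed

lemma unit_res_Suc_fibre:
  assumes "Factorial_Ring.prime p" "m > 0" "a \<in> unit_res p m"
  shows "bij_betw (\<lambda>i. a + int i * int p ^ m) {..<p} {a'\<in>unit_res p (Suc m). a' mod int p ^ m = a}"
proof (rule bij_betwI[where g = "\<lambda>a'. nat (a' div int p ^ m)"])
  have p: "p > 0" using assms prime_gt_0_nat by blast
  let ?q = "int p ^ m"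
  have q: "?q > 0" using p by simp
  have a: "0 \<le> a" "a < ?q" "\<not> int p dvd a"
    using assms coprime_prime_power_int[OF assms(1,2)] by (auto simp: unit_res_def)
  show "(\<lambda>i. a + int i * ?q) \<in> {..<p} \<rightarrow> {a'\<in>unit_res p (Suc m). a' mod ?q = a}"
  proof
    fix i assume "i \<in> {..<p}"
    then have "int i + 1 \<le> int p" by simp
    then have "(int i + 1) * ?q \<le> int p * ?q" using q by (intro mult_right_mono) auto
    then have "a + int i * ?q < int p ^ Suc m" using a by (simp add: algebra_simps)
    moreover have "int p dvd int i * ?q" using assms by (simp add: dvd_power)
    then have "\<not> int p dvd a + int i * ?q" using a by (simp add: dvd_add_left_iff)
    ultimately show "a + int i * ?q \<in> {a'\<in>unit_res p (Suc m). a' mod ?q = a}"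
      using a coprime_prime_power_int[OF assms(1), of "Suc m"] by (simp add: unit_res_def del: power_Suc)
  qed
  show "(\<lambda>a'. nat (a' div ?q)) \<in> {a'\<in>unit_res p (Suc m). a' mod ?q = a} \<rightarrow> {..<p}"
  proof
    fix a' assume "a' \<in> {a'\<in>unit_res p (Suc m). a' mod ?q = a}"
    then have "0 \<le> a'" "a' < int p * ?q" by (auto simp: unit_res_def)
    moreover have "a' div ?q * ?q \<le> a'" using div_mult_mod_eq[of a' ?q] pos_mod_sign[OF q, of a'] by linarith
    ultimately have "a' div ?q * ?q < int p * ?q" by linarith
    then have "a' div ?q < int p" using q by (simp only: mult_less_cancel_right)
    then show "nat (a' div ?q) \<in> {..<p}" using p by (simp add: nat_less_iff)
  qed
  show "nat ((a + int i * ?q) div ?q) = i" if "i \<in> {..<p}" for i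
    using a q by simp
  show "a + int (nat (a' div ?q)) * ?q = a'" if "a' \<in> {a'\<in>unit_res p (Suc m). a' mod ?q = a}" for a'
    using that q mod_div_mult_eq[of a' ?q] by (auto simp: unit_res_def pos_imp_zdiv_nonneg_iff)
qed

text \<open>Over the lifts \<open>a + i p ^ m\<close> the quotients are \<open>i + \<lfloor>(t + i) / p\<rfloor>\<close>, and Hermite's identity adds
  them up.\<close>

lemma coherent_bern_meas:
  assumes p: "Factorial_Ring.prime p" and odd: "odd p"
  shows "coherent p (bern_meas p)"
  unfolding coherent_def
proof (intro allI ballI)
  fix m b assume b: "b \<in> unit_res p m"
  have p0: "p > 0" using p prime_gt_0_nat by blast
  show "[(\<Sum>b'\<in>{b'\<in>unit_res p (Suc m). b' mod int p ^ m = b}. bern_meas p (Suc m) b') = bern_meas p m b] (mod int p ^ m)"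
  proof (cases "m = 0")
    case False
    let ?q = "int p ^ m"
    have q: "?q > 0" using p0 by simp
    define h where "h = (\<lambda>m. int p * (int p ^ m + 1) div 2)"
    have h: "2 * h m = int p * (int p ^ m + 1)" for m
      using odd by (simp add: h_def)
    let ?B = "{b'\<in>unit_res p (Suc m). b' mod ?q = b}"
    let ?A = "{a\<in>unit_res p m. (1 + int p) * a mod ?q = b}"
    let ?A' = "{a\<in>unit_res p (Suc m). (1 + int p) * a mod ?q = b}"
    let ?f = "\<lambda>a. (1 + int p) * a div int p ^ Suc m - h (Suc m)"
    have cop: "coprime ((1 + int p) * a) (int p ^ k)" if "a \<in> unit_res p k" for a k
    proof -
      have "coprime (1 + int p) (int p)"
        using coprime_add_one_left[of "int p"] by (simp only: add.commute)
      then show ?thesis using that by (auto simp: unit_res_def)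
    qed
    have "(\<Sum>b'\<in>?B. bern_meas p (Suc m) b') = (\<Sum>b'\<in>?B. sum ?f {a\<in>?A'. (1 + int p) * a mod int p ^ Suc m = b'})"
      unfolding bern_meas_def h_def
    proof (intro sum.cong refl)
      fix b' a assume "b' \<in> ?B"
      then show "{a \<in> unit_res p (Suc m). (1 + int p) * a mod int p ^ Suc m = b'} = {a\<in>?A'. (1 + int p) * a mod int p ^ Suc m = b'}"
        using mod_power_mod_power[of m "Suc m" _ p] by force
    qed
    also have "\<dots> = sum ?f ?A'"
    proof (rule sum.group)
      have "(1 + int p) * a mod int p ^ Suc m \<in> unit_res p (Suc m)" if "a \<in> unit_res p (Suc m)" for a
        using cop[OF that] p0 by (rule unit_res_mod[rotated])
      then show "(\<lambda>a. (1 + int p) * a mod int p ^ Suc m) ` ?A' \<subseteq> ?B"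
        by (auto simp only: mod_power_mod_power[OF le_SucI[OF le_refl]])
    qed auto
    also have "\<dots> = (\<Sum>a\<in>?A. sum ?f {a'\<in>?A'. a' mod ?q = a})"
    proof (rule sum.group[symmetric])
      show "(\<lambda>a'. a' mod ?q) ` ?A' \<subseteq> ?A"
        using unit_res_mod_le[of m "Suc m" _ p] p0 by (auto simp: mod_mult_right_eq simp del: power_Suc)
    qed auto
    also have "\<dots> = (\<Sum>a\<in>?A. (1 + int p) * a div ?q + int p * (int p - 1) div 2 - int p * h (Suc m))"
    proof (rule sum.cong)
      fix a assume a: "a \<in> ?A"
      have "{a'\<in>?A'. a' mod ?q = a} = {a'\<in>unit_res p (Suc m). a' mod ?q = a}"
      proof safe
        fix a' assume "a = a' mod ?q"
        moreover have "(1 + int p) * a mod ?q = b" using a by simp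
        ultimately show "(1 + int p) * a' mod ?q = b" by (simp only: mod_mult_right_eq)
      qed
      then have "sum ?f {a'\<in>?A'. a' mod ?q = a} = (\<Sum>i<p. ?f (a + int i * ?q))"
        using unit_res_Suc_fibre[OF p _ , of m a] a False by (simp add: sum.reindex_bij_betw[symmetric])
      also have "\<dots> = (\<Sum>i<p. ((1 + int p) * a div ?q + int i) div int p + int i - h (Suc m))"
      proof (intro sum.cong refl)
        fix i assume "i \<in> {..<p}"
        have "(1 + int p) * (a + int i * ?q) div int p ^ Suc m = ((1 + int p) * (a + int i * ?q) div ?q) div int p"
          unfolding power_Suc mult.commute[of "int p"] by (rule zdiv_zmult2_eq) simp
        also have E: "(1 + int p) * (a + int i * ?q) = (1 + int p) * a + ((1 + int p) * int i) * ?q"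
          by (simp add: algebra_simps)
        also have "\<dots> div ?q = (1 + int p) * a div ?q + int i + int i * int p"
        proof -
          have "?q \<noteq> 0" using q by linarith
          from div_mult_self1[OF this, of "(1 + int p) * a" "(1 + int p) * int i"]
          moreover have "(1 + int p) * int i = int i + int i * int p" by (simp add: algebra_simps)
          ultimately show ?thesis by linarith
        qed
        also have "\<dots> div int p = ((1 + int p) * a div ?q + int i) div int p + int i"
          using p0 by (subst div_mult_self1) auto
        finally show "?f (a + int i * ?q) = ((1 + int p) * a div ?q + int i) div int p + int i - h (Suc m)"
          unfolding E by linarith
      qed
      also have "\<dots> = (1 + int p) * a div ?q + (\<Sum>i<p. int i) - int p * h (Suc m)"
        by (simp add: sum.distrib sum_subtractf sum_div_hermite p0)
      also have "(\<Sum>i<p. int i) = int p * (int p - 1) div 2"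
      proof -
        have "2 * (\<Sum>i<p. int i) = int p * (int p - 1)" by (induction p) (auto simp: algebra_simps)
        then show ?thesis by simp
      qed
      finally show "sum ?f {a'\<in>?A'. a' mod ?q = a} = (1 + int p) * a div ?q + int p * (int p - 1) div 2 - int p * h (Suc m)" .
    qed simp
    finally have e1: "(\<Sum>b'\<in>?B. bern_meas p (Suc m) b') =
      (\<Sum>a\<in>?A. (1 + int p) * a div ?q + int p * (int p - 1) div 2 - int p * h (Suc m))" .
    have e2: "[(\<Sum>a\<in>?A. (1 + int p) * a div ?q + int p * (int p - 1) div 2 - int p * h (Suc m)) =
      (\<Sum>a\<in>?A. (1 + int p) * a div ?q - h m)] (mod ?q)"
    proof (rule cong_sum)
      fix a
      have e: "2 * (int p * (int p - 1) div 2) = int p * (int p - 1)"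
        by (rule dvd_mult_div_cancel) simp
      have cancel2: "2 * A = 2 * C \<Longrightarrow> A = C" for A C :: int by linarith
      have shift: "A - H' + H = R \<Longrightarrow> (C + A - H') - (C - H) = R" for A H H' R C :: int by linarith
      have gen: "2 * (A - P * H' + H) = 2 * A - P * (2 * H') + 2 * H" for A P H H' :: int
        by (simp only: right_diff_distrib distrib_left mult.left_commute)
      have "odd (int p)" using odd by simp
      then obtain l where l: "int p = 2 * l + 1" by (rule oddE)
      define r where "r = - 2 * l * (l + 1)"
      have r: "1 - int p ^ 2 = 2 * r" unfolding l r_def power2_eq_square by (simp only: ring_distribs)
      have "2 * (int p * (int p - 1) div 2 - int p * h (Suc m) + h m) =
         2 * (int p * (int p - 1) div 2) - int p * (2 * h (Suc m)) + 2 * h m"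
        by (rule gen)
      also have "\<dots> = int p * (1 - int p ^ 2) * ?q"
        unfolding h e by (simp add: algebra_simps power2_eq_square)
      also have "\<dots> = 2 * (int p * r * ?q)" unfolding r by (simp only: mult_ac)
      finally have "int p * (int p - 1) div 2 - int p * h (Suc m) + h m = int p * r * ?q"
        by (rule cancel2)
      then have D: "((1 + int p) * a div ?q + int p * (int p - 1) div 2 - int p * h (Suc m)) - ((1 + int p) * a div ?q - h m) = int p * r * ?q"
        by (rule shift)
      have E: "[x = y] (mod ?q)" if "x - y = R * ?q" for x y R :: int
        by (simp only: cong_iff_dvd_diff that dvd_triv_right)
      show "[(1 + int p) * a div ?q + int p * (int p - 1) div 2 - int p * h (Suc m) = (1 + int p) * a div ?q - h m] (mod ?q)"
        by (rule E[OF D])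
    qed
    have e3: "bern_meas p m b = (\<Sum>a\<in>?A. (1 + int p) * a div ?q - h m)"
      unfolding h_def by (rule bern_meas_def)
    show ?thesis unfolding e1 unfolding e3 by (rule e2)
  qed simp
qed

lemma mult_unit_res_bij:
  assumes "p > 0" "coprime c (int p ^ m)"
  shows "bij_betw (\<lambda>a. c * a mod int p ^ m) (unit_res p m) (unit_res p m)"
proof -
  have sub: "(\<lambda>a. c * a mod int p ^ m) ` unit_res p m \<subseteq> unit_res p m"
  proof safe
    fix a assume "a \<in> unit_res p m"
    then have "coprime (c * a) (int p ^ m)"
      using assms(2) by (simp only: coprime_mult_left_iff unit_res_def) blast
    with assms(1) show "c * a mod int p ^ m \<in> unit_res p m" by (rule unit_res_mod)
  qed
  have inj: "inj_on (\<lambda>a. c * a mod int p ^ m) (unit_res p m)"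
  proof (rule inj_onI)
    fix x y assume xy: "x \<in> unit_res p m" "y \<in> unit_res p m" "c * x mod int p ^ m = c * y mod int p ^ m"
    then have "[c * x = c * y] (mod int p ^ m)" by (simp add: cong_def)
    then have "[x = y] (mod int p ^ m)" using assms(2) by (simp only: cong_mult_lcancel)
    then show "x = y" using xy by (auto simp: unit_res_def cong_def)
  qed
  show ?thesis unfolding bij_betw_def using inj sub endo_inj_surj[OF finite_unit_res] by blast
qed

lemma power_add_mult_cong:
  "[(r + x) ^ n = r ^ n + int n * r ^ (n - 1) * x] (mod x ^ 2)" for r x :: int
proof (induction n)
  case (Suc n)
  have "[(r + x) ^ Suc n = (r + x) * (r ^ n + int n * r ^ (n - 1) * x)] (mod x ^ 2)"
    using cong_mult[OF cong_refl Suc, of "r + x"] by simp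
  also have "(r + x) * (r ^ n + int n * r ^ (n - 1) * x) = r ^ Suc n + int (Suc n) * r ^ n * x + x ^ 2 * (int n * r ^ (n - 1))"
    by (cases n) (auto simp: algebra_simps power2_eq_square)
  also have "[\<dots> = r ^ Suc n + int (Suc n) * r ^ n * x] (mod x ^ 2)"
    by (simp add: cong_iff_dvd_diff)
  finally show ?case by simp
qed simp

text \<open>Raising \<open>c a = b + p ^ m t\<close> to the \<open>n\<close>-th power modulo \<open>p ^ (2 m)\<close> and summing over the units
  gives \<open>(c ^ n - 1) * \<Sum> b ^ n = n p ^ m * \<Sum> t b ^ (n - 1)\<close>; after division by \<open>p ^ m\<close> the left-hand
  side tends to the Bernoulli number. The constant \<open>p / 2\<close> contributes a power sum that tends
  to zero.\<close>

theorem bern_meas_moment: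
  assumes p: "Factorial_Ring.prime p" and odd: "odd p" and n: "n \<ge> 1"
  shows "\<exists>D>0. \<forall>m\<ge>1. \<exists>k. of_int D * (of_nat n * of_int (\<Sum>b\<in>unit_res p m. bern_meas p m b * b ^ (n - 1))
     - ((1 + of_nat p) ^ n - 1) * (1 - of_nat p ^ (n - 1)) * bern n) = (of_int (int p ^ m * k) :: rat)"
proof -
  obtain D1 k1 where D1: "D1 > 0" "\<And>m. m \<ge> 1 \<Longrightarrow> of_int D1 * (of_int (\<Sum>b\<in>unit_res p m. b ^ n) - bern n * (1 - of_nat p ^ (n - 1)) * of_nat p ^ m)
      = (of_int (int p ^ (2 * m) * k1 m) :: rat)"
    using unit_power_sum_approx[OF p n] by metis
  obtain D2 where D2: "D2 > 0" "\<And>m. m \<ge> 1 \<Longrightarrow> int p ^ m dvd D2 * (\<Sum>b\<in>unit_res p m. b ^ (n - 1))"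
    using unit_power_sum_dvd[OF p, of "n - 1"] by metis
  have p0: "p > 0" using p prime_gt_0_nat by blast
  define c where "c = 1 + int p"
  show ?thesis
  proof (rule exI[of _ "D1 * D2"], intro conjI allI impI)
    fix m :: nat assume m: "m \<ge> 1"
    let ?q = "int p ^ m"
    have q: "?q > 0" using p0 by simp
    define h where "h = int p * (int p ^ m + 1) div 2"
    define r where "r = (\<lambda>a. c * a mod ?q)"
    define t where "t = (\<lambda>a. c * a div ?q)"
    have "coprime c (int p)"
      unfolding c_def using coprime_add_one_left[of "int p"] by (simp only: add.commute)
    then have cop: "coprime c ?q" by simp
    note bij = mult_unit_res_bij[OF p0 cop]
    have rU: "r a \<in> unit_res p m" if "a \<in> unit_res p m" for a
      using bij_betwE[OF bij] that by (auto simp: r_def)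
    have S: "(\<Sum>b\<in>unit_res p m. bern_meas p m b * b ^ (n - 1)) = (\<Sum>a\<in>unit_res p m. (t a - h) * r a ^ (n - 1))"
    proof -
      have "(\<Sum>b\<in>unit_res p m. bern_meas p m b * b ^ (n - 1)) =
        (\<Sum>b\<in>unit_res p m. \<Sum>a\<in>{a\<in>unit_res p m. r a = b}. (t a - h) * r a ^ (n - 1))"
        by (auto simp: bern_meas_def sum_distrib_right r_def t_def c_def h_def intro!: sum.cong)
      also have "\<dots> = (\<Sum>a\<in>unit_res p m. (t a - h) * r a ^ (n - 1))"
        by (rule sum.group) (use rU in auto)
      finally show ?thesis .
    qed
    have T0: "(\<Sum>a\<in>unit_res p m. r a ^ j) = (\<Sum>b\<in>unit_res p m. b ^ j)" for j
      unfolding r_def by (rule sum.reindex_bij_betw[OF bij])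
    have "[(\<Sum>a\<in>unit_res p m. (c * a) ^ n) = (\<Sum>a\<in>unit_res p m. r a ^ n + int n * r a ^ (n - 1) * (t a * ?q))] (mod ?q ^ 2)"
    proof (rule cong_sum)
      fix a
      have eq: "c * a = r a + t a * ?q" unfolding r_def t_def by (simp only: mod_div_mult_eq)
      have "?q ^ 2 dvd (t a * ?q) ^ 2" by (simp add: power_mult_distrib)
      from cong_dvd_modulus[OF power_add_mult_cong this]
      show "[(c * a) ^ n = r a ^ n + int n * r a ^ (n - 1) * (t a * ?q)] (mod ?q ^ 2)"
        unfolding eq .
    qed
    also have "(\<Sum>a\<in>unit_res p m. (c * a) ^ n) = c ^ n * (\<Sum>b\<in>unit_res p m. b ^ n)"
      by (simp add: power_mult_distrib sum_distrib_left)
    also have "(\<Sum>a\<in>unit_res p m. r a ^ n + int n * r a ^ (n - 1) * (t a * ?q)) =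
      (\<Sum>b\<in>unit_res p m. b ^ n) + ?q * (int n * (\<Sum>a\<in>unit_res p m. t a * r a ^ (n - 1)))"
      by (simp add: sum.distrib T0 sum_distrib_left mult_ac)
    finally have "\<exists>k2. c ^ n * (\<Sum>b\<in>unit_res p m. b ^ n) = 
      (\<Sum>b\<in>unit_res p m. b ^ n) + ?q * (int n * (\<Sum>a\<in>unit_res p m. t a * r a ^ (n - 1))) + ?q ^ 2 * k2"
      by (subst (asm) cong_sym_eq) (simp only: cong_iff_lin)
    then obtain k2 where k2: "c ^ n * (\<Sum>b\<in>unit_res p m. b ^ n) = 
      (\<Sum>b\<in>unit_res p m. b ^ n) + ?q * (int n * (\<Sum>a\<in>unit_res p m. t a * r a ^ (n - 1))) + ?q ^ 2 * k2" by blast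
    obtain k3 where k3: "D2 * (\<Sum>b\<in>unit_res p m. b ^ (n - 1)) = ?q * k3"
      using D2(2)[OF m] by blast
    define XX where "XX = (\<Sum>a\<in>unit_res p m. t a * r a ^ (n - 1))"
    define TT where "TT = (\<Sum>b\<in>unit_res p m. b ^ n)"
    define B where "B = bern n * (1 - of_nat p ^ (n - 1))"
    have S': "(\<Sum>b\<in>unit_res p m. bern_meas p m b * b ^ (n - 1)) = XX - h * (\<Sum>b\<in>unit_res p m. b ^ (n - 1))"
      unfolding S XX_def by (simp add: left_diff_distrib sum_subtractf sum_distrib_left[symmetric] T0)
    have D1': "of_int D1 * (of_int TT - B * of_int ?q) = (of_int (?q ^ 2 * k1 m) :: rat)"
      using D1(2)[OF m] by (simp add: TT_def B_def power_mult mult.commute)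
    have k2': "?q * (int n * XX) = (c ^ n - 1) * TT - ?q ^ 2 * k2"
      using k2 by (simp add: XX_def TT_def algebra_simps)
    have "of_int ?q * (of_int D1 * (of_nat n * of_int XX - (of_int c ^ n - 1) * B)) =
       of_int D1 * (of_int (?q * (int n * XX)) - (of_int c ^ n - 1) * (B * of_int ?q))"
      by (simp add: algebra_simps)
    also have "\<dots> = (of_int c ^ n - 1) * (of_int D1 * (of_int TT - B * of_int ?q)) - of_int (D1 * ?q ^ 2 * k2)"
      unfolding k2' by (simp add: algebra_simps)
    also have "\<dots> = of_int ?q * of_int (?q * ((c ^ n - 1) * k1 m - D1 * k2))"
      unfolding D1' by (simp add: algebra_simps power2_eq_square)
    finally have XX: "of_int D1 * (of_nat n * of_int XX - (of_int c ^ n - 1) * B) = (of_int (?q * ((c ^ n - 1) * k1 m - D1 * k2)) :: rat)"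
      using q p0 by simp
    have "of_int (D1 * D2) * (of_nat n * of_int (\<Sum>b\<in>unit_res p m. bern_meas p m b * b ^ (n - 1))
     - (of_int c ^ n - 1) * B) = of_int D2 * (of_int D1 * (of_nat n * of_int XX - (of_int c ^ n - 1) * B))
       - (of_int (D1 * int n * h * (D2 * (\<Sum>b\<in>unit_res p m. b ^ (n - 1)))) :: rat)"
      unfolding S' by (simp add: algebra_simps)
    also have "\<dots> = of_int (?q * (D2 * ((c ^ n - 1) * k1 m - D1 * k2) - D1 * int n * h * k3))"
      unfolding XX k3 by (simp add: algebra_simps)
    finally have F: "of_int (D1 * D2) * (of_nat n * of_int (\<Sum>b\<in>unit_res p m. bern_meas p m b * b ^ (n - 1))
     - (of_int c ^ n - 1) * B) = (of_int (?q * (D2 * ((c ^ n - 1) * k1 m - D1 * k2) - D1 * int n * h * k3)) :: rat)" .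
    have "((1 + of_nat p) ^ n - 1) * (1 - of_nat p ^ (n - 1)) * bern n = (of_int c ^ n - 1) * B"
      by (simp add: c_def B_def mult_ac)
    with F show "\<exists>k. of_int (D1 * D2) * (of_nat n * of_int (\<Sum>b\<in>unit_res p m. bern_meas p m b * b ^ (n - 1))
     - ((1 + of_nat p) ^ n - 1) * (1 - of_nat p ^ (n - 1)) * bern n) = (of_int (?q * k) :: rat)"
      by metis
  qed (use D1 D2 in simp)
qed

section \<open>Rings of fractions with regular denominators\<close>

locale regular_denominators = cring R for R (structure) +
  fixes S
  assumes one_S: "\<one> \<in> S" and mult_S: "s \<in> S \<Longrightarrow> t \<in> S \<Longrightarrow> s \<otimes> t \<in> S"
    and reg_S: "s \<in> S \<Longrightarrow> regular_element R s"
begin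

lemma S_carrier [simp, intro]: "s \<in> S \<Longrightarrow> s \<in> carrier R"
  using reg_S by (auto simp: regular_element_def)

lemma S_cancel: 
  assumes "s \<in> S" "x \<in> carrier R" "y \<in> carrier R" "s \<otimes> x = s \<otimes> y" shows "x = y"
proof -
  have "s \<otimes> (x \<ominus> y) = \<zero>"
  proof -
    have s: "s \<in> carrier R" using assms(1) by (rule S_carrier)
    have "s \<otimes> (x \<ominus> y) = s \<otimes> x \<ominus> s \<otimes> y"
      unfolding minus_eq using s assms(2,3) by (simp add: r_distr r_minus)
    also have "\<dots> = \<zero>" unfolding assms(4) using s assms(3) by (simp add: minus_eq r_neg)
    finally show ?thesis .
  qed
  moreover have "x \<ominus> y \<in> carrier R" using assms(2,3) by (rule minus_closed)
  ultimately have "x \<ominus> y = \<zero>" using reg_S[OF assms(1)] unfolding regular_element_def by blast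
  then show ?thesis using assms(2,3) by (simp only: r_right_minus_eq)
qed

lemma loc_rel_iff:
  "((a, s), (b, t)) \<in> loc_rel R S \<longleftrightarrow>
    a \<in> carrier R \<and> b \<in> carrier R \<and> s \<in> S \<and> t \<in> S \<and> a \<otimes> t = b \<otimes> s"
proof -
  have "(\<exists>u\<in>S. u \<otimes> (a \<otimes> t \<ominus> b \<otimes> s) = \<zero>) \<longleftrightarrow> a \<otimes> t = b \<otimes> s"
    if "a \<in> carrier R" "b \<in> carrier R" "s \<in> S" "t \<in> S"
  proof
    assume "\<exists>u\<in>S. u \<otimes> (a \<otimes> t \<ominus> b \<otimes> s) = \<zero>"
    then obtain u where u: "u \<in> S" "u \<otimes> (a \<otimes> t \<ominus> b \<otimes> s) = \<zero>" by blast
    then have "a \<otimes> t \<ominus> b \<otimes> s = \<zero>"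
      using reg_S[OF u(1)] that unfolding regular_element_def by blast
    then show "a \<otimes> t = b \<otimes> s" using that by (simp add: r_right_minus_eq)
  next
    assume "a \<otimes> t = b \<otimes> s"
    then have "\<one> \<otimes> (a \<otimes> t \<ominus> b \<otimes> s) = \<zero>" using that by (simp add: r_right_minus_eq)
    then show "\<exists>u\<in>S. u \<otimes> (a \<otimes> t \<ominus> b \<otimes> s) = \<zero>" using one_S by blast
  qed
  then show ?thesis unfolding loc_rel_def by auto
qed

lemma equiv_loc_rel: "equiv (carrier R \<times> S) (loc_rel R S)"
proof (rule equivI)
  show "loc_rel R S \<subseteq> (carrier R \<times> S) \<times> (carrier R \<times> S)"
    unfolding loc_rel_def by auto
  show "refl_on (carrier R \<times> S) (loc_rel R S)"
    by (auto simp: refl_on_def loc_rel_iff)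
  show "sym (loc_rel R S)" by (auto simp: sym_def loc_rel_iff)
  show "trans (loc_rel R S)"
  proof (rule transI, clarify)
    fix a s b t c u
    assume *: "((a, s), (b, t)) \<in> loc_rel R S" "((b, t), (c, u)) \<in> loc_rel R S"
    then have c: "a \<in> carrier R" "b \<in> carrier R" "c \<in> carrier R" "s \<in> S" "t \<in> S" "u \<in> S"
      and e: "a \<otimes> t = b \<otimes> s" "b \<otimes> u = c \<otimes> t" by (auto simp: loc_rel_iff)
    note [simp] = c S_carrier[OF c(4)] S_carrier[OF c(5)] S_carrier[OF c(6)]
    have "t \<otimes> (a \<otimes> u) = (a \<otimes> t) \<otimes> u" by (simp add: m_ac)
    also have "\<dots> = (b \<otimes> u) \<otimes> s" unfolding e(1) by (simp add: m_ac)
    also have "\<dots> = t \<otimes> (c \<otimes> s)" unfolding e(2) by (simp add: m_ac)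
    finally have "a \<otimes> u = c \<otimes> s" by (rule S_cancel[OF c(5), rotated 2]) simp_all
    then show "((a, s), (c, u)) \<in> loc_rel R S" using c by (simp add: loc_rel_iff)
  qed
qed

lemma loc_frac_eq_iff:
  assumes "a \<in> carrier R" "b \<in> carrier R" "s \<in> S" "t \<in> S"
  shows "loc_frac R S a s = loc_frac R S b t \<longleftrightarrow> a \<otimes> t = b \<otimes> s"
  unfolding loc_frac_def using assms
  by (subst eq_equiv_class_iff[OF equiv_loc_rel]) (auto simp: loc_rel_iff)

lemma carrier_localization:
  "carrier (localization R S) = {loc_frac R S a s | a s. a \<in> carrier R \<and> s \<in> S}"
  by (auto simp: localization_def quotient_def loc_frac_def)

lemma loc_map_frac:
  assumes "regular_denominators R' S'" "f \<in> ring_hom R R'" "f ` S \<subseteq> S'" "a \<in> carrier R" "s \<in> S"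
  shows "loc_map R' S' f (loc_frac R S a s) = loc_frac R' S' (f a) (f s)"
proof -
  interpret R': regular_denominators R' S' by fact
  have "loc_frac R' S' (f b) (f t) = loc_frac R' S' (f a) (f s)"
    if "((a, s), (b, t)) \<in> loc_rel R S" for b t
  proof -
    have bt: "b \<in> carrier R" "t \<in> S" "a \<otimes> t = b \<otimes> s" using that by (auto simp: loc_rel_iff)
    have "f a \<otimes>\<^bsub>R'\<^esub> f t = f b \<otimes>\<^bsub>R'\<^esub> f s"
      using arg_cong[OF bt(3), of f] bt(1,2) assms(4,5)
      by (simp add: ring_hom_mult[OF assms(2)])
    then show ?thesis
      using bt assms ring_hom_closed[OF assms(2)] by (subst R'.loc_frac_eq_iff) auto
  qed
  then have "(case x of (b, t) \<Rightarrow> loc_frac R' S' (f b) (f t)) = loc_frac R' S' (f a) (f s)"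
    if "x \<in> loc_frac R S a s" for x
    using that unfolding loc_frac_def[of R] by (cases x) simp
  then have "loc_map R' S' f (loc_frac R S a s) = (\<Union>x\<in>loc_frac R S a s. loc_frac R' S' (f a) (f s))"
    unfolding loc_map_def by (rule SUP_cong[OF refl])
  moreover have "((a, s), (a, s)) \<in> loc_rel R S" using assms(4,5) by (simp add: loc_rel_iff)
  then have "loc_frac R S a s \<noteq> {}" unfolding loc_frac_def by blast
  ultimately show ?thesis by simp
qed

end

section \<open>The ring of \<open>p\<close>-adic integers\<close>

lemma Zp_carrier_iff:
  "x \<in> carrier (Zp p) \<longleftrightarrow> (\<forall>m. x m \<in> {0..<int p ^ m}) \<and> (\<forall>m. x (Suc m) mod int p ^ m = x m)"
  by (simp add: Zp_def)

lemma Zp_ops: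
  "x \<otimes>\<^bsub>Zp p\<^esub> y = (\<lambda>m. (x m * y m) mod int p ^ m)"
  "\<one>\<^bsub>Zp p\<^esub> = (\<lambda>m. 1 mod int p ^ m)"
  "\<zero>\<^bsub>Zp p\<^esub> = (\<lambda>m. 0)"
  "x \<oplus>\<^bsub>Zp p\<^esub> y = (\<lambda>m. (x m + y m) mod int p ^ m)"
  by (simp_all add: Zp_def)

lemma Zp_mod_self: "x \<in> carrier (Zp p) \<Longrightarrow> x m mod int p ^ m = x m"
  by (simp add: Zp_carrier_iff)

lemma Zp_mod_le:
  assumes "x \<in> carrier (Zp p)" "k \<le> m" shows "x m mod int p ^ k = x k"
  using assms(2)
proof (induction m rule: dec_induct)
  case base show ?case by (rule Zp_mod_self[OF assms(1)])
next
  case (step m)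
  have "x (Suc m) mod int p ^ k = x (Suc m) mod int p ^ m mod int p ^ k"
    using step by (simp add: mod_mod_cancel le_imp_power_dvd)
  also have "x (Suc m) mod int p ^ m = x m" using assms(1) by (simp add: Zp_carrier_iff)
  finally show ?case using step by simp
qed

lemma Zp_carrierI:
  assumes "p > 0" "\<And>m. x m mod int p ^ m = x m" "\<And>m. [x (Suc m) = x m] (mod int p ^ m)"
  shows "x \<in> carrier (Zp p)"
proof -
  have "0 \<le> x m mod int p ^ m \<and> x m mod int p ^ m < int p ^ m" for m
    using assms(1) by simp
  then have "0 \<le> x m \<and> x m < int p ^ m" for m
    unfolding assms(2) .
  moreover have "x (Suc m) mod int p ^ m = x m" for m
    using assms(3)[of m] assms(2)[of m] by (simp add: cong_def)
  ultimately show ?thesis by (auto simp: Zp_carrier_iff)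
qed

lemma Zp_cong: "x \<in> carrier (Zp p) \<Longrightarrow> k \<le> m \<Longrightarrow> [x m = x k] (mod int p ^ k)"
  using Zp_mod_le Zp_mod_self by (metis cong_def)

lemma Zp_red_carrier:
  assumes "p > 0" "\<And>m. [x (Suc m) = x m] (mod int p ^ m)"
  shows "(\<lambda>m. x m mod int p ^ m) \<in> carrier (Zp p)"
proof (rule Zp_carrierI)
  fix m
  have "int p ^ m dvd int p ^ Suc m" by (rule le_imp_power_dvd) simp
  then have "x (Suc m) mod int p ^ Suc m mod int p ^ m = x (Suc m) mod int p ^ m"
    by (rule mod_mod_cancel)
  then show "[x (Suc m) mod int p ^ Suc m = x m mod int p ^ m] (mod int p ^ m)"
    using assms(2)[of m] by (simp only: cong_def mod_mod_trivial)
qed (use assms in auto)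

lemma Zp_of_int_carrier: "p > 0 \<Longrightarrow> Zp_of_int p k \<in> carrier (Zp p)"
  unfolding Zp_of_int_def by (rule Zp_red_carrier) auto

lemma Zp_cring: assumes "p > 0" shows "cring (Zp p)"
proof (rule cringI)
  note ex = Zp_red_carrier[OF assms]
  have cl_add: "x \<oplus>\<^bsub>Zp p\<^esub> y \<in> carrier (Zp p)" if "x \<in> carrier (Zp p)" "y \<in> carrier (Zp p)" for x y
    unfolding Zp_ops using that by (intro ex cong_add) (auto intro: Zp_cong)
  have cl_mult: "x \<otimes>\<^bsub>Zp p\<^esub> y \<in> carrier (Zp p)" if "x \<in> carrier (Zp p)" "y \<in> carrier (Zp p)" for x y
    unfolding Zp_ops using that by (intro ex cong_mult) (auto intro: Zp_cong)
  have z: "\<zero>\<^bsub>Zp p\<^esub> \<in> carrier (Zp p)" using ex[of "\<lambda>_. 0"] by (simp add: Zp_ops)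
  have o: "\<one>\<^bsub>Zp p\<^esub> \<in> carrier (Zp p)" using ex[of "\<lambda>_. 1"] by (simp add: Zp_ops)
  show "abelian_group (Zp p)"
  proof (rule abelian_groupI)
    fix x assume x: "x \<in> carrier (Zp p)"
    have "(\<lambda>m. (- x m) mod int p ^ m) \<in> carrier (Zp p)"
      using x by (intro ex cong_minus_minus_iff[THEN iffD2]) (auto intro: Zp_cong)
    moreover have "(\<lambda>m. (- x m) mod int p ^ m) \<oplus>\<^bsub>Zp p\<^esub> x = \<zero>\<^bsub>Zp p\<^esub>"
      unfolding Zp_ops by (auto simp: mod_add_left_eq)
    ultimately show "\<exists>y\<in>carrier (Zp p). y \<oplus>\<^bsub>Zp p\<^esub> x = \<zero>\<^bsub>Zp p\<^esub>" by blast
    show "\<zero>\<^bsub>Zp p\<^esub> \<oplus>\<^bsub>Zp p\<^esub> x = x" by (simp add: Zp_ops Zp_mod_self[OF x])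
  next
    fix x y z
    show "x \<oplus>\<^bsub>Zp p\<^esub> y \<oplus>\<^bsub>Zp p\<^esub> z = x \<oplus>\<^bsub>Zp p\<^esub> (y \<oplus>\<^bsub>Zp p\<^esub> z)"
      by (simp add: Zp_ops mod_add_left_eq mod_add_right_eq add.assoc)
    show "x \<oplus>\<^bsub>Zp p\<^esub> y = y \<oplus>\<^bsub>Zp p\<^esub> x" by (simp add: Zp_ops add.commute)
  qed (use cl_add z in auto)
  show "comm_monoid (Zp p)"
  proof (rule comm_monoidI)
    fix x y z
    show "x \<otimes>\<^bsub>Zp p\<^esub> y \<otimes>\<^bsub>Zp p\<^esub> z = x \<otimes>\<^bsub>Zp p\<^esub> (y \<otimes>\<^bsub>Zp p\<^esub> z)"
      by (simp add: Zp_ops mod_mult_left_eq mod_mult_right_eq mult.assoc)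
    show "x \<otimes>\<^bsub>Zp p\<^esub> y = y \<otimes>\<^bsub>Zp p\<^esub> x" by (simp add: Zp_ops mult.commute)
    assume x: "x \<in> carrier (Zp p)"
    show "\<one>\<^bsub>Zp p\<^esub> \<otimes>\<^bsub>Zp p\<^esub> x = x" by (simp add: Zp_ops mod_mult_left_eq Zp_mod_self[OF x])
  qed (use cl_mult o in auto)
  fix x y z
  show "(x \<oplus>\<^bsub>Zp p\<^esub> y) \<otimes>\<^bsub>Zp p\<^esub> z = x \<otimes>\<^bsub>Zp p\<^esub> z \<oplus>\<^bsub>Zp p\<^esub> y \<otimes>\<^bsub>Zp p\<^esub> z"
    by (simp add: Zp_ops mod_mult_left_eq mod_add_eq distrib_right)
qed

lemma Zp_finsum:
  assumes "p > 0" "finite A" "\<And>i. i \<in> A \<Longrightarrow> f i \<in> carrier (Zp p)"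
  shows "(\<Oplus>\<^bsub>Zp p\<^esub>i\<in>A. f i) = (\<lambda>m. (\<Sum>i\<in>A. f i m) mod int p ^ m)"
proof -
  interpret cring "Zp p" by (rule Zp_cring) fact
  show ?thesis using assms(2,3)
  proof (induction A rule: finite_induct)
    case empty then show ?case by (simp add: Zp_ops)
  next
    case (insert i A)
    then have "(\<Oplus>\<^bsub>Zp p\<^esub>i\<in>insert i A. f i) = f i \<oplus>\<^bsub>Zp p\<^esub> (\<Oplus>\<^bsub>Zp p\<^esub>i\<in>A. f i)"
      by (intro finsum_insert) auto
    then show ?case using insert by (simp add: Zp_ops mod_add_right_eq)
  qed
qed

lemma Zp_pow: 
  assumes "p > 0" shows "x [^]\<^bsub>Zp p\<^esub> (n::nat) = (\<lambda>m. (x m ^ n) mod int p ^ m)"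
proof -
  interpret cring "Zp p" by (rule Zp_cring) fact
  show ?thesis
  proof (induction n)
    case 0 then show ?case by (simp add: Zp_ops)
  next
    case (Suc n)
    then show ?case by (simp add: Zp_ops mod_mult_left_eq mod_mult_right_eq mult.commute)
  qed
qed

lemma Zp_domain: assumes p: "Factorial_Ring.prime p" shows "domain (Zp p)"
proof -
  have p0: "p > 0" and p1: "p > 1" using p prime_gt_0_nat prime_gt_1_nat by auto
  interpret cring "Zp p" by (rule Zp_cring) fact
  show ?thesis
  proof
    show "\<one>\<^bsub>Zp p\<^esub> \<noteq> \<zero>\<^bsub>Zp p\<^esub>"
    proof
      assume "\<one>\<^bsub>Zp p\<^esub> = \<zero>\<^bsub>Zp p\<^esub>"
      from fun_cong[OF this, of 1] show False using p1 by (simp add: Zp_ops)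
    qed
    fix x y assume xy: "x \<otimes>\<^bsub>Zp p\<^esub> y = \<zero>\<^bsub>Zp p\<^esub>" "x \<in> carrier (Zp p)" "y \<in> carrier (Zp p)"
    show "x = \<zero>\<^bsub>Zp p\<^esub> \<or> y = \<zero>\<^bsub>Zp p\<^esub>"
    proof (rule ccontr)
      assume "\<not> ?thesis"
      then obtain m k where mk: "x m \<noteq> 0" "y k \<noteq> 0" by (auto simp: Zp_ops fun_eq_iff)
      have nd: "\<not> int p ^ i dvd z (m + k)" if "z i \<noteq> 0" "z \<in> carrier (Zp p)" "i \<le> m + k" for z i
        using Zp_mod_le[OF that(2,3)] that(1) by (auto simp: dvd_eq_mod_eq_0)
      let ?x = "x (m + k)" and ?y = "y (m + k)"
      have x: "\<not> int p ^ m dvd ?x" and y: "\<not> int p ^ k dvd ?y" using nd mk xy by auto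
      then have "?x \<noteq> 0" "?y \<noteq> 0" by auto
      have pe: "prime_elem (int p)" using p by auto
      have ps: "Factorial_Ring.prime (int p)" using p by simp
      have "multiplicity (int p) ?x < m" using x \<open>?x \<noteq> 0\<close> ps by (meson not_less multiplicity_dvd' )
      moreover have "multiplicity (int p) ?y < k" using y \<open>?y \<noteq> 0\<close> ps by (meson not_less multiplicity_dvd')
      moreover have "multiplicity (int p) (?x * ?y) = multiplicity (int p) ?x + multiplicity (int p) ?y"
        using pe \<open>?x \<noteq> 0\<close> \<open>?y \<noteq> 0\<close> by (rule prime_elem_multiplicity_mult_distrib)
      moreover have "int p ^ (m + k) dvd ?x * ?y"
        using fun_cong[OF xy(1), of "m + k"] by (simp add: Zp_ops dvd_eq_mod_eq_0)
      then have "multiplicity (int p) (?x * ?y) \<ge> m + k"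
        using \<open>?x \<noteq> 0\<close> \<open>?y \<noteq> 0\<close> ps by (intro multiplicity_geI) auto
      ultimately show False by linarith
    qed
  qed
qed

lemma Zp_denominators: 
  assumes "Factorial_Ring.prime p" shows "regular_denominators (Zp p) (Zp_nonzero p)"
proof -
  interpret domain "Zp p" by (rule Zp_domain) fact
  show ?thesis
    by unfold_locales (auto simp: regular_element_def integral_iff)
qed

lemma Zp_torsion_free:
  assumes p: "Factorial_Ring.prime p" and "x \<in> carrier (Zp p)" "y \<in> carrier (Zp p)" "D \<noteq> 0"
    and "\<And>m. m \<ge> 1 \<Longrightarrow> [D * x m = D * y m] (mod int p ^ m)"
  shows "x = y"
proof -
  have p0: "p > 0" using p prime_gt_0_nat by auto
  interpret domain "Zp p" by (rule Zp_domain) fact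
  have "Zp_of_int p D \<noteq> \<zero>\<^bsub>Zp p\<^esub>"
  proof
    assume "Zp_of_int p D = \<zero>\<^bsub>Zp p\<^esub>"
    then have dv: "int p ^ m dvd D" for m by (auto simp: Zp_of_int_def Zp_ops fun_eq_iff dvd_eq_mod_eq_0)
    have "multiplicity (int p) D \<ge> m" for m
      using dv[of m] assms(4) p by (intro multiplicity_geI) auto
    from this[of "Suc (multiplicity (int p) D)"] show False by simp
  qed
  moreover have "Zp_of_int p D \<otimes>\<^bsub>Zp p\<^esub> x = Zp_of_int p D \<otimes>\<^bsub>Zp p\<^esub> y"
  proof
    fix m
    show "(Zp_of_int p D \<otimes>\<^bsub>Zp p\<^esub> x) m = (Zp_of_int p D \<otimes>\<^bsub>Zp p\<^esub> y) m"
      using assms(5)[of m] by (cases m) (auto simp: Zp_ops Zp_of_int_def mod_mult_left_eq cong_def)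
  qed
  ultimately show ?thesis
    using assms(2,3) Zp_of_int_carrier[OF p0, of D] by (simp add: m_lcancel)
qed

lemma Zp_of_int_mult: "p > 0 \<Longrightarrow> Zp_of_int p a \<otimes>\<^bsub>Zp p\<^esub> Zp_of_int p b = Zp_of_int p (a * b)"
  by (simp add: Zp_ops Zp_of_int_def mod_mult_eq)

lemma Zp_of_int_nonzero:
  assumes p: "Factorial_Ring.prime p" "k \<noteq> 0" shows "Zp_of_int p k \<in> Zp_nonzero p"
proof -
  have p0: "p > 0" using p prime_gt_0_nat by auto
  have "Zp_of_int p k \<noteq> \<zero>\<^bsub>Zp p\<^esub>"
  proof
    assume "Zp_of_int p k = \<zero>\<^bsub>Zp p\<^esub>"
    then have dv: "int p ^ m dvd k" for m by (auto simp: Zp_of_int_def Zp_ops fun_eq_iff dvd_eq_mod_eq_0)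
    have "multiplicity (int p) k \<ge> m" for m
      using dv[of m] assms by (intro multiplicity_geI) auto
    from this[of "Suc (multiplicity (int p) k)"] show False by simp
  qed
  then show ?thesis using Zp_of_int_carrier[OF p0] by simp
qed

section \<open>Profinite group rings as rings of measures\<close>

text \<open>What the measure theory needs to know about the Galois group: surjective homomorphisms \<open>r m\<close> onto
  the units modulo \<open>p ^ m\<close>, compatible with each other, whose kernels form a basis of open normal
  subgroups. In the application \<open>r m g\<close> is \<open>\<kappa>(g) ^ (- 1)\<close> modulo \<open>p ^ m\<close>, so that the characters
  \<open>\<kappa> ^ (1 - n)\<close> become the non-negative powers of \<open>r\<close>.\<close>

locale residue_tower =
  fixes p :: nat and G :: "('g, 'n) monoid_scheme" (structure) and T :: "'g topology"
    and r :: "nat \<Rightarrow> 'g \<Rightarrow> int"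
  assumes prime: "Factorial_Ring.prime p" and comm: "comm_group G"
    and r_unit: "g \<in> carrier G \<Longrightarrow> r m g \<in> unit_res p m"
    and r_mult: "g \<in> carrier G \<Longrightarrow> h \<in> carrier G \<Longrightarrow> r m (g \<otimes> h) = r m g * r m h mod int p ^ m"
    and r_Suc: "g \<in> carrier G \<Longrightarrow> r (Suc m) g mod int p ^ m = r m g"
    and r_surj: "b \<in> unit_res p m \<Longrightarrow> \<exists>g\<in>carrier G. r m g = b"
    and r_open: "{g \<in> carrier G. r m g = 1 mod int p ^ m} \<in> open_normal G T"
    and r_basis: "U \<in> open_normal G T \<Longrightarrow> \<exists>m. {g \<in> carrier G. r m g = 1 mod int p ^ m} \<subseteq> U"
begin

sublocale comm_group G by (rule comm)

lemma p0 [simp]: "p > 0" using prime prime_gt_0_nat by blast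

definition N :: "nat \<Rightarrow> 'g set" where "N m = {g \<in> carrier G. r m g = 1 mod int p ^ m}"
definition F :: "nat \<Rightarrow> int \<Rightarrow> 'g set" where "F m b = {g \<in> carrier G. r m g = b}"
abbreviation "ON \<equiv> open_normal G T"
abbreviation "\<Lambda> \<equiv> profinite_group_ring p G T"

lemma N_ON: "N m \<in> ON" unfolding N_def by (rule r_open)

lemma ON_normal: "U \<in> ON \<Longrightarrow> U \<lhd> G" by (simp add: open_normal_def)
lemma ON_subgroup: "U \<in> ON \<Longrightarrow> subgroup U G" using ON_normal normal_imp_subgroup by blast
lemma ON_subset: "U \<in> ON \<Longrightarrow> U \<subseteq> carrier G" using ON_subgroup subgroup.subset by blast

lemma r_bounds: "g \<in> carrier G \<Longrightarrow> r m g mod int p ^ m = r m g"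
  using r_unit[of g m] by (auto simp: unit_res_def)

lemma r_le: 
  assumes "g \<in> carrier G" "k \<le> m" shows "r m g mod int p ^ k = r k g"
  using assms(2)
proof (induction m rule: dec_induct)
  case base show ?case using assms(1) by (rule r_bounds)
next
  case (step m)
  have "r (Suc m) g mod int p ^ k = r (Suc m) g mod int p ^ m mod int p ^ k"
    using step by (simp only: mod_power_mod_power)
  then show ?case using step assms(1) by (simp only: r_Suc)
qed

lemma r_cong_cancel:
  assumes "g \<in> carrier G" "[r m g * x = r m g * y] (mod int p ^ m)"
  shows "[x = y] (mod int p ^ m)"
proof -
  have "coprime (r m g) (int p ^ m)" using r_unit[OF assms(1)] unfolding unit_res_def by blast
  then show ?thesis using assms(2) by (simp only: cong_mult_lcancel)
qed

lemma r_one: "r m \<one> = 1 mod int p ^ m"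
proof -
  have "r m (\<one> \<otimes> \<one>) = r m \<one> * r m \<one> mod int p ^ m" by (rule r_mult) auto
  then have "[r m \<one> * r m \<one> = r m \<one> * 1] (mod int p ^ m)"
    by (simp add: cong_def r_bounds)
  then have "[r m \<one> = 1] (mod int p ^ m)" by (rule r_cong_cancel[rotated]) simp
  then show ?thesis unfolding cong_def by (simp only: r_bounds[OF one_closed])
qed

lemma N_antimono: "k \<le> m \<Longrightarrow> N m \<subseteq> N k"
proof
  fix g assume "k \<le> m" "g \<in> N m"
  then have g: "g \<in> carrier G" "r m g = 1 mod int p ^ m" by (auto simp: N_def)
  then have "r k g = 1 mod int p ^ m mod int p ^ k" using r_le[OF g(1) \<open>k \<le> m\<close>] by simp
  then show "g \<in> N k" using g \<open>k \<le> m\<close> unfolding N_def by (simp only: mod_power_mod_power) simp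
qed

lemma ex_level:
  assumes "U \<in> ON" obtains m where "k \<le> m" "N m \<subseteq> U"
proof -
  obtain m where "N m \<subseteq> U" using r_basis[OF assms] unfolding N_def by blast
  then have "N (max k m) \<subseteq> U" using N_antimono[of m "max k m"] by simp
  then show ?thesis using that[of "max k m"] by simp
qed

lemma r_eq_diff:
  assumes "g \<in> carrier G" "h \<in> carrier G" "r m g = r m h" shows "g \<otimes> inv h \<in> N m"
proof -
  have "r m (h \<otimes> (g \<otimes> inv h)) = r m h * r m (g \<otimes> inv h) mod int p ^ m"
    using assms by (intro r_mult) auto
  moreover have "h \<otimes> (g \<otimes> inv h) = g" using assms by (simp add: m_lcomm)
  ultimately have "[r m h * r m (g \<otimes> inv h) = r m h * 1] (mod int p ^ m)"
    using assms by (simp add: cong_def r_bounds)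
  then have "[r m (g \<otimes> inv h) = 1] (mod int p ^ m)" using assms(2) by (rule r_cong_cancel[rotated])
  then show ?thesis unfolding N_def cong_def using assms by (simp add: r_bounds)
qed

text \<open>A coset of \<open>U\<close> is a union of cosets of \<open>N m\<close> and is therefore determined by its image under \<open>r m\<close>.
  All computations in the group rings of the quotients are transported to residues this way.\<close>

lemma coset_sat:
  assumes "U \<in> ON" "N m \<subseteq> U" "C \<in> rcosets U" "g \<in> carrier G" "r m g \<in> r m ` C"
  shows "g \<in> C"
proof -
  obtain c0 where c0: "c0 \<in> carrier G" "C = U #> c0" using assms(3) unfolding RCOSETS_def by blast
  obtain c where c: "c \<in> C" "r m g = r m c" using assms(5) by blast
  have cc: "c \<in> carrier G" using c c0 ON_subset[OF assms(1)] r_coset_subset_G by blast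
  have "C = U #> c" using repr_independence[OF _ c0(1) ON_subgroup[OF assms(1)]] c(1) c0(2) by metis
  moreover have "g = (g \<otimes> inv c) \<otimes> c" using assms(4) cc by (simp add: m_assoc)
  moreover have "g \<otimes> inv c \<in> U" using r_eq_diff[OF assms(4) cc c(2)] assms(2) by blast
  ultimately show ?thesis unfolding r_coset_def by blast
qed

lemma coset_subset: "U \<in> ON \<Longrightarrow> C \<in> rcosets U \<Longrightarrow> C \<subseteq> carrier G"
  using rcosets_part_G[OF ON_subgroup] by blast

lemma r_image_unit: "U \<in> ON \<Longrightarrow> C \<in> rcosets U \<Longrightarrow> r m ` C \<subseteq> unit_res p m"
  using coset_subset r_unit by blast

lemma finite_r_image [simp]: "U \<in> ON \<Longrightarrow> C \<in> rcosets U \<Longrightarrow> finite (r m ` C)"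
  using r_image_unit finite_subset finite_unit_res by metis

lemma finite_rcosets: assumes "U \<in> ON" shows "finite (rcosets U)"
proof -
  obtain m where m: "N m \<subseteq> U" using ex_level[OF assms, of 0] by blast
  have "inj_on (\<lambda>C. r m ` C) (rcosets U)"
  proof (rule inj_onI)
    fix C D assume CD: "C \<in> rcosets U" "D \<in> rcosets U" "r m ` C = r m ` D"
    have "C \<subseteq> D" "D \<subseteq> C"
      using coset_sat[OF assms m] coset_subset[OF assms] CD by blast+
    then show "C = D" by blast
  qed
  moreover have "(\<lambda>C. r m ` C) ` (rcosets U) \<subseteq> Pow (unit_res p m)"
    using r_image_unit[OF assms] by blast
  ultimately show ?thesis by (rule inj_on_finite) simp
qed

lemma coset_eq: "U \<in> ON \<Longrightarrow> C \<in> rcosets U \<Longrightarrow> g \<in> C \<Longrightarrow> C = U #> g"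
  unfolding RCOSETS_def using repr_independence[OF _ _ ON_subgroup] by fastforce

lemma coset_disj:
  assumes "U \<in> ON" "N m \<subseteq> U" "C \<in> rcosets U" "D \<in> rcosets U" "C \<noteq> D" shows "r m ` C \<inter> r m ` D = {}"
proof (rule ccontr)
  assume "r m ` C \<inter> r m ` D \<noteq> {}"
  then obtain g where g: "g \<in> C" "r m g \<in> r m ` D" by blast
  then have "g \<in> D" using coset_sat[OF assms(1,2,4)] coset_subset[OF assms(1,3)] by blast
  then show False using coset_eq[OF assms(1,3) g(1)] coset_eq[OF assms(1,4)] assms(5) by blast
qed

lemma rcos_mem: "U \<in> ON \<Longrightarrow> c \<in> carrier G \<Longrightarrow> c \<in> U #> c"
  by (rule rcos_self[OF _ ON_subgroup])

lemma rcos_in: "U \<in> ON \<Longrightarrow> c \<in> carrier G \<Longrightarrow> U #> c \<in> rcosets U"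
  by (rule rcosetsI[OF ON_subset])

lemma set_mult_rcos:
  assumes "U \<in> ON" "V \<in> ON" "U \<subseteq> V" "c \<in> carrier G" shows "V <#> (U #> c) = V #> c"
proof -
  have "V <#> (U #> c) = (V <#> U) #> c"
    using setmult_rcos_assoc[OF ON_subset[OF assms(2)] ON_subset[OF assms(1)] assms(4)] .
  also have "V <#> U = V"
  proof
    interpret V: subgroup V G using assms(2) by (rule ON_subgroup)
    show "V <#> U \<subseteq> V" unfolding set_mult_def using assms(3) by blast
    have "\<one> \<in> U" using ON_subgroup[OF assms(1)] by (rule subgroup.one_closed)
    then show "V \<subseteq> V <#> U" unfolding set_mult_def using V.subset r_one by force
  qed
  finally show ?thesis .
qed

lemma fibre_iff:
  assumes "U \<in> ON" "V \<in> ON" "U \<subseteq> V" "C \<in> rcosets U" "D \<in> rcosets V"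
  shows "V <#> C = D \<longleftrightarrow> C \<subseteq> D"
proof -
  obtain c where c: "c \<in> carrier G" "C = U #> c" using assms(4) unfolding RCOSETS_def by blast
  have cC: "c \<in> C" unfolding c(2) using assms(1) c(1) by (rule rcos_mem)
  have "V <#> C = V #> c" unfolding c(2) using assms(1-3) c(1) by (rule set_mult_rcos)
  moreover have "V #> c = D \<longleftrightarrow> C \<subseteq> D"
  proof
    assume "V #> c = D"
    then show "C \<subseteq> D" unfolding c(2) r_coset_def using assms(3) by blast
  next
    assume "C \<subseteq> D"
    then show "V #> c = D" using coset_eq[OF assms(2,5)] cC by blast
  qed
  ultimately show ?thesis by simp
qed

lemma sum_fibre:
  assumes "U \<in> ON" "V \<in> ON" "U \<subseteq> V" "N m \<subseteq> U" "D \<in> rcosets V"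
  shows "(\<Sum>C\<in>{C\<in>rcosets U. V <#> C = D}. \<Sum>b\<in>r m ` C. f b) = (\<Sum>b\<in>r m ` D. f b :: int)"
proof -
  have "(\<Union>C\<in>{C\<in>rcosets U. V <#> C = D}. r m ` C) = r m ` D"
  proof safe
    fix C g assume C: "C \<in> rcosets U" "g \<in> C" "D = V <#> C"
    then have "C \<subseteq> D" using fibre_iff[OF assms(1-3) C(1) assms(5)] by simp
    then show "r m g \<in> r m ` (V <#> C)" using C by blast
  next
    fix g assume g: "g \<in> D"
    then have gc: "g \<in> carrier G" using coset_subset[OF assms(2,5)] by blast
    have "V <#> (U #> g) = V #> g" using assms(1-3) gc by (rule set_mult_rcos)
    also have "\<dots> = D" using coset_eq[OF assms(2,5) g] by simp
    finally show "r m g \<in> (\<Union>C\<in>{C\<in>rcosets U. V <#> C = D}. r m ` C)"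
      using rcos_mem[OF assms(1) gc] rcos_in[OF assms(1) gc] by blast
  qed
  moreover have "(\<Sum>b\<in>(\<Union>C\<in>{C\<in>rcosets U. V <#> C = D}. r m ` C). f b) = 
      (\<Sum>C\<in>{C\<in>rcosets U. V <#> C = D}. \<Sum>b\<in>r m ` C. f b)"
  proof (rule sum.UNION_disjoint)
    show "finite {C \<in> rcosets U. V <#> C = D}" using finite_rcosets[OF assms(1)] by simp
    show "\<forall>i\<in>{C \<in> rcosets U. V <#> C = D}. finite (r m ` i)" using assms(1) by simp
    show "\<forall>i\<in>{C \<in> rcosets U. V <#> C = D}. \<forall>j\<in>{C \<in> rcosets U. V <#> C = D}. i \<noteq> j \<longrightarrow> r m ` i \<inter> r m ` j = {}"
      using coset_disj[OF assms(1,4)] by blast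
  qed
  ultimately show ?thesis by simp
qed

lemma sum_rcosets:
  assumes "U \<in> ON" "N m \<subseteq> U"
  shows "(\<Sum>C\<in>rcosets U. \<Sum>b\<in>r m ` C. f b) = (\<Sum>b\<in>unit_res p m. f b :: int)"
proof -
  have "(\<Union>C\<in>rcosets U. r m ` C) = unit_res p m"
  proof (intro equalityI subsetI)
    fix b assume "b \<in> unit_res p m"
    then obtain g where g: "g \<in> carrier G" "r m g = b" using r_surj by blast
    then show "b \<in> (\<Union>C\<in>rcosets U. r m ` C)"
      using rcos_mem[OF assms(1) g(1)] rcos_in[OF assms(1) g(1)] by blast
  qed (use r_image_unit[OF assms(1)] in blast)
  moreover have "(\<Sum>b\<in>(\<Union>C\<in>rcosets U. r m ` C). f b) = (\<Sum>C\<in>rcosets U. \<Sum>b\<in>r m ` C. f b)"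
  proof (rule sum.UNION_disjoint)
    show "finite (rcosets U)" by (rule finite_rcosets[OF assms(1)])
    show "\<forall>i\<in>rcosets U. finite (r m ` i)" using assms(1) by simp
    show "\<forall>i\<in>rcosets U. \<forall>j\<in>rcosets U. i \<noteq> j \<longrightarrow> r m ` i \<inter> r m ` j = {}"
      using coset_disj[OF assms] by blast
  qed
  ultimately show ?thesis by simp
qed

lemma rcoset_N: "g \<in> carrier G \<Longrightarrow> N m #> g = F m (r m g)"
proof (intro equalityI subsetI)
  fix h assume g: "g \<in> carrier G" and "h \<in> N m #> g"
  then obtain n where n: "n \<in> N m" "h = n \<otimes> g" unfolding r_coset_def by blast
  then have nc: "n \<in> carrier G" "r m n = 1 mod int p ^ m" by (auto simp: N_def)
  have "r m h = (1 mod int p ^ m) * r m g mod int p ^ m" unfolding n(2) using r_mult[OF nc(1) g] nc(2) by simp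
  also have "\<dots> = r m g" using r_bounds[OF g] by (simp only: mod_mult_left_eq mult_1_left)
  finally show "h \<in> F m (r m g)" unfolding F_def n(2) using nc g by simp
next
  fix h assume g: "g \<in> carrier G" and "h \<in> F m (r m g)"
  then have h: "h \<in> carrier G" "r m h = r m g" by (auto simp: F_def)
  have "h \<otimes> inv g \<in> N m" using r_eq_diff[OF h(1) g h(2)] .
  moreover have "h = (h \<otimes> inv g) \<otimes> g" using h g by (simp add: m_assoc)
  ultimately show "h \<in> N m #> g" unfolding r_coset_def by blast
qed

lemma rcosets_N: "rcosets (N m) = F m ` unit_res p m"
proof (intro equalityI subsetI)
  fix C assume "C \<in> rcosets (N m)"
  then obtain g where "g \<in> carrier G" "C = N m #> g" unfolding RCOSETS_def by blast
  then show "C \<in> F m ` unit_res p m" using rcoset_N r_unit by blast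
next
  fix C assume "C \<in> F m ` unit_res p m"
  then obtain b where b: "b \<in> unit_res p m" "C = F m b" by blast
  then obtain g where g: "g \<in> carrier G" "r m g = b" using r_surj by blast
  then show "C \<in> rcosets (N m)" using rcos_in[OF N_ON g(1)] rcoset_N[OF g(1)] b by metis
qed

lemma r_F: "b \<in> unit_res p m \<Longrightarrow> r m ` F m b = {b}"
  using r_surj unfolding F_def by blast

lemma r_F_le: "b \<in> unit_res p k \<Longrightarrow> k \<le> m \<Longrightarrow> r m ` F k b = {b'\<in>unit_res p m. b' mod int p ^ k = b}"
proof (intro equalityI subsetI)
  fix b' assume k: "k \<le> m" "b' \<in> r m ` F k b"
  then obtain g where g: "g \<in> carrier G" "r k g = b" "b' = r m g" unfolding F_def by blast
  then show "b' \<in> {b'\<in>unit_res p m. b' mod int p ^ k = b}" using r_le[OF g(1) k(1)] r_unit by simp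
next
  fix b' assume k: "k \<le> m" "b' \<in> {b'\<in>unit_res p m. b' mod int p ^ k = b}"
  then obtain g where g: "g \<in> carrier G" "r m g = b'" using r_surj by blast
  then have "r k g = b" using r_le[OF g(1) k(1)] k by simp
  then show "b' \<in> r m ` F k b" unfolding F_def using g by blast
qed

lemma carrier_Mod: "carrier (G Mod U) = rcosets U" by (simp add: FactGroup_def)

lemma carrier_\<Lambda>_iff: "x \<in> carrier \<Lambda> \<longleftrightarrow> x \<in> extensional ON \<and>
   (\<forall>U\<in>ON. x U \<in> extensional (rcosets U) \<and> (\<forall>C\<in>rcosets U. x U C \<in> carrier (Zp p))) \<and>
   (\<forall>U\<in>ON. \<forall>V\<in>ON. U \<subseteq> V \<longrightarrow> (\<forall>D\<in>rcosets V. (\<lambda>k. (\<Sum>C\<in>{C\<in>rcosets U. V <#> C = D}. x U C k) mod int p ^ k) = x V D))"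
  (is "?L \<longleftrightarrow> ?E \<and> ?A \<and> ?C")
proof -
  have gr: "y \<in> carrier (group_ring (Zp p) (G Mod U)) \<longleftrightarrow> y \<in> extensional (rcosets U) \<and> (\<forall>C\<in>rcosets U. y C \<in> carrier (Zp p))"
    if "U \<in> ON" for U y
    using finite_rcosets[OF that] by (auto simp: group_ring_def carrier_Mod PiE_iff)
  have gm: "group_ring_map (Zp p) (G Mod U) (G Mod V) (\<lambda>C. V <#> C) (x U) = x V \<longleftrightarrow>
     (\<forall>D\<in>rcosets V. (\<lambda>k. (\<Sum>C\<in>{C\<in>rcosets U. V <#> C = D}. x U C k) mod int p ^ k) = x V D)"
    if U: "U \<in> ON" and V: "V \<in> ON" and A: ?A for U V
  proof -
    have fs: "(\<Oplus>\<^bsub>Zp p\<^esub>C\<in>{C \<in> rcosets U. V <#> C = D \<and> x U C \<noteq> \<zero>\<^bsub>Zp p\<^esub>}. x U C) =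
       (\<lambda>k. (\<Sum>C\<in>{C\<in>rcosets U. V <#> C = D}. x U C k) mod int p ^ k)" for D
    proof -
      have "(\<Oplus>\<^bsub>Zp p\<^esub>C\<in>{C \<in> rcosets U. V <#> C = D \<and> x U C \<noteq> \<zero>\<^bsub>Zp p\<^esub>}. x U C) =
         (\<lambda>k. (\<Sum>C\<in>{C \<in> rcosets U. V <#> C = D \<and> x U C \<noteq> \<zero>\<^bsub>Zp p\<^esub>}. x U C k) mod int p ^ k)"
        using finite_rcosets[OF U] A U by (intro Zp_finsum) auto
      also have "(\<lambda>k. \<Sum>C\<in>{C \<in> rcosets U. V <#> C = D \<and> x U C \<noteq> \<zero>\<^bsub>Zp p\<^esub>}. x U C k) = 
        (\<lambda>k. \<Sum>C\<in>{C\<in>rcosets U. V <#> C = D}. x U C k)"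
        using finite_rcosets[OF U] by (intro ext sum.mono_neutral_left) (auto simp: Zp_ops)
      finally show ?thesis by meson
    qed
    have "x V \<in> extensional (rcosets V)" using A V by blast
    then show ?thesis
      unfolding group_ring_map_def carrier_Mod fs
      by (auto simp: fun_eq_iff extensional_def restrict_def)
  qed
  have "?L \<longleftrightarrow> x \<in> (\<Pi>\<^sub>E U\<in>ON. carrier (group_ring (Zp p) (G Mod U))) \<and>
    (\<forall>U\<in>ON. \<forall>V\<in>ON. U \<subseteq> V \<longrightarrow> group_ring_map (Zp p) (G Mod U) (G Mod V) (\<lambda>C. V <#> C) (x U) = x V)"
    by (simp add: profinite_group_ring_def)
  also have "\<dots> \<longleftrightarrow> ?E \<and> ?A \<and> (\<forall>U\<in>ON. \<forall>V\<in>ON. U \<subseteq> V \<longrightarrow> group_ring_map (Zp p) (G Mod U) (G Mod V) (\<lambda>C. V <#> C) (x U) = x V)"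
    using gr unfolding PiE_iff by blast
  also have "\<dots> \<longleftrightarrow> ?E \<and> ?A \<and> ?C"
    by (intro conj_cong refl ball_cong imp_cong) (rule gm)
  finally show ?thesis .
qed

text \<open>The element \<open>x\<close> of the inverse limit is the measure with level-\<open>m\<close> masses \<open>w m\<close>. The equation is
  demanded for every sufficiently deep level \<open>m\<close>, which makes it stable under all ring operations.\<close>

definition represents :: "('g set \<Rightarrow> 'g set \<Rightarrow> nat \<Rightarrow> int) \<Rightarrow> (nat \<Rightarrow> int \<Rightarrow> int) \<Rightarrow> bool" where
  "represents x w \<longleftrightarrow> x \<in> extensional ON \<and> (\<forall>U\<in>ON. x U \<in> extensional (rcosets U)) \<and> coherent p w \<and>
    (\<forall>U\<in>ON. \<forall>C\<in>rcosets U. \<forall>m k. k \<le> m \<longrightarrow> N m \<subseteq> U \<longrightarrow> x U C k = (\<Sum>b\<in>r m ` C. w m b) mod int p ^ k)"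

lemma repD:
  assumes "represents x w" "U \<in> ON" "C \<in> rcosets U" "k \<le> m" "N m \<subseteq> U"
  shows "x U C k = (\<Sum>b\<in>r m ` C. w m b) mod int p ^ k"
  using assms unfolding represents_def by blast

lemma represents_Zp:
  assumes "represents x w" "U \<in> ON" "C \<in> rcosets U" shows "x U C \<in> carrier (Zp p)"
proof (rule Zp_carrierI)
  fix k
  obtain m where m: "Suc k \<le> m" "N m \<subseteq> U" using ex_level[OF assms(2)] by blast
  show "x U C k mod int p ^ k = x U C k"
    using repD[OF assms, of k m] m by simp
  have "x U C (Suc k) = (\<Sum>b\<in>r m ` C. w m b) mod int p ^ Suc k" using repD[OF assms m] .
  then have "x U C (Suc k) mod int p ^ k = (\<Sum>b\<in>r m ` C. w m b) mod int p ^ k"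
    by (simp only: mod_power_mod_power[of k "Suc k"] le_SucI)
  moreover have "x U C k = (\<Sum>b\<in>r m ` C. w m b) mod int p ^ k"
    using repD[OF assms, of k m] m by simp
  ultimately show "[x U C (Suc k) = x U C k] (mod int p ^ k)" by (simp only: cong_def mod_mod_trivial)
qed simp

lemma represents_carrier: assumes "represents x w" shows "x \<in> carrier \<Lambda>"
  unfolding carrier_\<Lambda>_iff
proof (intro conjI ballI impI)
  show "x \<in> extensional ON" using assms by (simp add: represents_def)
  show "x U \<in> extensional (rcosets U)" if "U \<in> ON" for U using assms that by (simp add: represents_def)
  show "x U C \<in> carrier (Zp p)" if "U \<in> ON" "C \<in> rcosets U" for U C using assms that by (rule represents_Zp)
  fix U V D assume UV: "U \<in> ON" "V \<in> ON" "U \<subseteq> V" and D: "D \<in> rcosets V"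
  show "(\<lambda>k. (\<Sum>C\<in>{C\<in>rcosets U. V <#> C = D}. x U C k) mod int p ^ k) = x V D"
  proof
    fix k
    obtain m where m: "k \<le> m" "N m \<subseteq> U" using ex_level[OF UV(1)] by blast
    have "(\<Sum>C\<in>{C\<in>rcosets U. V <#> C = D}. x U C k) = (\<Sum>C\<in>{C\<in>rcosets U. V <#> C = D}. (\<Sum>b\<in>r m ` C. w m b) mod int p ^ k)"
      using repD[OF assms UV(1) _ m] by (intro sum.cong) auto
    then have "(\<Sum>C\<in>{C\<in>rcosets U. V <#> C = D}. x U C k) mod int p ^ k = (\<Sum>C\<in>{C\<in>rcosets U. V <#> C = D}. \<Sum>b\<in>r m ` C. w m b) mod int p ^ k"
      by (simp only: mod_sum_eq)
    also have "\<dots> = (\<Sum>b\<in>r m ` D. w m b) mod int p ^ k"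
      using sum_fibre[OF UV m(2) D] by simp
    also have "\<dots> = x V D k" using repD[OF assms UV(2) D m(1)] m(2) UV(3) by simp
    finally show "(\<Sum>C\<in>{C\<in>rcosets U. V <#> C = D}. x U C k) mod int p ^ k = x V D k" .
  qed
qed

text \<open>The mass of a residue class at level \<open>m\<close>, truncated modulo \<open>p ^ m\<close>. Coherence recovers the full
  \<open>p\<close>-adic masses from the truncated ones at deeper levels.\<close>

definition coords :: "('g set \<Rightarrow> 'g set \<Rightarrow> nat \<Rightarrow> int) \<Rightarrow> nat \<Rightarrow> int \<Rightarrow> int" where
  "coords x m b = x (N m) (F m b) m"

lemma F_rcosets: "b \<in> unit_res p m \<Longrightarrow> F m b \<in> rcosets (N m)" unfolding rcosets_N by blast

lemma carrier_rep: assumes x: "x \<in> carrier \<Lambda>" shows "represents x (coords x)"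
proof -
  have Zp: "x U C \<in> carrier (Zp p)" if "U \<in> ON" "C \<in> rcosets U" for U C
    using x that unfolding carrier_\<Lambda>_iff by blast
  have main: "x U C k = (\<Sum>b\<in>r m ` C. coords x m b) mod int p ^ k"
    if U: "U \<in> ON" "C \<in> rcosets U" "k \<le> m" "N m \<subseteq> U" for U C k m
  proof -
    have "(\<lambda>k. (\<Sum>D\<in>{D\<in>rcosets (N m). U <#> D = C}. x (N m) D k) mod int p ^ k) = x U C"
      using x N_ON U unfolding carrier_\<Lambda>_iff by blast
    then have "x U C k = (\<Sum>D\<in>{D\<in>rcosets (N m). U <#> D = C}. x (N m) D k) mod int p ^ k" by (rule fun_cong[OF sym])
    also have "(\<Sum>D\<in>{D\<in>rcosets (N m). U <#> D = C}. x (N m) D k) = 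
      (\<Sum>D\<in>{D\<in>rcosets (N m). U <#> D = C}. (\<Sum>b\<in>r m ` D. coords x m b mod int p ^ k))"
    proof (rule sum.cong)
      fix D assume "D \<in> {D\<in>rcosets (N m). U <#> D = C}"
      then obtain b where b: "b \<in> unit_res p m" "D = F m b" unfolding rcosets_N by blast
      have "(\<Sum>b\<in>r m ` D. coords x m b mod int p ^ k) = coords x m b mod int p ^ k" unfolding b(2) r_F[OF b(1)] by simp
      also have "\<dots> = x (N m) D k" unfolding coords_def b(2)
        using Zp[OF N_ON F_rcosets[OF b(1)]] U(3) by (rule Zp_mod_le)
      finally show "x (N m) D k = (\<Sum>b\<in>r m ` D. coords x m b mod int p ^ k)" by simp
    qed simp
    also have "\<dots> = (\<Sum>b\<in>r m ` C. coords x m b mod int p ^ k)"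
      using N_ON U(1,4) subset_refl U(2) by (rule sum_fibre)
    finally show ?thesis by (simp only: mod_sum_eq)
  qed
  have "coherent p (coords x)"
    unfolding coherent_def
  proof (intro allI ballI)
    fix m b assume b: "b \<in> unit_res p m"
    have "coords x m b = (\<Sum>b'\<in>r (Suc m) ` F m b. coords x (Suc m) b') mod int p ^ m"
      unfolding coords_def[of x m] using N_ON F_rcosets[OF b] le_SucI[OF le_refl] N_antimono[of m "Suc m"]
      by (intro main) auto
    also have "r (Suc m) ` F m b = {b'\<in>unit_res p (Suc m). b' mod int p ^ m = b}"
      using b by (rule r_F_le) simp
    finally show "[(\<Sum>b'\<in>{b'\<in>unit_res p (Suc m). b' mod int p ^ m = b}. coords x (Suc m) b') = coords x m b] (mod int p ^ m)"
      by (simp only: cong_def mod_mod_trivial)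
  qed
  then show ?thesis unfolding represents_def using x main unfolding carrier_\<Lambda>_iff by blast
qed

lemma represents_coords:
  assumes "represents x w" "b \<in> unit_res p m" shows "coords x m b = w m b mod int p ^ m"
proof -
  have "coords x m b = (\<Sum>b\<in>r m ` F m b. w m b) mod int p ^ m"
    unfolding coords_def using assms(1) N_ON F_rcosets[OF assms(2)] le_refl subset_refl by (rule repD)
  then show ?thesis unfolding r_F[OF assms(2)] by simp
qed

end

lemma coherentD:
  "coherent p w \<Longrightarrow> b \<in> unit_res p m \<Longrightarrow>
   [(\<Sum>b'\<in>{b'\<in>unit_res p (Suc m). b' mod int p ^ m = b}. w (Suc m) b') = w m b] (mod int p ^ m)"
  by (simp add: coherent_def)

lemma coherent_add:
  assumes "coherent p w" "coherent p v" shows "coherent p (\<lambda>m b. w m b + v m b)"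
  unfolding coherent_def sum.distrib by (intro allI ballI cong_add coherentD assms)

lemma coherent_diff:
  assumes "coherent p w" "coherent p v" shows "coherent p (\<lambda>m b. w m b - v m b)"
  unfolding coherent_def sum_subtractf by (intro allI ballI cong_diff coherentD assms)

lemma coherent_smult:
  assumes "coherent p w" "a \<in> carrier (Zp p)" shows "coherent p (\<lambda>m b. a m * w m b)"
  unfolding coherent_def sum_distrib_left[symmetric]
  by (intro allI ballI cong_mult coherentD assms Zp_cong) simp

section \<open>Convolution\<close>

definition convolve :: "nat \<Rightarrow> (nat \<Rightarrow> int \<Rightarrow> int) \<Rightarrow> (nat \<Rightarrow> int \<Rightarrow> int) \<Rightarrow> nat \<Rightarrow> int \<Rightarrow> int" where
  "convolve p w v m b = (\<Sum>c\<in>{c\<in>unit_res p m \<times> unit_res p m. fst c * snd c mod int p ^ m = b}. w m (fst c) * v m (snd c))"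

lemma unit_res_mult:
  assumes "p > 0" "a \<in> unit_res p m" "b \<in> unit_res p m" shows "a * b mod int p ^ m \<in> unit_res p m"
proof (rule unit_res_mod[OF assms(1)])
  show "coprime (a * b) (int p ^ m)" using assms(2,3) unfolding unit_res_def coprime_mult_left_iff by blast
qed

lemma sum_unit_res_group:
  fixes f :: "int \<Rightarrow> int"
  assumes "p > 0"
  shows "(\<Sum>b'\<in>unit_res p (Suc m). f b') = (\<Sum>b\<in>unit_res p m. \<Sum>b'\<in>{b'\<in>unit_res p (Suc m). b' mod int p ^ m = b}. f b')"
proof (rule sum.group[symmetric])
  show "(\<lambda>b'. b' mod int p ^ m) ` unit_res p (Suc m) \<subseteq> unit_res p m"
    using unit_res_mod_le[OF le_SucI[OF le_refl] _ assms] by blast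
qed auto

text \<open>The pairs of residues at level \<open>m + 1\<close> are grouped by their reductions to level \<open>m\<close>; the sum over
  each group is a product of two sums over lifts.\<close>

lemma coherent_conv:
  assumes "p > 0" "coherent p w" "coherent p v" shows "coherent p (convolve p w v)"
  unfolding coherent_def
proof (intro allI ballI)
  fix m b assume b: "b \<in> unit_res p m"
  let ?q = "int p ^ m" and ?A = "unit_res p m" and ?A' = "unit_res p (Suc m)"
  let ?B = "{b'\<in>?A'. b' mod ?q = b}"
  let ?S = "{c\<in>?A' \<times> ?A'. fst c * snd c mod ?q = b}"
  let ?T = "{c\<in>?A \<times> ?A. fst c * snd c mod ?q = b}"
  let ?g = "\<lambda>c. w (Suc m) (fst c) * v (Suc m) (snd c)"
  let ?fib = "\<lambda>a. {a'\<in>?A'. a' mod ?q = a}"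
  have mm: "x mod int p ^ Suc m mod ?q = x mod ?q" for x :: int by (rule mod_power_mod_power) simp
  have "(\<Sum>b'\<in>?B. convolve p w v (Suc m) b') = (\<Sum>b'\<in>?B. sum ?g {c\<in>?S. fst c * snd c mod int p ^ Suc m = b'})"
    unfolding convolve_def
  proof (rule sum.cong[OF refl], rule sum.cong)
    fix b' assume b': "b' \<in> ?B"
    show "{c\<in>?A' \<times> ?A'. fst c * snd c mod int p ^ Suc m = b'} = {c\<in>?S. fst c * snd c mod int p ^ Suc m = b'}"
    proof (intro equalityI subsetI)
      fix c assume c: "c \<in> {c\<in>?A' \<times> ?A'. fst c * snd c mod int p ^ Suc m = b'}"
      then have eq: "fst c * snd c mod int p ^ Suc m = b'" by blast
      have "fst c * snd c mod ?q = b' mod ?q" unfolding eq[symmetric] by (rule mm[symmetric])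
      also have "\<dots> = b" using b' by blast
      finally show "c \<in> {c\<in>?S. fst c * snd c mod int p ^ Suc m = b'}" using c by blast
    qed blast
  qed simp
  also have "\<dots> = sum ?g ?S"
  proof (rule sum.group)
    show "(\<lambda>c. fst c * snd c mod int p ^ Suc m) ` ?S \<subseteq> ?B"
    proof
      fix y assume "y \<in> (\<lambda>c. fst c * snd c mod int p ^ Suc m) ` ?S"
      then obtain c where c: "c \<in> ?S" "y = fst c * snd c mod int p ^ Suc m" by blast
      have "y mod ?q = fst c * snd c mod ?q" unfolding c(2) by (rule mm)
      also have "\<dots> = b" using c(1) by blast
      finally have "y mod ?q = b" .
      moreover have "y \<in> ?A'" unfolding c(2) using c(1) by (intro unit_res_mult[OF assms(1)]) auto
      ultimately show "y \<in> ?B" by blast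
    qed
  qed auto
  also have "\<dots> = (\<Sum>d\<in>?T. sum ?g {c\<in>?S. (fst c mod ?q, snd c mod ?q) = d})"
  proof (rule sum.group[symmetric])
    show "(\<lambda>c. (fst c mod ?q, snd c mod ?q)) ` ?S \<subseteq> ?T"
    proof
      fix d assume "d \<in> (\<lambda>c. (fst c mod ?q, snd c mod ?q)) ` ?S"
      then obtain c where c: "fst c \<in> ?A'" "snd c \<in> ?A'" "fst c * snd c mod ?q = b" "d = (fst c mod ?q, snd c mod ?q)" by auto
      have "fst c mod ?q \<in> ?A" "snd c mod ?q \<in> ?A"
        using unit_res_mod_le[OF le_SucI[OF le_refl] _ assms(1)] c by blast+
      moreover have "(fst c mod ?q) * (snd c mod ?q) mod ?q = b" using c(3) by (simp only: mod_mult_eq)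
      ultimately show "d \<in> ?T" unfolding c(4) by simp
    qed
  qed auto
  also have "\<dots> = (\<Sum>d\<in>?T. (\<Sum>a\<in>?fib (fst d). w (Suc m) a) * (\<Sum>a\<in>?fib (snd d). v (Suc m) a))"
  proof (rule sum.cong[OF refl])
    fix d assume d: "d \<in> ?T"
    have "{c\<in>?S. (fst c mod ?q, snd c mod ?q) = d} = ?fib (fst d) \<times> ?fib (snd d)"
    proof (intro equalityI subsetI)
      fix c assume "c \<in> ?fib (fst d) \<times> ?fib (snd d)"
      then have c: "fst c \<in> ?A'" "snd c \<in> ?A'" "fst c mod ?q = fst d" "snd c mod ?q = snd d" by auto
      have "fst c * snd c mod ?q = fst d * snd d mod ?q" using mod_mult_eq[of "fst c" ?q "snd c"] c by simp
      then have "c \<in> ?S" using d c by (simp add: mem_Times_iff)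
      then show "c \<in> {c\<in>?S. (fst c mod ?q, snd c mod ?q) = d}" using c by simp
    qed auto
    then show "sum ?g {c\<in>?S. (fst c mod ?q, snd c mod ?q) = d} = (\<Sum>a\<in>?fib (fst d). w (Suc m) a) * (\<Sum>a\<in>?fib (snd d). v (Suc m) a)"
      unfolding sum_product sum.cartesian_product by (simp add: case_prod_unfold)
  qed
  finally have 1: "(\<Sum>b'\<in>?B. convolve p w v (Suc m) b') = (\<Sum>d\<in>?T. (\<Sum>a\<in>?fib (fst d). w (Suc m) a) * (\<Sum>a\<in>?fib (snd d). v (Suc m) a))" .
  show "[(\<Sum>b'\<in>?B. convolve p w v (Suc m) b') = convolve p w v m b] (mod ?q)"
    unfolding 1 unfolding convolve_def
  proof (rule cong_sum)
    fix d assume "d \<in> ?T"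
    then show "[(\<Sum>a\<in>?fib (fst d). w (Suc m) a) * (\<Sum>a\<in>?fib (snd d). v (Suc m) a) = w m (fst d) * v m (snd d)] (mod ?q)"
      by (intro cong_mult coherentD assms) auto
  qed
qed

definition moment :: "nat \<Rightarrow> (nat \<Rightarrow> int \<Rightarrow> int) \<Rightarrow> nat \<Rightarrow> nat \<Rightarrow> int" where
  "moment p w n = (\<lambda>m. (\<Sum>b\<in>unit_res p m. w m b * b ^ n) mod int p ^ m)"

lemma moment_carrier:
  assumes "p > 0" "coherent p w" shows "moment p w n \<in> carrier (Zp p)"
  unfolding moment_def
proof (rule Zp_red_carrier[OF assms(1)])
  fix m
  let ?q = "int p ^ m" and ?fib = "\<lambda>a. {a'\<in>unit_res p (Suc m). a' mod int p ^ m = a}"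
  have 1: "(\<Sum>b\<in>unit_res p (Suc m). w (Suc m) b * b ^ n) = (\<Sum>b\<in>unit_res p m. \<Sum>b'\<in>?fib b. w (Suc m) b' * b' ^ n)"
    by (rule sum_unit_res_group[OF assms(1)])
  show "[(\<Sum>b\<in>unit_res p (Suc m). w (Suc m) b * b ^ n) = (\<Sum>b\<in>unit_res p m. w m b * b ^ n)] (mod ?q)"
    unfolding 1
  proof (rule cong_sum)
    fix b assume b: "b \<in> unit_res p m"
    have "[(\<Sum>b'\<in>?fib b. w (Suc m) b' * b' ^ n) = (\<Sum>b'\<in>?fib b. w (Suc m) b' * b ^ n)] (mod ?q)"
    proof (rule cong_sum)
      fix b' assume "b' \<in> ?fib b"
      then have "[b' = b] (mod ?q)" using b by (auto simp: cong_def)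
      then show "[w (Suc m) b' * b' ^ n = w (Suc m) b' * b ^ n] (mod ?q)" by (intro cong_mult cong_pow cong_refl)
    qed
    moreover have "[(\<Sum>b'\<in>?fib b. w (Suc m) b' * b ^ n) = w m b * b ^ n] (mod ?q)"
      unfolding sum_distrib_right[symmetric] by (intro cong_mult cong_refl coherentD[OF assms(2) b])
    ultimately show "[(\<Sum>b'\<in>?fib b. w (Suc m) b' * b' ^ n) = w m b * b ^ n] (mod ?q)" by (rule cong_trans)
  qed
qed

lemma moment_cong:
  assumes "\<And>m b. b \<in> unit_res p m \<Longrightarrow> [w m b = v m b] (mod int p ^ m)"
  shows "moment p w n = moment p v n"
proof
  fix m
  have "[(\<Sum>b\<in>unit_res p m. w m b * b ^ n) = (\<Sum>b\<in>unit_res p m. v m b * b ^ n)] (mod int p ^ m)"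
    by (intro cong_sum cong_mult cong_refl assms)
  then show "moment p w n m = moment p v n m" by (simp only: moment_def cong_def)
qed

lemma moment_add: "moment p (\<lambda>m b. w m b + v m b) n = moment p w n \<oplus>\<^bsub>Zp p\<^esub> moment p v n"
  by (simp only: moment_def Zp_ops distrib_right sum.distrib mod_add_eq)

lemma moment_smult:
  "moment p (\<lambda>m b. a m * w m b) n = a \<otimes>\<^bsub>Zp p\<^esub> moment p w n"
  by (simp only: moment_def Zp_ops mult.assoc sum_distrib_left[symmetric] mod_mult_right_eq)

lemma moment_conv:
  assumes "p > 0" shows "moment p (convolve p w v) n = moment p w n \<otimes>\<^bsub>Zp p\<^esub> moment p v n"
proof
  fix m
  let ?q = "int p ^ m" and ?A = "unit_res p m"
  have "(\<Sum>b\<in>?A. convolve p w v m b * b ^ n) = (\<Sum>b\<in>?A. \<Sum>c\<in>{c\<in>?A \<times> ?A. fst c * snd c mod ?q = b}.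
      w m (fst c) * v m (snd c) * (fst c * snd c mod ?q) ^ n)"
    unfolding convolve_def sum_distrib_right by (intro sum.cong refl) simp
  also have "\<dots> = (\<Sum>c\<in>?A \<times> ?A. w m (fst c) * v m (snd c) * (fst c * snd c mod ?q) ^ n)"
  proof (rule sum.group)
    show "(\<lambda>c. fst c * snd c mod ?q) ` (?A \<times> ?A) \<subseteq> ?A"
      using unit_res_mult[OF assms] by fastforce
  qed auto
  finally have 1: "(\<Sum>b\<in>?A. convolve p w v m b * b ^ n) = (\<Sum>c\<in>?A \<times> ?A. w m (fst c) * v m (snd c) * (fst c * snd c mod ?q) ^ n)" .
  have "[(\<Sum>c\<in>?A \<times> ?A. w m (fst c) * v m (snd c) * (fst c * snd c mod ?q) ^ n) =
     (\<Sum>c\<in>?A \<times> ?A. w m (fst c) * v m (snd c) * (fst c * snd c) ^ n)] (mod ?q)"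
    by (intro cong_sum cong_mult cong_refl cong_pow) (simp only: cong_def mod_mod_trivial)
  moreover have "(\<Sum>c\<in>?A \<times> ?A. w m (fst c) * v m (snd c) * (fst c * snd c) ^ n) =
     (\<Sum>b\<in>?A. w m b * b ^ n) * (\<Sum>b\<in>?A. v m b * b ^ n)"
    unfolding sum_product sum.cartesian_product by (simp add: case_prod_unfold power_mult_distrib mult_ac)
  ultimately show "moment p (convolve p w v) n m = (moment p w n \<otimes>\<^bsub>Zp p\<^esub> moment p v n) m"
    unfolding moment_def Zp_ops 1 by (simp only: cong_def mod_mult_eq)
qed

context residue_tower
begin

lemma represents_eqI:
  assumes "represents x w" "represents y v" "\<And>m b. b \<in> unit_res p m \<Longrightarrow> [w m b = v m b] (mod int p ^ m)"
  shows "x = y"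
proof (rule extensionalityI[of _ ON])
  show "x \<in> extensional ON" "y \<in> extensional ON" using assms by (auto simp: represents_def)
  fix U assume U: "U \<in> ON"
  show "x U = y U"
  proof (rule extensionalityI[of _ "rcosets U"])
    show "x U \<in> extensional (rcosets U)" "y U \<in> extensional (rcosets U)" using assms U by (auto simp: represents_def)
    fix C assume C: "C \<in> rcosets U"
    show "x U C = y U C"
    proof
      fix k
      obtain m where m: "k \<le> m" "N m \<subseteq> U" using ex_level[OF U] by blast
      have "[(\<Sum>b\<in>r m ` C. w m b) = (\<Sum>b\<in>r m ` C. v m b)] (mod int p ^ k)"
      proof (rule cong_sum)
        fix b assume "b \<in> r m ` C"
        then have "[w m b = v m b] (mod int p ^ m)" using r_image_unit[OF U C] assms(3) by blast
        then show "[w m b = v m b] (mod int p ^ k)"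
          by (rule cong_dvd_modulus) (rule le_imp_power_dvd[OF m(1)])
      qed
      then show "x U C k = y U C k"
        unfolding repD[OF assms(1) U C m] repD[OF assms(2) U C m] by (simp only: cong_def)
    qed
  qed
qed

text \<open>The value on a coset may be computed at any deep level, by coherence, so an arbitrary choice of
  the level yields a well-defined element.\<close>

lemma represents_ex:
  assumes "coherent p w" shows "\<exists>x. represents x w"
proof -
  define lev where "lev = (\<lambda>U k. SOME m. k \<le> m \<and> N m \<subseteq> U)"
  define x where "x = (\<lambda>U\<in>ON. \<lambda>C\<in>rcosets U. \<lambda>k. (\<Sum>b\<in>r (lev U k) ` C. w (lev U k) b) mod int p ^ k)"
  have lev: "k \<le> lev U k \<and> N (lev U k) \<subseteq> U" if "U \<in> ON" for U k
    unfolding lev_def using ex_level[OF that] by (rule someI2_ex[of "\<lambda>m. k \<le> m \<and> N m \<subseteq> U"]) blast+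
  have step: "[(\<Sum>b\<in>r M ` C. w M b) = (\<Sum>b\<in>r m ` C. w m b)] (mod int p ^ k)"
    if U: "U \<in> ON" "C \<in> rcosets U" "k \<le> m" "m \<le> M" "N m \<subseteq> U" for U C k m M
  proof -
    have im: "r m ` C = (\<lambda>b'. b' mod int p ^ m) ` (r M ` C)"
      unfolding image_image using r_le[OF _ U(4)] coset_subset[OF U(1,2)] by (intro image_cong) auto
    have "(\<Sum>b\<in>r M ` C. w M b) = (\<Sum>b\<in>r m ` C. sum (w M) {b'\<in>r M ` C. b' mod int p ^ m = b})"
      unfolding im using U(1,2) by (intro sum.group[symmetric]) auto
    also have "\<dots> = (\<Sum>b\<in>r m ` C. sum (w M) {b'\<in>unit_res p M. b' mod int p ^ m = b})"
    proof (rule sum.cong[OF refl], rule sum.cong[OF _ refl])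
      fix b assume b: "b \<in> r m ` C"
      show "{b'\<in>r M ` C. b' mod int p ^ m = b} = {b'\<in>unit_res p M. b' mod int p ^ m = b}"
      proof (intro equalityI subsetI)
        fix b' assume b': "b' \<in> {b'\<in>unit_res p M. b' mod int p ^ m = b}"
        then obtain g where g: "g \<in> carrier G" "r M g = b'" using r_surj by blast
        have "r m g = b" using r_le[OF g(1) U(4)] g b' by simp
        then have "g \<in> C" using coset_sat[OF U(1,5,2) g(1)] b by simp
        then show "b' \<in> {b'\<in>r M ` C. b' mod int p ^ m = b}" using g b' by blast
      qed (use r_image_unit[OF U(1,2)] in blast)
    qed
    finally have e: "(\<Sum>b\<in>r M ` C. w M b) = (\<Sum>b\<in>r m ` C. sum (w M) {b'\<in>unit_res p M. b' mod int p ^ m = b})" .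
    have "[(\<Sum>b\<in>r M ` C. w M b) = (\<Sum>b\<in>r m ` C. w m b)] (mod int p ^ m)"
      unfolding e using r_image_unit[OF U(1,2)] by (intro cong_sum coherent_le[OF assms U(4) _ p0]) auto
    then show ?thesis by (rule cong_dvd_modulus) (rule le_imp_power_dvd[OF U(3)])
  qed
  have "represents x w"
    unfolding represents_def
  proof (intro conjI ballI allI impI)
    show "x \<in> extensional ON" by (simp add: x_def)
    show "x U \<in> extensional (rcosets U)" if "U \<in> ON" for U using that by (simp add: x_def)
    show "coherent p w" by fact
    fix U C m k assume U: "U \<in> ON" "C \<in> rcosets U" "k \<le> m" "N m \<subseteq> U"
    let ?l = "lev U k"
    have "[(\<Sum>b\<in>r ?l ` C. w ?l b) = (\<Sum>b\<in>r m ` C. w m b)] (mod int p ^ k)"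
    proof (cases "m \<le> ?l")
      case True then show ?thesis using U by (intro step)
    next
      case False
      then have "[(\<Sum>b\<in>r m ` C. w m b) = (\<Sum>b\<in>r ?l ` C. w ?l b)] (mod int p ^ k)"
        using U lev[OF U(1)] by (intro step) auto
      then show ?thesis by (rule cong_sym)
    qed
    then show "x U C k = (\<Sum>b\<in>r m ` C. w m b) mod int p ^ k"
      using U by (simp add: x_def cong_def)
  qed
  then show ?thesis by blast
qed

lemma \<Lambda>_add_eval: "U \<in> ON \<Longrightarrow> C \<in> rcosets U \<Longrightarrow> (x \<oplus>\<^bsub>\<Lambda>\<^esub> y) U C = x U C \<oplus>\<^bsub>Zp p\<^esub> y U C"
  by (simp add: profinite_group_ring_def group_ring_def carrier_Mod)

lemma \<Lambda>_smult_eval: "U \<in> ON \<Longrightarrow> C \<in> rcosets U \<Longrightarrow> (a \<odot>\<^bsub>\<Lambda>\<^esub> x) U C = a \<otimes>\<^bsub>Zp p\<^esub> x U C"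
  by (simp add: profinite_group_ring_def group_ring_def carrier_Mod)

lemma represents_add:
  assumes "represents x w" "represents y v" shows "represents (x \<oplus>\<^bsub>\<Lambda>\<^esub> y) (\<lambda>m b. w m b + v m b)"
  unfolding represents_def
proof (intro conjI ballI allI impI)
  show "x \<oplus>\<^bsub>\<Lambda>\<^esub> y \<in> extensional ON" by (simp add: profinite_group_ring_def)
  show "(x \<oplus>\<^bsub>\<Lambda>\<^esub> y) U \<in> extensional (rcosets U)" if "U \<in> ON" for U
    using that by (simp add: profinite_group_ring_def group_ring_def carrier_Mod)
  show "coherent p (\<lambda>m b. w m b + v m b)" using assms by (intro coherent_add) (auto simp: represents_def)
  fix U C m k assume U: "U \<in> ON" "C \<in> rcosets U" "k \<le> m" "N m \<subseteq> U"
  show "(x \<oplus>\<^bsub>\<Lambda>\<^esub> y) U C k = (\<Sum>b\<in>r m ` C. w m b + v m b) mod int p ^ k"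
    unfolding \<Lambda>_add_eval[OF U(1,2)] Zp_ops repD[OF assms(1) U] repD[OF assms(2) U] sum.distrib
    by (rule mod_add_eq)
qed

lemma represents_smult:
  assumes "represents x w" "a \<in> carrier (Zp p)" shows "represents (a \<odot>\<^bsub>\<Lambda>\<^esub> x) (\<lambda>m b. a m * w m b)"
  unfolding represents_def
proof (intro conjI ballI allI impI)
  show "a \<odot>\<^bsub>\<Lambda>\<^esub> x \<in> extensional ON" by (simp add: profinite_group_ring_def)
  show "(a \<odot>\<^bsub>\<Lambda>\<^esub> x) U \<in> extensional (rcosets U)" if "U \<in> ON" for U
    using that by (simp add: profinite_group_ring_def group_ring_def carrier_Mod)
  show "coherent p (\<lambda>m b. a m * w m b)" using assms by (intro coherent_smult) (auto simp: represents_def)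
  fix U C m k assume U: "U \<in> ON" "C \<in> rcosets U" "k \<le> m" "N m \<subseteq> U"
  have "a m mod int p ^ k = a k mod int p ^ k" using Zp_cong[OF assms(2) U(3)] by (simp only: cong_def)
  then have "a k * (\<Sum>b\<in>r m ` C. w m b) mod int p ^ k = a m * (\<Sum>b\<in>r m ` C. w m b) mod int p ^ k"
    by (metis mod_mult_left_eq)
  then show "(a \<odot>\<^bsub>\<Lambda>\<^esub> x) U C k = (\<Sum>b\<in>r m ` C. a m * w m b) mod int p ^ k"
    unfolding \<Lambda>_smult_eval[OF U(1,2)] Zp_ops repD[OF assms(1) U] sum_distrib_left[symmetric]
    by (simp only: mod_mult_right_eq)
qed

lemma represents_elem:
  assumes g: "g \<in> carrier G"
  shows "represents (group_elem p G T g) (\<lambda>m b. if b = r m g then 1 else 0)"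
  unfolding represents_def
proof (intro conjI ballI allI impI)
  show "group_elem p G T g \<in> extensional ON" by (simp add: group_elem_def)
  show "group_elem p G T g U \<in> extensional (rcosets U)" if "U \<in> ON" for U
    using that by (simp add: group_elem_def carrier_Mod)
  show "coherent p (\<lambda>m b. if b = r m g then 1 else 0)"
    unfolding coherent_def
  proof (intro allI ballI)
    fix m b assume b: "b \<in> unit_res p m"
    have "(\<Sum>b'\<in>{b'\<in>unit_res p (Suc m). b' mod int p ^ m = b}. if b' = r (Suc m) g then 1 else 0) = (if b = r m g then 1 else 0 :: int)"
      using r_unit[OF g, of "Suc m"] r_Suc[OF g, of m] by (subst sum.delta) auto
    then show "[(\<Sum>b'\<in>{b'\<in>unit_res p (Suc m). b' mod int p ^ m = b}. if b' = r (Suc m) g then 1 else 0) = (if b = r m g then 1 else 0 :: int)] (mod int p ^ m)"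
      by simp
  qed
  fix U C m k assume U: "U \<in> ON" "C \<in> rcosets U" "k \<le> m" "N m \<subseteq> U"
  have "C = U #> g \<longleftrightarrow> g \<in> C"
    using coset_eq[OF U(1,2)] rcos_mem[OF U(1) g] by blast
  also have "\<dots> \<longleftrightarrow> r m g \<in> r m ` C" using coset_sat[OF U(1,4,2) g] by blast
  finally have iff: "C = U #> g \<longleftrightarrow> r m g \<in> r m ` C" .
  have "(\<Sum>b\<in>r m ` C. if b = r m g then 1 else 0 :: int) = (if r m g \<in> r m ` C then 1 else 0)"
    using U(1,2) by (subst sum.delta) auto
  then show "group_elem p G T g U C k = (\<Sum>b\<in>r m ` C. if b = r m g then 1 else 0) mod int p ^ k"
    using U(1,2) iff by (simp add: group_elem_def carrier_Mod Zp_ops)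
qed

lemma one_eq_elem: "\<one>\<^bsub>\<Lambda>\<^esub> = group_elem p G T \<one>"
proof -
  have "U #> \<one> = U" if "U \<in> ON" for U using coset_mult_one[OF ON_subset[OF that]] .
  then show ?thesis
    by (auto simp: profinite_group_ring_def group_ring_def group_elem_def FactGroup_def restrict_def fun_eq_iff)
qed

lemma represents_zero: "represents \<zero>\<^bsub>\<Lambda>\<^esub> (\<lambda>m b. 0)"
  unfolding represents_def
  by (auto simp: profinite_group_ring_def group_ring_def carrier_Mod coherent_def Zp_ops)

text \<open>Both sides count pairs of residues whose product lies in the image of the coset \<open>C\<close>: the product of
  the group ring sorts them by the coset of the first factor, the convolution by their product.\<close>

lemma represents_mult:
  assumes x: "represents x w" and y: "represents y v" shows "represents (x \<otimes>\<^bsub>\<Lambda>\<^esub> y) (convolve p w v)"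
  unfolding represents_def
proof (intro conjI ballI allI impI)
  show "x \<otimes>\<^bsub>\<Lambda>\<^esub> y \<in> extensional ON" by (simp add: profinite_group_ring_def)
  show "(x \<otimes>\<^bsub>\<Lambda>\<^esub> y) U \<in> extensional (rcosets U)" if "U \<in> ON" for U
    using that by (simp add: profinite_group_ring_def group_ring_def carrier_Mod)
  show "coherent p (convolve p w v)" using x y by (intro coherent_conv) (auto simp: represents_def)
  fix U C m k assume U: "U \<in> ON" "C \<in> rcosets U" "k \<le> m" "N m \<subseteq> U"
  let ?q = "int p ^ m" and ?A = "unit_res p m"
  interpret U: normal U G using ON_normal[OF U(1)] .
  have GU: "group (G Mod U)" by (rule U.factorgroup_is_group)
  let ?D = "\<lambda>D. inv\<^bsub>G Mod U\<^esub> D \<otimes>\<^bsub>G Mod U\<^esub> C"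
  have D_in: "?D D \<in> rcosets U" if "D \<in> rcosets U" for D
    using group.inv_closed[OF GU, of D] monoid.m_closed[OF group.is_monoid[OF GU], of "inv\<^bsub>G Mod U\<^esub> D" C] that U(2)
    unfolding carrier_Mod by blast
  have mem: "h \<in> ?D D \<longleftrightarrow> g \<otimes> h \<in> C" if D: "D \<in> rcosets U" "g \<in> D" "h \<in> carrier G" for D g h
  proof -
    have g: "g \<in> carrier G" using coset_subset[OF U(1) D(1)] D(2) by blast
    obtain c where c: "c \<in> carrier G" "C = U #> c" using U(2) unfolding RCOSETS_def by blast
    have "inv\<^bsub>G Mod U\<^esub> D = set_inv D" by (rule U.inv_FactGroup) (simp only: carrier_Mod D(1))
    also have "\<dots> = U #> inv g" unfolding coset_eq[OF U(1) D(1,2)] using g by (rule U.rcos_inv)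
    finally have "?D D = (U #> inv g) <#> (U #> c)" using c(2) by (simp add: FactGroup_def)
    also have "\<dots> = U #> (inv g \<otimes> c)" using g c(1) by (intro U.rcos_sum) auto
    finally have e: "?D D = U #> (inv g \<otimes> c)" .
    have "h \<in> U #> (inv g \<otimes> c) \<longleftrightarrow> h \<otimes> inv (inv g \<otimes> c) \<in> U"
      using g c D(3) by (intro U.rcos_module[OF is_group]) auto
    also have "h \<otimes> inv (inv g \<otimes> c) = (g \<otimes> h) \<otimes> inv c" using g c D(3) by (simp add: inv_mult m_ac)
    also have "\<dots> \<in> U \<longleftrightarrow> g \<otimes> h \<in> U #> c"
      using g c D(3) by (intro U.rcos_module[OF is_group, symmetric]) auto
    finally show ?thesis unfolding e c(2)[symmetric] .
  qed
  have "(x \<otimes>\<^bsub>\<Lambda>\<^esub> y) U C = (\<Oplus>\<^bsub>Zp p\<^esub>D\<in>{D \<in> rcosets U. x U D \<noteq> \<zero>\<^bsub>Zp p\<^esub>}. x U D \<otimes>\<^bsub>Zp p\<^esub> y U (?D D))"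
    using U(1,2) by (simp add: profinite_group_ring_def group_ring_def carrier_Mod)
  also have "\<dots> = (\<lambda>k. (\<Sum>D\<in>{D \<in> rcosets U. x U D \<noteq> \<zero>\<^bsub>Zp p\<^esub>}. (x U D \<otimes>\<^bsub>Zp p\<^esub> y U (?D D)) k) mod int p ^ k)"
  proof (rule Zp_finsum)
    show "finite {D \<in> rcosets U. x U D \<noteq> \<zero>\<^bsub>Zp p\<^esub>}" using finite_rcosets[OF U(1)] by simp
    fix D assume "D \<in> {D \<in> rcosets U. x U D \<noteq> \<zero>\<^bsub>Zp p\<^esub>}"
    then show "x U D \<otimes>\<^bsub>Zp p\<^esub> y U (?D D) \<in> carrier (Zp p)"
      using represents_Zp[OF x U(1)] represents_Zp[OF y U(1) D_in] cring.cring_simprules(5)[OF Zp_cring[OF p0]] by blast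
  qed simp
  finally have "(x \<otimes>\<^bsub>\<Lambda>\<^esub> y) U C k = (\<Sum>D\<in>{D \<in> rcosets U. x U D \<noteq> \<zero>\<^bsub>Zp p\<^esub>}. (x U D \<otimes>\<^bsub>Zp p\<^esub> y U (?D D)) k) mod int p ^ k"
    by (rule fun_cong)
  also have "(\<Sum>D\<in>{D \<in> rcosets U. x U D \<noteq> \<zero>\<^bsub>Zp p\<^esub>}. (x U D \<otimes>\<^bsub>Zp p\<^esub> y U (?D D)) k) = 
     (\<Sum>D\<in>rcosets U. (x U D \<otimes>\<^bsub>Zp p\<^esub> y U (?D D)) k)"
    using finite_rcosets[OF U(1)] by (intro sum.mono_neutral_left) (auto simp: Zp_ops)
  also have "\<dots> = (\<Sum>D\<in>rcosets U. ((\<Sum>a\<in>r m ` D. w m a) * (\<Sum>a'\<in>r m ` ?D D. v m a')) mod int p ^ k)"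
  proof (rule sum.cong[OF refl])
    fix D assume D: "D \<in> rcosets U"
    show "(x U D \<otimes>\<^bsub>Zp p\<^esub> y U (?D D)) k = ((\<Sum>a\<in>r m ` D. w m a) * (\<Sum>a'\<in>r m ` ?D D. v m a')) mod int p ^ k"
      unfolding Zp_ops repD[OF x U(1) D U(3,4)] repD[OF y U(1) D_in[OF D] U(3,4)] by (rule mod_mult_eq)
  qed
  also have "\<dots> mod int p ^ k = (\<Sum>D\<in>rcosets U. (\<Sum>a\<in>r m ` D. w m a) * (\<Sum>a'\<in>r m ` ?D D. v m a')) mod int p ^ k"
    by (rule mod_sum_eq)
  also have "(\<Sum>D\<in>rcosets U. (\<Sum>a\<in>r m ` D. w m a) * (\<Sum>a'\<in>r m ` ?D D. v m a')) =
    (\<Sum>D\<in>rcosets U. \<Sum>a\<in>r m ` D. w m a * (\<Sum>a'\<in>{a'\<in>?A. a * a' mod ?q \<in> r m ` C}. v m a'))"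
    unfolding sum_distrib_right
  proof (rule sum.cong[OF refl], rule sum.cong[OF refl])
    fix D a assume D: "D \<in> rcosets U" "a \<in> r m ` D"
    then obtain g where g: "g \<in> D" "a = r m g" by blast
    have gc: "g \<in> carrier G" using coset_subset[OF U(1) D(1)] g(1) by blast
    have "r m ` ?D D = {a'\<in>?A. a * a' mod ?q \<in> r m ` C}"
    proof (intro equalityI subsetI)
      fix a' assume "a' \<in> r m ` ?D D"
      then obtain h where h: "h \<in> ?D D" "a' = r m h" by blast
      have hc: "h \<in> carrier G" using coset_subset[OF U(1) D_in[OF D(1)]] h(1) by blast
      have "g \<otimes> h \<in> C" using mem[OF D(1) g(1) hc] h(1) by blast
      moreover have "r m (g \<otimes> h) = a * a' mod ?q" unfolding g(2) h(2) using gc hc by (rule r_mult)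
      ultimately have "a * a' mod ?q \<in> r m ` C" by (metis imageI)
      then show "a' \<in> {a'\<in>?A. a * a' mod ?q \<in> r m ` C}" using r_unit[OF hc] h(2) by simp
    next
      fix a' assume a': "a' \<in> {a'\<in>?A. a * a' mod ?q \<in> r m ` C}"
      then obtain h where h: "h \<in> carrier G" "a' = r m h" using r_surj by blast
      have "r m (g \<otimes> h) = a * a' mod ?q" unfolding g(2) h(2) using gc h(1) by (rule r_mult)
      then have "g \<otimes> h \<in> C" using a' coset_sat[OF U(1,4,2) m_closed[OF gc h(1)]] by simp
      then have "h \<in> ?D D" using mem[OF D(1) g(1) h(1)] by blast
      then show "a' \<in> r m ` ?D D" unfolding h(2) by blast
    qed
    then show "w m a * (\<Sum>a'\<in>r m ` ?D D. v m a') = w m a * (\<Sum>a'\<in>{a'\<in>?A. a * a' mod ?q \<in> r m ` C}. v m a')" by simp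
  qed
  also have "\<dots> = (\<Sum>a\<in>?A. w m a * (\<Sum>a'\<in>{a'\<in>?A. a * a' mod ?q \<in> r m ` C}. v m a'))"
    by (rule sum_rcosets[OF U(1,4)])
  also have "\<dots> = (\<Sum>c\<in>(SIGMA a:?A. {a'\<in>?A. a * a' mod ?q \<in> r m ` C}). w m (fst c) * v m (snd c))"
    unfolding sum_distrib_left by (subst sum.Sigma) (auto simp: case_prod_unfold)
  also have "(SIGMA a:?A. {a'\<in>?A. a * a' mod ?q \<in> r m ` C}) = {c\<in>?A \<times> ?A. fst c * snd c mod ?q \<in> r m ` C}" by auto
  also have "(\<Sum>c\<in>{c\<in>?A \<times> ?A. fst c * snd c mod ?q \<in> r m ` C}. w m (fst c) * v m (snd c)) = (\<Sum>b\<in>r m ` C. convolve p w v m b)"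
  proof -
    let ?S = "{c\<in>?A \<times> ?A. fst c * snd c mod ?q \<in> r m ` C}"
    have "(\<Sum>b\<in>r m ` C. convolve p w v m b) = (\<Sum>b\<in>r m ` C. \<Sum>c\<in>{c\<in>?S. fst c * snd c mod ?q = b}. w m (fst c) * v m (snd c))"
      unfolding convolve_def by (rule sum.cong[OF refl], rule sum.cong[OF _ refl]) blast
    also have "\<dots> = (\<Sum>c\<in>?S. w m (fst c) * v m (snd c))"
      using U(1,2) by (intro sum.group) auto
    finally show ?thesis by simp
  qed
  finally show "(x \<otimes>\<^bsub>\<Lambda>\<^esub> y) U C k = (\<Sum>b\<in>r m ` C. convolve p w v m b) mod int p ^ k" .
qed

end

context residue_tower
begin

definition \<phi> :: "nat \<Rightarrow> ('g set \<Rightarrow> 'g set \<Rightarrow> nat \<Rightarrow> int) \<Rightarrow> nat \<Rightarrow> int" where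
  "\<phi> n = (\<lambda>x\<in>carrier \<Lambda>. moment p (coords x) n)"

lemma represents_coherent: "represents x w \<Longrightarrow> coherent p w" by (simp add: represents_def)

lemma \<phi>_rep: assumes "represents x w" shows "\<phi> n x = moment p w n"
proof -
  have "moment p (coords x) n = moment p w n"
    using represents_coords[OF assms] by (intro moment_cong) (simp only: cong_def mod_mod_trivial)
  then show ?thesis using represents_carrier[OF assms] by (simp add: \<phi>_def)
qed

lemma \<phi>_carrier: "x \<in> carrier \<Lambda> \<Longrightarrow> \<phi> n x \<in> carrier (Zp p)"
  unfolding \<phi>_def using moment_carrier[OF p0 represents_coherent[OF carrier_rep[of x]]] by simp

lemma \<Lambda>_eqI:
  assumes "x \<in> carrier \<Lambda>" "y \<in> carrier \<Lambda>" "\<And>n. \<phi> n x = \<phi> n y" shows "x = y"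
proof (rule represents_eqI[OF carrier_rep[OF assms(1)] carrier_rep[OF assms(2)]])
  fix m b assume b: "b \<in> unit_res p m"
  have "[coords x m b - coords y m b = 0] (mod int p ^ m)"
  proof (rule moments_separate[OF prime _ _ b])
    show "coherent p (\<lambda>m b. coords x m b - coords y m b)"
      using assms(1,2) by (intro coherent_diff represents_coherent[OF carrier_rep])
    fix n m
    have "[(\<Sum>b\<in>unit_res p m. coords x m b * b ^ n) = (\<Sum>b\<in>unit_res p m. coords y m b * b ^ n)] (mod int p ^ m)"
      using fun_cong[OF assms(3)[of n], of m] assms(1,2) by (simp add: \<phi>_def moment_def cong_def)
    then show "[(\<Sum>b\<in>unit_res p m. (coords x m b - coords y m b) * b ^ n) = 0] (mod int p ^ m)"
      unfolding left_diff_distrib sum_subtractf by (simp only: cong_iff_dvd_diff diff_0_right)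
  qed
  then show "[coords x m b = coords y m b] (mod int p ^ m)"
    by (simp only: cong_iff_dvd_diff diff_0_right)
qed

lemma \<Lambda>_closed:
  "x \<in> carrier \<Lambda> \<Longrightarrow> y \<in> carrier \<Lambda> \<Longrightarrow> x \<oplus>\<^bsub>\<Lambda>\<^esub> y \<in> carrier \<Lambda>"
  "x \<in> carrier \<Lambda> \<Longrightarrow> y \<in> carrier \<Lambda> \<Longrightarrow> x \<otimes>\<^bsub>\<Lambda>\<^esub> y \<in> carrier \<Lambda>"
  "x \<in> carrier \<Lambda> \<Longrightarrow> a \<in> carrier (Zp p) \<Longrightarrow> a \<odot>\<^bsub>\<Lambda>\<^esub> x \<in> carrier \<Lambda>"
  "\<zero>\<^bsub>\<Lambda>\<^esub> \<in> carrier \<Lambda>" "\<one>\<^bsub>\<Lambda>\<^esub> \<in> carrier \<Lambda>"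
  "g \<in> carrier G \<Longrightarrow> group_elem p G T g \<in> carrier \<Lambda>"
proof -
  show el: "group_elem p G T g \<in> carrier \<Lambda>" if "g \<in> carrier G" for g
    using that by (rule represents_carrier[OF represents_elem])
  show "\<one>\<^bsub>\<Lambda>\<^esub> \<in> carrier \<Lambda>" unfolding one_eq_elem by (rule el[OF one_closed])
  show "\<zero>\<^bsub>\<Lambda>\<^esub> \<in> carrier \<Lambda>" by (rule represents_carrier[OF represents_zero])
  assume x: "x \<in> carrier \<Lambda>"
  show "a \<odot>\<^bsub>\<Lambda>\<^esub> x \<in> carrier \<Lambda>" if "a \<in> carrier (Zp p)"
    by (rule represents_carrier[OF represents_smult[OF carrier_rep[OF x] that]])
  assume y: "y \<in> carrier \<Lambda>"
  show "x \<oplus>\<^bsub>\<Lambda>\<^esub> y \<in> carrier \<Lambda>" by (rule represents_carrier[OF represents_add[OF carrier_rep[OF x] carrier_rep[OF y]]])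
  show "x \<otimes>\<^bsub>\<Lambda>\<^esub> y \<in> carrier \<Lambda>" by (rule represents_carrier[OF represents_mult[OF carrier_rep[OF x] carrier_rep[OF y]]])
qed

lemma \<phi>_add: "x \<in> carrier \<Lambda> \<Longrightarrow> y \<in> carrier \<Lambda> \<Longrightarrow> \<phi> n (x \<oplus>\<^bsub>\<Lambda>\<^esub> y) = \<phi> n x \<oplus>\<^bsub>Zp p\<^esub> \<phi> n y"
  using \<phi>_rep[OF represents_add[OF carrier_rep carrier_rep]] moment_add by (simp add: \<phi>_def)

lemma \<phi>_mult: "x \<in> carrier \<Lambda> \<Longrightarrow> y \<in> carrier \<Lambda> \<Longrightarrow> \<phi> n (x \<otimes>\<^bsub>\<Lambda>\<^esub> y) = \<phi> n x \<otimes>\<^bsub>Zp p\<^esub> \<phi> n y"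
  using \<phi>_rep[OF represents_mult[OF carrier_rep carrier_rep]] moment_conv[OF p0] by (simp add: \<phi>_def)

lemma \<phi>_smult: "x \<in> carrier \<Lambda> \<Longrightarrow> a \<in> carrier (Zp p) \<Longrightarrow> \<phi> n (a \<odot>\<^bsub>\<Lambda>\<^esub> x) = a \<otimes>\<^bsub>Zp p\<^esub> \<phi> n x"
  using \<phi>_rep[OF represents_smult[OF carrier_rep]] moment_smult[of p a] by (simp add: \<phi>_def)

lemma \<phi>_elem:
  assumes "g \<in> carrier G" shows "\<phi> n (group_elem p G T g) = (\<lambda>m. r m g ^ n mod int p ^ m)"
proof -
  have "(\<Sum>b\<in>unit_res p m. (if b = r m g then 1 else 0) * b ^ n) = r m g ^ n" for m
  proof -
    have "(\<Sum>b\<in>unit_res p m. (if b = r m g then 1 else 0) * b ^ n) = (\<Sum>b\<in>unit_res p m. if b = r m g then b ^ n else 0)"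
      by (rule sum.cong) auto
    also have "\<dots> = r m g ^ n" using r_unit[OF assms, of m] by (subst sum.delta) auto
    finally show ?thesis .
  qed
  then show ?thesis unfolding \<phi>_rep[OF represents_elem[OF assms]] moment_def by simp
qed

lemma \<phi>_one: "\<phi> n \<one>\<^bsub>\<Lambda>\<^esub> = \<one>\<^bsub>Zp p\<^esub>"
proof -
  have "(1 mod int p ^ m) ^ n mod int p ^ m = 1 mod int p ^ m" for m
    by (simp only: power_mod power_one)
  then show ?thesis unfolding one_eq_elem \<phi>_elem[OF one_closed] r_one Zp_ops by simp
qed

lemma \<phi>_zero: "\<phi> n \<zero>\<^bsub>\<Lambda>\<^esub> = \<zero>\<^bsub>Zp p\<^esub>"
  unfolding \<phi>_rep[OF represents_zero] by (simp add: moment_def Zp_ops)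

lemmas \<phi>_simps = \<phi>_add \<phi>_mult \<phi>_smult \<phi>_one \<phi>_zero

text \<open>The maps \<open>\<phi> n\<close> preserve all operations and are jointly injective, so every ring axiom is inherited
  from \<open>\<int>\<^sub>p\<close>.\<close>

lemma \<Lambda>_cring: "cring \<Lambda>"
proof -
  interpret Z: cring "Zp p" by (rule Zp_cring) simp
  note cl = \<Lambda>_closed \<phi>_carrier
  show ?thesis
  proof (rule cringI)
    show "abelian_group \<Lambda>"
    proof (rule abelian_groupI)
      fix x assume x: "x \<in> carrier \<Lambda>"
      have m1: "\<ominus>\<^bsub>Zp p\<^esub> \<one>\<^bsub>Zp p\<^esub> \<in> carrier (Zp p)" by simp
      have "(\<ominus>\<^bsub>Zp p\<^esub> \<one>\<^bsub>Zp p\<^esub>) \<odot>\<^bsub>\<Lambda>\<^esub> x \<oplus>\<^bsub>\<Lambda>\<^esub> x = \<zero>\<^bsub>\<Lambda>\<^esub>"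
        by (rule \<Lambda>_eqI) (use x m1 in \<open>simp_all add: cl \<phi>_simps Z.l_minus Z.l_neg\<close>)
      then show "\<exists>y\<in>carrier \<Lambda>. y \<oplus>\<^bsub>\<Lambda>\<^esub> x = \<zero>\<^bsub>\<Lambda>\<^esub>" using cl(3)[OF x m1] by blast
    next
      fix x y z assume "x \<in> carrier \<Lambda>" "y \<in> carrier \<Lambda>" "z \<in> carrier \<Lambda>"
      then show "x \<oplus>\<^bsub>\<Lambda>\<^esub> y \<oplus>\<^bsub>\<Lambda>\<^esub> z = x \<oplus>\<^bsub>\<Lambda>\<^esub> (y \<oplus>\<^bsub>\<Lambda>\<^esub> z)"
        by (intro \<Lambda>_eqI) (simp_all add: cl \<phi>_simps Z.a_assoc)
    next
      fix x y assume "x \<in> carrier \<Lambda>" "y \<in> carrier \<Lambda>"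
      then show "x \<oplus>\<^bsub>\<Lambda>\<^esub> y = y \<oplus>\<^bsub>\<Lambda>\<^esub> x"
        by (intro \<Lambda>_eqI) (simp_all add: cl \<phi>_simps Z.a_comm)
    next
      fix x assume "x \<in> carrier \<Lambda>"
      then show "\<zero>\<^bsub>\<Lambda>\<^esub> \<oplus>\<^bsub>\<Lambda>\<^esub> x = x"
        by (intro \<Lambda>_eqI) (simp_all add: cl \<phi>_simps)
    qed (auto intro: cl)
    show "comm_monoid \<Lambda>"
    proof (rule comm_monoidI)
      fix x y z assume "x \<in> carrier \<Lambda>" "y \<in> carrier \<Lambda>" "z \<in> carrier \<Lambda>"
      then show "x \<otimes>\<^bsub>\<Lambda>\<^esub> y \<otimes>\<^bsub>\<Lambda>\<^esub> z = x \<otimes>\<^bsub>\<Lambda>\<^esub> (y \<otimes>\<^bsub>\<Lambda>\<^esub> z)"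
        by (intro \<Lambda>_eqI) (simp_all add: cl \<phi>_simps Z.m_assoc)
    next
      fix x y assume "x \<in> carrier \<Lambda>" "y \<in> carrier \<Lambda>"
      then show "x \<otimes>\<^bsub>\<Lambda>\<^esub> y = y \<otimes>\<^bsub>\<Lambda>\<^esub> x"
        by (intro \<Lambda>_eqI) (simp_all add: cl \<phi>_simps Z.m_comm)
    next
      fix x assume "x \<in> carrier \<Lambda>"
      then show "\<one>\<^bsub>\<Lambda>\<^esub> \<otimes>\<^bsub>\<Lambda>\<^esub> x = x"
        by (intro \<Lambda>_eqI) (simp_all add: cl \<phi>_simps)
    qed (auto intro: cl)
    fix x y z assume "x \<in> carrier \<Lambda>" "y \<in> carrier \<Lambda>" "z \<in> carrier \<Lambda>"
    then show "(x \<oplus>\<^bsub>\<Lambda>\<^esub> y) \<otimes>\<^bsub>\<Lambda>\<^esub> z = x \<otimes>\<^bsub>\<Lambda>\<^esub> z \<oplus>\<^bsub>\<Lambda>\<^esub> y \<otimes>\<^bsub>\<Lambda>\<^esub> z"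
      by (intro \<Lambda>_eqI) (simp_all add: cl \<phi>_simps Z.l_distr)
  qed
qed

lemma \<phi>_ring_hom: "\<phi> n \<in> ring_hom \<Lambda> (Zp p)"
  by (rule ring_hom_memI) (auto simp: \<phi>_carrier \<phi>_simps)

section \<open>Continuity of the moments\<close>

abbreviation "\<Lambda>top \<equiv> profinite_group_ring_top p G T"

lemma continuous_discrete_combine:
  assumes "continuous_map Y (discrete_topology UNIV) f" "continuous_map Y (discrete_topology UNIV) g"
  shows "continuous_map Y (discrete_topology UNIV) (\<lambda>x. h (f x) (g x))"
proof -
  have f: "openin Y {x \<in> topspace Y. f x = a}" and g: "openin Y {x \<in> topspace Y. g x = b}" for a b
    using openin_continuous_map_preimage[OF assms(1), of "{a}"]
      openin_continuous_map_preimage[OF assms(2), of "{b}"] by simp_all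
  have "openin Y {x \<in> topspace Y. h (f x) (g x) \<in> S}" for S
  proof -
    have "{x \<in> topspace Y. h (f x) (g x) \<in> S} =
      \<Union>{{x \<in> topspace Y. f x = a} \<inter> {x \<in> topspace Y. g x = b} | a b. h a b \<in> S}"
      by auto
    moreover have "openin Y (\<Union>{{x \<in> topspace Y. f x = a} \<inter> {x \<in> topspace Y. g x = b} | a b. h a b \<in> S})"
      using f g by (intro openin_Union) (auto simp only: mem_Collect_eq openin_Int)
    ultimately show ?thesis by simp
  qed
  then show ?thesis by (auto simp: continuous_map_def)
qed

lemma continuous_discrete_sum:
  fixes f :: "'i \<Rightarrow> 'x \<Rightarrow> int"
  assumes "finite A" "\<And>i. i \<in> A \<Longrightarrow> continuous_map Y (discrete_topology UNIV) (f i)"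
  shows "continuous_map Y (discrete_topology UNIV) (\<lambda>x. \<Sum>i\<in>A. f i x)"
  using assms
proof (induction A rule: finite_induct)
  case empty then show ?case by simp
next
  case (insert a A)
  have "continuous_map Y (discrete_topology UNIV) (\<lambda>x. f a x + (\<Sum>i\<in>A. f i x))"
    by (rule continuous_discrete_combine[where h = "(+)"]) (use insert in auto)
  then show ?case using insert by simp
qed

lemma coord_continuous:
  assumes "U \<in> ON" "C \<in> rcosets U"
  shows "continuous_map \<Lambda>top (discrete_topology UNIV) (\<lambda>x. x U C k)"
proof -
  let ?Z = "product_topology (\<lambda>_::nat. discrete_topology (UNIV :: int set)) UNIV"
  let ?P = "\<lambda>U. product_topology (\<lambda>_. Zp_top p) (carrier (G Mod U))"
  have 1: "continuous_map \<Lambda>top (?P U) (\<lambda>x. x U)"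
    unfolding profinite_group_ring_top_def
    by (rule continuous_map_from_subtopology) (rule continuous_map_product_projection[OF assms(1)])
  have 2: "continuous_map (?P U) (Zp_top p) (\<lambda>y. y C)"
    by (rule continuous_map_product_projection) (simp only: carrier_Mod assms(2))
  have 3: "continuous_map (Zp_top p) (discrete_topology UNIV) (\<lambda>z. z k)"
    unfolding Zp_top_def
    by (rule continuous_map_from_subtopology) (rule continuous_map_product_projection[OF UNIV_I])
  show ?thesis using continuous_map_compose[OF continuous_map_compose[OF 1 2] 3] by (simp add: o_def)
qed

lemma \<Lambda>_topspace:
  assumes "x \<in> carrier \<Lambda>"
  shows "x \<in> topspace (product_topology (\<lambda>U. product_topology (\<lambda>_. Zp_top p) (carrier (G Mod U))) ON)"
proof -
  have "carrier (Zp p) = topspace (Zp_top p)" by (simp add: Zp_top_def)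
  then show ?thesis
    using assms unfolding carrier_\<Lambda>_iff topspace_product_topology carrier_Mod
    by (simp add: PiE_iff)
qed

lemma topspace_\<Lambda>top: "topspace \<Lambda>top = carrier \<Lambda>"
  unfolding profinite_group_ring_top_def topspace_subtopology using \<Lambda>_topspace by blast

lemma \<phi>_continuous: "continuous_map \<Lambda>top (Zp_top p) (\<phi> n)"
  unfolding Zp_top_def continuous_map_in_subtopology continuous_map_componentwise_UNIV
proof (intro conjI allI)
  fix m
  have "continuous_map \<Lambda>top (discrete_topology UNIV) (\<lambda>x. \<Sum>b\<in>unit_res p m. x (N m) (F m b) m * b ^ n)"
  proof (rule continuous_discrete_sum)
    fix b assume b: "b \<in> unit_res p m"
    have "continuous_map \<Lambda>top (discrete_topology UNIV) (\<lambda>x. x (N m) (F m b) m)"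
      using N_ON F_rcosets[OF b] by (rule coord_continuous)
    from continuous_discrete_combine[OF this this, of "\<lambda>a _. a * b ^ n"]
    show "continuous_map \<Lambda>top (discrete_topology UNIV) (\<lambda>x. x (N m) (F m b) m * b ^ n)" .
  qed simp
  from continuous_discrete_combine[OF this this, of "\<lambda>a _. a mod int p ^ m"]
  have "continuous_map \<Lambda>top (discrete_topology UNIV) (\<lambda>x. (\<Sum>b\<in>unit_res p m. x (N m) (F m b) m * b ^ n) mod int p ^ m)" .
  then show "continuous_map \<Lambda>top (discrete_topology UNIV) (\<lambda>x. \<phi> n x m)"
    by (rule continuous_map_eq) (simp add: topspace_\<Lambda>top \<phi>_def moment_def coords_def)
next
  show "\<phi> n \<in> topspace \<Lambda>top \<rightarrow> carrier (Zp p)" using \<phi>_carrier by (auto simp: topspace_\<Lambda>top)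
qed

text \<open>Density of the span of the group elements: at level \<open>M\<close> an element is the combination of coset
  representatives weighted by its own coefficients. The set \<open>A\<close> is any set closed under the formation
  of such combinations.\<close>

lemma span_approx:
  assumes x: "x \<in> carrier \<Lambda>"
    and A: "\<And>y z. y \<in> A \<Longrightarrow> z \<in> A \<Longrightarrow> y \<oplus>\<^bsub>\<Lambda>\<^esub> z \<in> A"
      "\<And>a y. a \<in> carrier (Zp p) \<Longrightarrow> y \<in> A \<Longrightarrow> a \<odot>\<^bsub>\<Lambda>\<^esub> y \<in> A" "\<zero>\<^bsub>\<Lambda>\<^esub> \<in> A"
      "\<And>g. g \<in> carrier G \<Longrightarrow> group_elem p G T g \<in> A"
  shows "\<exists>y\<in>A. y \<in> carrier \<Lambda> \<and> (\<forall>U\<in>ON. \<forall>C\<in>rcosets U. \<forall>k\<le>M. N M \<subseteq> U \<longrightarrow> y U C k = x U C k)"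
proof -
  define a where "a = (\<lambda>b. x (N M) (F M b))"
  have a: "a b \<in> carrier (Zp p)" if "b \<in> unit_res p M" for b
    unfolding a_def using represents_Zp[OF carrier_rep[OF x] N_ON F_rcosets[OF that]] .
  have "\<exists>y\<in>A. \<exists>w. represents y w \<and> (\<forall>c\<in>unit_res p M. w M c = (if c \<in> S then a c M else 0))"
    if "finite S" "S \<subseteq> unit_res p M" for S
    using that
  proof (induction S rule: finite_induct)
    case empty
    show ?case using A(3) represents_zero by force
  next
    case (insert b S)
    then obtain y w where y: "y \<in> A" "represents y w" "\<forall>c\<in>unit_res p M. w M c = (if c \<in> S then a c M else 0)" by auto
    obtain g where g: "g \<in> carrier G" "r M g = b" using r_surj insert.prems by blast
    have ab: "a b \<in> carrier (Zp p)" using a insert.prems by blast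
    let ?w = "\<lambda>m c. a b m * (if c = r m g then 1 else 0) + w m c"
    have "represents (a b \<odot>\<^bsub>\<Lambda>\<^esub> group_elem p G T g \<oplus>\<^bsub>\<Lambda>\<^esub> y) ?w"
      by (rule represents_add[OF represents_smult[OF represents_elem[OF g(1)] ab] y(2)])
    moreover have "a b \<odot>\<^bsub>\<Lambda>\<^esub> group_elem p G T g \<oplus>\<^bsub>\<Lambda>\<^esub> y \<in> A"
      using A ab g y(1) by blast
    moreover have "\<forall>c\<in>unit_res p M. ?w M c = (if c \<in> insert b S then a c M else 0)"
      using y(3) insert.hyps(2) g(2) by auto
    ultimately show ?case by blast
  qed
  from this[OF finite_unit_res subset_refl] obtain y w where
    y: "y \<in> A" "represents y w" "\<forall>c\<in>unit_res p M. w M c = a c M" by auto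
  have "y U C k = x U C k" if U: "U \<in> ON" "C \<in> rcosets U" "k \<le> M" "N M \<subseteq> U" for U C k
  proof -
    have "(\<Sum>b\<in>r M ` C. w M b) = (\<Sum>b\<in>r M ` C. coords x M b)"
      using y(3) r_image_unit[OF U(1,2)] by (intro sum.cong) (auto simp: a_def coords_def)
    then show ?thesis unfolding repD[OF y(2) U] repD[OF carrier_rep[OF x] U] by simp
  qed
  then show ?thesis using y(1) represents_carrier[OF y(2)] by blast
qed

text \<open>Finite combinations of group elements, on which the two maps agree, converge to \<open>x\<close>; the limits
  are compared digit by digit, each digit being eventually constant.\<close>

lemma \<phi>_unique:
  assumes ext: "\<psi> \<in> extensional (carrier \<Lambda>)" and hom: "\<psi> \<in> ring_hom \<Lambda> (Zp p)"
    and lin: "\<And>a x. a \<in> carrier (Zp p) \<Longrightarrow> x \<in> carrier \<Lambda> \<Longrightarrow> \<psi> (a \<odot>\<^bsub>\<Lambda>\<^esub> x) = a \<otimes>\<^bsub>Zp p\<^esub> \<psi> x"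
    and cont: "continuous_map \<Lambda>top (Zp_top p) \<psi>"
    and el: "\<And>g. g \<in> carrier G \<Longrightarrow> \<psi> (group_elem p G T g) = \<phi> n (group_elem p G T g)"
  shows "\<psi> = \<phi> n"
proof (rule extensionalityI[OF ext])
  show "\<phi> n \<in> extensional (carrier \<Lambda>)" by (simp add: \<phi>_def)
  fix x assume x: "x \<in> carrier \<Lambda>"
  interpret Z: cring "Zp p" by (rule Zp_cring) simp
  define A where "A = {y \<in> carrier \<Lambda>. \<psi> y = \<phi> n y}"
  have "\<psi> \<zero>\<^bsub>\<Lambda>\<^esub> = \<zero>\<^bsub>Zp p\<^esub>"
    using ring_hom_zero[OF hom cring.axioms(1)[OF \<Lambda>_cring] Z.ring_axioms] .
  then have "\<exists>y\<in>A. y \<in> carrier \<Lambda> \<and> (\<forall>U\<in>ON. \<forall>C\<in>rcosets U. \<forall>k\<le>M. N M \<subseteq> U \<longrightarrow> y U C k = x U C k)" for M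
    using ring_hom_add[OF hom] lin el \<Lambda>_closed
    by (intro span_approx x) (auto simp: A_def \<phi>_simps)
  then have "\<forall>M. \<exists>y. y \<in> A \<and> (\<forall>U\<in>ON. \<forall>C\<in>rcosets U. \<forall>k\<le>M. N M \<subseteq> U \<longrightarrow> y U C k = x U C k)"
    by blast
  from choice[OF this] obtain y
    where Y: "\<forall>M. y M \<in> A \<and> (\<forall>U\<in>ON. \<forall>C\<in>rcosets U. \<forall>k\<le>M. N M \<subseteq> U \<longrightarrow> y M U C k = x U C k)" ..
  have y: "y M \<in> carrier \<Lambda>" "\<psi> (y M) = \<phi> n (y M)" for M using Y unfolding A_def by blast+
  have yx: "y M U C k = x U C k" if "U \<in> ON" "C \<in> rcosets U" "k \<le> M" "N M \<subseteq> U" for M U C k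
    using Y that by blast
  have lim: "limitin \<Lambda>top y x sequentially"
    unfolding profinite_group_ring_top_def limitin_subtopology limitin_componentwise
  proof (intro conjI ballI)
    show "x \<in> carrier \<Lambda>" by fact
    show "\<forall>\<^sub>F M in sequentially. y M \<in> carrier \<Lambda>" using y(1) by simp
    show "x \<in> extensional ON" using x unfolding carrier_\<Lambda>_iff by blast
    show "\<forall>\<^sub>F M in sequentially. y M \<in> topspace (product_topology (\<lambda>U. product_topology (\<lambda>_. Zp_top p) (carrier (G Mod U))) ON)"
      using \<Lambda>_topspace[OF y(1)] by simp
    fix U assume U: "U \<in> ON"
    show "x U \<in> extensional (carrier (G Mod U))" using x U unfolding carrier_\<Lambda>_iff carrier_Mod by blast
    show "\<forall>\<^sub>F M in sequentially. y M U \<in> topspace (product_topology (\<lambda>_. Zp_top p) (carrier (G Mod U)))"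
      using y(1) U unfolding carrier_\<Lambda>_iff by (simp add: Zp_top_def carrier_Mod PiE_iff)
    fix C assume "C \<in> carrier (G Mod U)"
    then have C: "C \<in> rcosets U" by (simp only: carrier_Mod)
    obtain M0 where M0: "N M0 \<subseteq> U" using ex_level[OF U, of 0] by blast
    show "limitin (Zp_top p) (\<lambda>M. y M U C) (x U C) sequentially"
      unfolding Zp_top_def limitin_subtopology limitin_componentwise
    proof (intro conjI ballI)
      show "x U C \<in> carrier (Zp p)" using x U C unfolding carrier_\<Lambda>_iff by blast
      show "\<forall>\<^sub>F M in sequentially. y M U C \<in> carrier (Zp p)" using y(1) U C unfolding carrier_\<Lambda>_iff by simp
      fix k :: nat
      have "\<forall>\<^sub>F M in sequentially. y M U C k = x U C k"
        using eventually_ge_at_top[of "max k M0"]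
      proof eventually_elim
        case (elim M)
        then show ?case using N_antimono[of M0 M] M0 by (intro yx[OF U C]) auto
      qed
      then show "limitin (discrete_topology UNIV) (\<lambda>M. y M U C k) (x U C k) sequentially"
        unfolding limitin_def by (auto elim: eventually_mono)
    qed auto
  qed
  have rat_eval: "\<forall>\<^sub>F M in sequentially. f (y M) k = f x k" if "continuous_map \<Lambda>top (Zp_top p) f" for f k
  proof -
    have "limitin (Zp_top p) (f \<circ> y) (f x) sequentially"
      using that lim by (rule continuous_map_limit)
    then have "limitin (discrete_topology UNIV) (\<lambda>M. (f \<circ> y) M k) (f x k) sequentially"
      unfolding Zp_top_def limitin_subtopology limitin_componentwise by blast
    then have "\<forall>\<^sub>F M in sequentially. (f \<circ> y) M k \<in> {f x k}"
      unfolding limitin_def openin_discrete_topology by blast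
    then show ?thesis by simp
  qed
  show "\<psi> x = \<phi> n x"
  proof
    fix k
    have "\<forall>\<^sub>F M in sequentially. \<psi> x k = \<phi> n x k"
      using rat_eval[OF cont, of k] rat_eval[OF \<phi>_continuous[of n], of k]
      by eventually_elim (use y(2) in simp)
    then show "\<psi> x k = \<phi> n x k" by simp
  qed
qed

end

section \<open>Irreducibility of cyclotomic polynomials of prime power order\<close>

definition rat_eval :: "complex \<Rightarrow> rat poly \<Rightarrow> complex" where
  "rat_eval z f = poly (map_poly of_rat f) z"

lemma rat_eval_0 [simp]: "rat_eval z 0 = 0" by (simp add: rat_eval_def)

lemma rat_eval_pCons: "rat_eval z (pCons a f) = of_rat a + z * rat_eval z f"
  by (simp add: rat_eval_def map_poly_pCons)

lemma rat_eval_add: "rat_eval z (f + g) = rat_eval z f + rat_eval z g"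
proof (induction f arbitrary: g)
  case (pCons a f)
  show ?case
  proof (cases g rule: pCons_cases)
    case (pCons b h)
    show ?thesis unfolding pCons add_pCons rat_eval_pCons pCons.IH of_rat_add by (simp add: algebra_simps)
  qed
qed simp

lemma rat_eval_smult: "rat_eval z (smult c f) = of_rat c * rat_eval z f"
  by (induction f) (simp_all add: rat_eval_pCons of_rat_mult algebra_simps)

lemma rat_eval_mult: "rat_eval z (f * g) = rat_eval z f * rat_eval z g"
  by (induction f) (simp_all add: rat_eval_pCons rat_eval_add rat_eval_smult algebra_simps)

lemma rat_eval_diff: "rat_eval z (f - g) = rat_eval z f - rat_eval z g"
  using rat_eval_add[of z "f - g" g] by simp

lemma rat_eval_minus: "rat_eval z (- f) = - rat_eval z f"
  using rat_eval_diff[of z 0 f] by simp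

lemma rat_eval_1 [simp]: "rat_eval z 1 = 1"
  unfolding one_pCons by (simp add: rat_eval_pCons)

lemma rat_eval_power: "rat_eval z (f ^ n) = rat_eval z f ^ n"
  by (induction n) (simp_all add: rat_eval_mult)

lemma rat_eval_sum: "rat_eval z (\<Sum>i\<in>A. f i) = (\<Sum>i\<in>A. rat_eval z (f i))"
  by (induction A rule: infinite_finite_induct) (simp_all add: rat_eval_add)

lemma rat_eval_var: "rat_eval z [:0, 1:] = z" by (simp add: rat_eval_pCons)

lemma rat_eval_pcompose: "rat_eval z (pcompose f g) = rat_eval (rat_eval z g) f"
  by (induction f) (simp_all add: rat_eval_pCons rat_eval_add rat_eval_mult pcompose_pCons)

text \<open>The first coefficient of \<open>A\<close> that is prime to \<open>q\<close> meets only \<open>coeff B 0\<close> modulo \<open>q\<close>, so the same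
  coefficient of the product is prime to \<open>q\<close>; but only the leading one is.\<close>

lemma eisenstein_aux:
  fixes A B :: "int poly" and q :: int
  assumes q: "prime_elem q" and A0: "q dvd coeff A 0" and B0: "\<not> q dvd coeff B 0"
    and lc: "\<not> q dvd lead_coeff (A * B)" and co: "\<And>i. i < degree (A * B) \<Longrightarrow> q dvd coeff (A * B) i"
  shows "degree B = 0"
proof -
  have nz: "A \<noteq> 0" "B \<noteq> 0" using lc by auto
  have deg: "degree (A * B) = degree A + degree B" using nz by (rule degree_mult_eq)
  have "\<not> q dvd lead_coeff A" using lc unfolding lead_coeff_mult by (metis dvd_mult2)
  define i where "i = (LEAST i. \<not> q dvd coeff A i)"
  have i: "\<not> q dvd coeff A i" unfolding i_def by (rule LeastI) fact
  have less: "q dvd coeff A j" if "j < i" for j using not_less_Least[of j "\<lambda>i. \<not> q dvd coeff A i"] that unfolding i_def by blast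
  have "i \<le> degree A" unfolding i_def by (rule Least_le) fact
  have "coeff (A * B) i = (\<Sum>j\<le>i. coeff A j * coeff B (i - j))" by (rule coeff_mult)
  also have "\<dots> = (\<Sum>j<i. coeff A j * coeff B (i - j)) + coeff A i * coeff B 0"
    by (simp add: lessThan_Suc_atMost[symmetric])
  finally have e: "coeff (A * B) i = (\<Sum>j<i. coeff A j * coeff B (i - j)) + coeff A i * coeff B 0" .
  have "q dvd (\<Sum>j<i. coeff A j * coeff B (i - j))" by (intro dvd_sum) (simp add: less)
  moreover have "\<not> q dvd coeff A i * coeff B 0" using i B0 q by (simp add: prime_elem_dvd_mult_iff)
  ultimately have "\<not> q dvd coeff (A * B) i" unfolding e by (simp add: dvd_add_right_iff)
  then have "\<not> i < degree (A * B)" using co by blast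
  then show ?thesis using \<open>i \<le> degree A\<close> deg by simp
qed

lemma eisenstein:
  fixes A B :: "int poly" and q :: int
  assumes q: "prime_elem q" and c0: "q dvd coeff (A * B) 0" "\<not> q * q dvd coeff (A * B) 0"
    and lc: "\<not> q dvd lead_coeff (A * B)" and co: "\<And>i. i < degree (A * B) \<Longrightarrow> q dvd coeff (A * B) i"
  shows "degree A = 0 \<or> degree B = 0"
proof -
  have e: "coeff (A * B) 0 = coeff A 0 * coeff B 0" by (simp add: coeff_mult)
  have "\<not> (q dvd coeff A 0 \<and> q dvd coeff B 0)" using c0(2) unfolding e by (auto intro: mult_dvd_mono)
  moreover have "q dvd coeff A 0 \<or> q dvd coeff B 0" using c0(1) q unfolding e by (simp add: prime_elem_dvd_mult_iff)
  ultimately consider "q dvd coeff A 0" "\<not> q dvd coeff B 0" | "q dvd coeff B 0" "\<not> q dvd coeff A 0" by blast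
  then show ?thesis
  proof cases
    case 1
    have "degree B = 0" by (rule eisenstein_aux[OF q 1 lc]) (rule co)
    then show ?thesis by blast
  next
    case 2
    have "degree A = 0"
      by (rule eisenstein_aux[OF q 2]) (use lc co in \<open>simp_all add: mult.commute[of B A]\<close>)
    then show ?thesis by blast
  qed
qed

text \<open>The cyclotomic polynomial of order \<open>p ^ (l + 1)\<close>.\<close>

definition Phi :: "nat \<Rightarrow> nat \<Rightarrow> int poly" where
  "Phi p l = (\<Sum>i<p. ([:0, 1:] ^ (p ^ l)) ^ i)"

lemma dvd_power_diff: "(a::int poly) dvd f - g \<Longrightarrow> a dvd f ^ n - g ^ n"
  by (cases n) (auto simp: power_diff_sumr2 simp del: power_Suc intro: dvd_mult2)

lemma frobenius_poly:
  assumes "Factorial_Ring.prime p" shows "[:int p:] dvd (f + g) ^ p - (f ^ p + g ^ p)"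
proof -
  have p: "p > 0" using assms prime_gt_0_nat by blast
  then obtain p' where p': "p = Suc p'" by (cases p) auto
  have "(f + g) ^ p = (\<Sum>k\<le>p. of_nat (p choose k) * f ^ k * g ^ (p - k))" by (rule binomial_ring)
  also have "\<dots> = (\<Sum>k\<in>{1..p'}. of_nat (p choose k) * f ^ k * g ^ (p - k)) + (f ^ p + g ^ p)"
  proof -
    have "{..p} = insert 0 (insert p {1..p'})" using p' by auto
    then show ?thesis using p' by (simp add: add_ac)
  qed
  finally have e: "(f + g) ^ p - (f ^ p + g ^ p) = (\<Sum>k\<in>{1..p'}. of_nat (p choose k) * f ^ k * g ^ (p - k))" by simp
  have "[:int p:] dvd of_nat (p choose k) * f ^ k * g ^ (p - k)" if "k \<in> {1..p'}" for k
  proof -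
    have "p dvd (p choose k)" using that p' by (intro prime_power_dvd_choose[OF assms, of p 1 p k]) auto
    then obtain c where "p choose k = p * c" by blast
    then have "(of_nat (p choose k) :: int poly) = [:int p:] * of_nat c" by (simp add: of_nat_poly)
    then show ?thesis by (simp only: mult.assoc dvd_triv_left)
  qed
  then show ?thesis unfolding e by (rule dvd_sum)
qed

lemma frobenius_shift:
  assumes "Factorial_Ring.prime p"
  shows "[:int p:] dvd [:1, 1:] ^ (p ^ l) - (1 + [:0, 1:] ^ (p ^ l))"
proof (induction l)
  case 0 then show ?case by (simp add: one_pCons)
next
  case (Suc l)
  let ?U = "[:1, 1:] :: int poly" and ?Y = "[:0, 1:] :: int poly"
  have "[:int p:] dvd (?U ^ (p ^ l)) ^ p - (1 + ?Y ^ (p ^ l)) ^ p" using Suc by (rule dvd_power_diff)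
  moreover have "[:int p:] dvd (1 + ?Y ^ (p ^ l)) ^ p - (1 ^ p + (?Y ^ (p ^ l)) ^ p)"
    by (rule frobenius_poly[OF assms])
  ultimately have "[:int p:] dvd (?U ^ (p ^ l)) ^ p - (1 + ?Y ^ (p ^ l)) ^ p + ((1 + ?Y ^ (p ^ l)) ^ p - (1 ^ p + (?Y ^ (p ^ l)) ^ p))"
    by (rule dvd_add)
  also have "\<dots> = (?U ^ (p ^ l)) ^ p - (1 + (?Y ^ (p ^ l)) ^ p)" by simp
  finally show ?case by (simp only: power_mult[symmetric] power_Suc mult.commute[of "p ^ l" p])
qed

lemma pcompose_power: "pcompose (f ^ n) g = pcompose f g ^ n" for f g :: "int poly"
  by (induction n) (simp_all add: pcompose_mult pcompose_1)

text \<open>Modulo \<open>p\<close>, with \<open>T = Y ^ (p ^ l)\<close>, the Frobenius gives \<open>(1 + Y) ^ (p ^ l) = 1 + T\<close>, and hence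
  \<open>\<Phi>(1 + Y) = ((1 + T) ^ p - 1) / T = T ^ (p - 1)\<close>: this is the Eisenstein condition.\<close>

lemma Phi_shift:
  fixes p l :: nat
  assumes p: "Factorial_Ring.prime p"
  defines "C \<equiv> pcompose (Phi p l) [:1, 1:]"
  shows "[:int p:] dvd C - [:0, 1:] ^ (p ^ l * (p - 1))" "coeff C 0 = int p" "degree C = p ^ l * (p - 1)"
proof -
  let ?U = "[:1, 1:] :: int poly" and ?Y = "[:0, 1:] :: int poly"
  let ?V = "1 + ?Y ^ (p ^ l)" and ?W = "?U ^ (p ^ l)"
  have p0: "p > 0" using p prime_gt_0_nat by blast
  have C: "C = (\<Sum>i<p. ?W ^ i)"
    unfolding C_def Phi_def pcompose_sum by (simp add: pcompose_power pcompose_pCons)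
  have W: "[:int p:] dvd ?W - ?V" by (rule frobenius_shift[OF p])
  have "[:int p:] dvd (\<Sum>i<p. ?W ^ i - ?V ^ i)" by (intro dvd_sum dvd_power_diff W)
  then have 1: "[:int p:] dvd C - (\<Sum>i<p. ?V ^ i)" unfolding C sum_subtractf .
  have pe: "prime_elem [:int p:]" using p by (intro lift_prime_elem_poly) simp
  have "[:int p:] dvd ?V ^ p - (1 ^ p + (?Y ^ (p ^ l)) ^ p)" by (rule frobenius_poly[OF p])
  also have "?V ^ p - (1 ^ p + (?Y ^ (p ^ l)) ^ p) = (?V ^ p - 1) - (?Y ^ (p ^ l)) ^ p" by simp
  also have "?V ^ p - 1 = ?Y ^ (p ^ l) * (\<Sum>i<p. ?V ^ i)" using power_diff_1_eq[of ?V p] by simp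
  also have "(?Y ^ (p ^ l)) ^ p = ?Y ^ (p ^ l) * ?Y ^ (p ^ l * (p - 1))"
    using p0 by (simp add: power_mult[symmetric] power_add[symmetric] algebra_simps)
  finally have "[:int p:] dvd ?Y ^ (p ^ l) * ((\<Sum>i<p. ?V ^ i) - ?Y ^ (p ^ l * (p - 1)))"
    by (simp only: right_diff_distrib)
  moreover have "\<not> [:int p:] dvd ?Y ^ (p ^ l)"
  proof
    assume "[:int p:] dvd ?Y ^ (p ^ l)"
    then have "int p dvd coeff (?Y ^ (p ^ l)) (p ^ l)" unfolding const_poly_dvd_iff by blast
    also have "?Y ^ (p ^ l) = monom 1 (p ^ l)" by (simp add: monom_altdef)
    finally show False using p prime_gt_1_nat[OF p] by simp
  qed
  ultimately have 2: "[:int p:] dvd (\<Sum>i<p. ?V ^ i) - ?Y ^ (p ^ l * (p - 1))"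
    using pe by (simp add: prime_elem_dvd_mult_iff)
  from dvd_add[OF 1 2] show A: "[:int p:] dvd C - ?Y ^ (p ^ l * (p - 1))" by simp
  have "coeff C 0 = poly C 0" by (simp add: poly_0_coeff_0)
  also have "\<dots> = int p" unfolding C by (simp add: poly_sum poly_power)
  finally show "coeff C 0 = int p" .
  have le: "degree C \<le> p ^ l * (p - 1)"
    unfolding C
  proof (rule degree_sum_le)
    fix i assume "i \<in> {..<p}"
    have "degree (?W ^ i) \<le> degree ?W * i" by (rule degree_power_le)
    also have "degree ?W \<le> degree ?U * p ^ l" by (rule degree_power_le)
    then have "degree ?W * i \<le> p ^ l * (p - 1)" using \<open>i \<in> {..<p}\<close> by (intro mult_le_mono) auto
    finally show "degree (?W ^ i) \<le> p ^ l * (p - 1)" .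
  qed simp
  have "int p dvd coeff (C - monom 1 (p ^ l * (p - 1))) (p ^ l * (p - 1))"
    using A unfolding const_poly_dvd_iff monom_altdef by (simp only: smult_1_left) 
  then have "int p dvd coeff C (p ^ l * (p - 1)) - 1" by simp
  moreover have "\<not> int p dvd 0 - 1" using prime_gt_1_nat[OF p] by simp
  ultimately have "coeff C (p ^ l * (p - 1)) \<noteq> 0" by metis
  then have "p ^ l * (p - 1) \<le> degree C" by (rule le_degree)
  with le show "degree C = p ^ l * (p - 1)" by simp
qed

lemma Phi_irreducible_int:
  assumes p: "Factorial_Ring.prime p" and AB: "A * B = Phi p l"
  shows "degree A = 0 \<or> degree B = 0"
proof -
  let ?U = "[:1, 1:] :: int poly"
  let ?d = "p ^ l * (p - 1)"
  let ?C = "pcompose (Phi p l) ?U"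
  have p1: "p > 1" using p prime_gt_1_nat by blast
  have C: "pcompose A ?U * pcompose B ?U = ?C" unfolding AB[symmetric] by (rule pcompose_mult[symmetric])
  note S = Phi_shift[OF p, of l]
  have co: "int p dvd coeff ?C i - (if i = ?d then 1 else 0)" for i
  proof -
    have "int p dvd coeff (?C - monom 1 ?d) i"
      using S(1) unfolding const_poly_dvd_iff monom_altdef by (simp only: smult_1_left)
    then show ?thesis by (cases "i = ?d") simp_all
  qed
  have "degree (pcompose A ?U) = 0 \<or> degree (pcompose B ?U) = 0"
  proof (rule eisenstein[where q = "int p"], unfold C)
    show "prime_elem (int p)" using p by simp
    show "int p dvd coeff ?C 0" unfolding S(2) by simp
    have "int p * 1 < int p * int p" using p1 by (intro mult_strict_left_mono) auto
    then show "\<not> int p * int p dvd coeff ?C 0"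
      using p1 zdvd_imp_le[of "int p * int p" "int p"] unfolding S(2) by auto
    have "\<not> int p dvd 1" using p1 by simp
    then show "\<not> int p dvd lead_coeff ?C" using co[of ?d] unfolding S(3) by (metis dvd_diff_right_iff dvd_diff_commute)
    fix i assume "i < degree ?C"
    then show "int p dvd coeff ?C i" using co[of i] unfolding S(3) by simp
  qed
  then show ?thesis by (simp add: degree_pcompose)
qed

definition rat_poly :: "int poly \<Rightarrow> rat poly" where "rat_poly A = map_poly of_int A"

lemma coeff_ip [simp]: "coeff (rat_poly A) n = of_int (coeff A n)" by (simp add: rat_poly_def coeff_map_poly)

lemma rat_poly_mult: "rat_poly (A * B) = rat_poly A * rat_poly B" by (rule poly_eqI) (simp add: coeff_mult)
lemma rat_poly_inj: "rat_poly A = rat_poly B \<Longrightarrow> A = B" by (simp add: poly_eq_iff)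
lemma rat_poly_smult: "rat_poly (smult a A) = smult (of_int a) (rat_poly A)" by (rule poly_eqI) simp
lemma degree_ip: "degree (rat_poly A) = degree A" by (simp add: rat_poly_def degree_map_poly)

lemma clear_denominators: "\<exists>a>0. \<exists>A. smult (of_int a) P = rat_poly A"
proof (induction P)
  case 0
  have "smult (of_int 1) 0 = rat_poly 0" by (simp add: rat_poly_def)
  then show ?case by (intro exI[of _ 1]) auto
next
  case (pCons c P)
  then obtain a A where aA: "a > 0" "smult (of_int a) P = rat_poly A" by blast
  obtain n d where nd: "quotient_of c = (n, d)" by (cases "quotient_of c")
  have d: "d > 0" "c = of_int n / of_int d" using nd quotient_of_denom_pos quotient_of_div by auto
  have "smult (of_int (a * d)) (pCons c P) = pCons (of_int (a * n)) (smult (of_int d) (smult (of_int a) P))"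
    using d by (simp add: mult.commute)
  also have "\<dots> = rat_poly (pCons (a * n) (smult d A))"
    unfolding aA(2) by (rule poly_eqI) (simp add: coeff_pCons split: nat.split)
  finally show ?case using aA d by (intro exI[of _ "a * d"]) auto
qed

text \<open>Gauss's lemma: the primitive parts of the cleared factors multiply to \<open>\<Phi>\<close>.\<close>

lemma Phi_irreducible_rat:
  assumes p: "Factorial_Ring.prime p" and PR: "P * R = rat_poly (Phi p l)"
  shows "degree P = 0 \<or> degree R = 0"
proof -
  obtain a A where A: "a > 0" "smult (of_int a) P = rat_poly A" using clear_denominators by blast
  obtain b B where B: "b > 0" "smult (of_int b) R = rat_poly B" using clear_denominators by blast
  have "rat_poly (A * B) = smult (of_int (a * b)) (P * R)"
    unfolding rat_poly_mult A(2)[symmetric] B(2)[symmetric] by (simp add: mult.commute)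
  also have "\<dots> = rat_poly (smult (a * b) (Phi p l))" unfolding PR rat_poly_smult ..
  finally have e: "A * B = smult (a * b) (Phi p l)" by (rule rat_poly_inj)
  have "p > 0" using p prime_gt_0_nat by blast
  then have "coeff (Phi p l) 0 = 1"
    unfolding Phi_def by (simp add: coeff_sum coeff_0_power power_0_left sum.delta' if_distrib cong: if_cong)
  then have "Polynomial.content (Phi p l) dvd 1" using content_dvd_coeff[of "Phi p l" 0] by simp
  then have "Polynomial.content (Phi p l) = 1" by (metis content_1 is_unit_normalize normalize_content) 
  then have ct: "Polynomial.content A * Polynomial.content B = a * b"
    using arg_cong[OF e, of Polynomial.content] A(1) B(1) by (simp add: content_mult abs_mult)
  have "smult (a * b) (primitive_part A * primitive_part B) = smult (Polynomial.content A) (primitive_part A) * smult (Polynomial.content B) (primitive_part B)"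
    unfolding ct[symmetric] mult_smult_left mult_smult_right smult_smult by (simp only: mult.commute)
  also have "\<dots> = smult (a * b) (Phi p l)" unfolding content_times_primitive_part by (rule e)
  finally have "smult (a * b) (primitive_part A * primitive_part B - Phi p l) = 0"
    by (simp only: smult_diff_right diff_self)
  then have "a * b = 0 \<or> primitive_part A * primitive_part B - Phi p l = 0"
    by (simp only: smult_eq_0_iff)
  then have "primitive_part A * primitive_part B = Phi p l" using A(1) B(1) by auto
  from Phi_irreducible_int[OF p this] have "degree A = 0 \<or> degree B = 0" by simp
  moreover have "degree P = degree A" using A by (metis degree_ip degree_smult_eq of_int_0_eq_iff less_irrefl)
  moreover have "degree R = degree B" using B by (metis degree_ip degree_smult_eq of_int_0_eq_iff less_irrefl)
  ultimately show ?thesis by simp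
qed

lemma min_poly_dvd:
  assumes Q: "rat_eval z Q = 0" "Q \<noteq> 0" and irr: "\<And>P R. P * R = Q \<Longrightarrow> degree P = 0 \<or> degree R = 0"
    and f: "rat_eval z f = 0"
  shows "Q dvd f"
proof -
  obtain P where P: "P \<noteq> 0" "rat_eval z P = 0" and min: "\<And>g. g \<noteq> 0 \<Longrightarrow> rat_eval z g = 0 \<Longrightarrow> degree P \<le> degree g"
    using ex_has_least_nat[of "\<lambda>P. P \<noteq> 0 \<and> rat_eval z P = 0" Q degree] Q by blast
  have dv: "P dvd g" if "rat_eval z g = 0" for g
  proof -
    have "g mod P = g - g div P * P" by (simp add: minus_div_mult_eq_mod)
    then have "rat_eval z (g mod P) = 0" using that P(2) by (simp add: rat_eval_diff rat_eval_mult)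
    then have "g mod P = 0" using min[of "g mod P"] degree_mod_less'[OF P(1), of g] by force
    then show ?thesis by (simp add: dvd_eq_mod_eq_0)
  qed
  obtain R where R: "Q = P * R" using dv[OF Q(1)] by blast
  have "degree P \<noteq> 0"
  proof
    assume "degree P = 0"
    then obtain c where "P = [:c:]" by (rule degree_eq_zeroE)
    then show False using P by (simp add: rat_eval_pCons)
  qed
  then have "degree R = 0" using irr[OF R[symmetric]] by simp
  then obtain c where c: "R = [:c:]" by (rule degree_eq_zeroE)
  then have "c \<noteq> 0" using R Q(2) by auto
  then have "is_unit R" unfolding c by (simp add: is_unit_const_poly_iff dvd_field_iff)
  then show ?thesis using dv[OF f] unfolding R by (simp add: mult_unit_dvd_iff)
qed

text \<open>A generator \<open>d\<close> of the ideal \<open>(f, Q)\<close> does not vanish at \<open>z\<close>, so \<open>Q\<close> divides the cofactor of \<open>d\<close> in \<open>Q\<close> and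
  \<open>d\<close> is constant.\<close>

lemma rat_eval_inverse:
  assumes Q: "rat_eval z Q = 0" "Q \<noteq> 0" and irr: "\<And>P R. P * R = Q \<Longrightarrow> degree P = 0 \<or> degree R = 0"
    and f: "rat_eval z f \<noteq> 0"
  shows "\<exists>g. rat_eval z f * rat_eval z g = 1"
proof -
  let ?I = "\<lambda>d. d \<noteq> 0 \<and> (\<exists>u v. d = u * f + v * Q)"
  have "?I Q" using Q(2) by (auto intro: exI[of _ 0] exI[of _ 1])
  then obtain d where d: "?I d" and min: "\<And>g. ?I g \<Longrightarrow> degree d \<le> degree g"
    using ex_has_least_nat[of ?I Q degree] by blast
  obtain u v where uv: "d = u * f + v * Q" using d by blast
  have dv: "d dvd u' * f + v' * Q" for u' v'
  proof -
    let ?g = "u' * f + v' * Q"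
    define k where "k = ?g div d"
    have "?g mod d = ?g - k * d" unfolding k_def by (simp only: minus_div_mult_eq_mod)
    also have "\<dots> = ?g - k * (u * f + v * Q)" by (simp only: uv[symmetric])
    also have "\<dots> = (u' - k * u) * f + (v' - k * v) * Q" by (simp add: algebra_simps)
    finally have "\<exists>u v. ?g mod d = u * f + v * Q" by blast
    then have "?g mod d = 0" using min[of "?g mod d"] degree_mod_less'[of d ?g] d by force
    then show ?thesis by (simp add: dvd_eq_mod_eq_0)
  qed
  have "d dvd f" "d dvd Q" using dv[of 1 0] dv[of 0 1] by simp_all
  then obtain e e' where e: "f = d * e" "Q = d * e'" by (auto elim!: dvdE)
  have "rat_eval z d \<noteq> 0" using f unfolding e(1) rat_eval_mult by auto
  then have e0: "rat_eval z e' = 0" using Q(1) unfolding e(2) rat_eval_mult by simp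
  have "Q dvd e'"
  proof (rule min_poly_dvd[OF Q _ e0])
    fix P R assume "P * R = Q" then show "degree P = 0 \<or> degree R = 0" by (rule irr)
  qed
  then have "degree Q \<le> degree e'" using Q(2) e(2) by (intro dvd_imp_degree_le) auto
  moreover have "degree Q = degree d + degree e'" using Q(2) e(2) by (auto simp: degree_mult_eq)
  ultimately have "degree d = 0" by simp
  then obtain c where c: "d = [:c:]" by (rule degree_eq_zeroE)
  then have c0: "c \<noteq> 0" using d by auto
  have "rat_eval z f * rat_eval z (smult (1 / c) u) = rat_eval z (smult (1 / c) d)"
    unfolding uv rat_eval_smult rat_eval_add rat_eval_mult Q(1) by simp
  also have "\<dots> = 1" unfolding c using c0 by (simp add: rat_eval_pCons)
  finally show ?thesis ..
qed

section \<open>The cyclotomic field\<close>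

definition prim_root :: "nat \<Rightarrow> nat \<Rightarrow> complex" where
  "prim_root p m = exp (2 * of_real pi * \<i> / of_nat (p ^ m))"

lemma prim_root_power: "prim_root p m ^ j = exp (2 * of_real pi * \<i> * of_nat j / of_nat (p ^ m))"
  unfolding prim_root_def by (subst exp_of_nat_mult[symmetric]) (simp add: mult_ac)

lemma prim_root_power_eq_iff: "p > 0 \<Longrightarrow> prim_root p m ^ i = prim_root p m ^ j \<longleftrightarrow> i mod p ^ m = j mod p ^ m"
  unfolding prim_root_power by (intro complex_root_unity_eq) (simp add: Suc_leI)

lemma prim_root_power_1: "p > 0 \<Longrightarrow> prim_root p m ^ (p ^ m) = 1"
  using prim_root_power_eq_iff[of p m "p ^ m" 0] by simp

lemma root_eq_rt_power: "p > 0 \<Longrightarrow> \<xi> ^ (p ^ m) = 1 \<Longrightarrow> \<exists>j. \<xi> = prim_root p m ^ j"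
  using complex_roots_unity[of "p ^ m"] unfolding prim_root_power by (simp add: Suc_leI) blast

lemma prim_root_0 [simp]: "prim_root p 0 = 1" by (simp add: prim_root_def)

lemma prim_root_add: 
  assumes "p > 0" shows "prim_root p (m + k) ^ (p ^ k) = prim_root p m"
  unfolding prim_root_power prim_root_def[of p m] using assms by (simp add: power_add field_simps)

lemma rat_poly_Phi: "rat_poly (Phi p l) = (\<Sum>i<p. ([:0, 1:] ^ (p ^ l)) ^ i)"
proof -
  have sum: "rat_poly (\<Sum>i\<in>A. f i) = (\<Sum>i\<in>A. rat_poly (f i))" for A :: "nat set" and f
    by (rule poly_eqI) (simp add: coeff_sum)
  have "rat_poly 1 = 1" by (rule poly_eqI) simp
  then have pow: "rat_poly (f ^ n) = rat_poly f ^ n" for f n by (induction n) (simp_all add: rat_poly_mult)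
  have "rat_poly [:0, 1:] = [:0, 1:]" by (rule poly_eqI) (simp add: coeff_pCons split: nat.split)
  then show ?thesis unfolding Phi_def sum pow by simp
qed

lemma prim_root_ev_Phi:
  assumes p: "Factorial_Ring.prime p" and b: "\<not> p dvd b"
  shows "rat_eval (prim_root p (Suc l) ^ b) (rat_poly (Phi p l)) = 0"
proof -
  have p0: "p > 0" using p prime_gt_0_nat by blast
  let ?w = "(prim_root p (Suc l) ^ b) ^ (p ^ l)"
  have "?w \<noteq> 1"
  proof
    assume "?w = 1"
    then have "prim_root p (Suc l) ^ (b * p ^ l) = prim_root p (Suc l) ^ 0" by (simp add: power_mult)
    then have "b * p ^ l mod p ^ Suc l = 0 mod p ^ Suc l" by (simp only: prim_root_power_eq_iff[OF p0])
    then have "p * p ^ l dvd b * p ^ l" by (simp only: mod_0 dvd_eq_mod_eq_0 power_Suc)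
    then show False using b p0 by simp
  qed
  moreover have "?w ^ p = 1"
  proof -
    have "?w ^ p = (prim_root p (Suc l) ^ (p ^ Suc l)) ^ b" by (simp only: power_mult[symmetric] power_Suc mult_ac)
    then show ?thesis by (simp only: prim_root_power_1[OF p0] power_one)
  qed
  moreover have "(?w - 1) * (\<Sum>i<p. ?w ^ i) = ?w ^ p - 1" by (rule power_diff_1_eq[symmetric])
  ultimately have "(\<Sum>i<p. ?w ^ i) = 0" by simp
  then show ?thesis unfolding rat_poly_Phi rat_eval_sum rat_eval_power rat_eval_var .
qed

lemma Phi_nonzero: "Factorial_Ring.prime p \<Longrightarrow> rat_poly (Phi p l) \<noteq> 0"
proof
  assume p: "Factorial_Ring.prime p" and "rat_poly (Phi p l) = 0"
  then have "Phi p l = 0" by (intro rat_poly_inj) (simp add: rat_poly_def)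
  then show False using Phi_shift(2)[OF p, of l] prime_gt_0_nat[OF p] by simp
qed

lemma not_dvd_1_prime: "Factorial_Ring.prime (p::nat) \<Longrightarrow> \<not> p dvd 1"
  using prime_gt_1_nat by fastforce

text \<open>Irreducibility of the cyclotomic polynomial in the form in which it is used: a rational relation
  for \<open>\<zeta>\<close> also holds for each conjugate \<open>\<zeta> ^ b\<close>. It makes the automorphisms below well defined.\<close>

lemma conjugate_root:
  assumes p: "Factorial_Ring.prime p" and b: "\<not> p dvd b" and f: "rat_eval (prim_root p m) f = 0"
  shows "rat_eval (prim_root p m ^ b) f = 0"
proof (cases m)
  case 0
  then show ?thesis using f by simp
next
  case (Suc l)
  have "rat_poly (Phi p l) dvd f"
  proof (rule min_poly_dvd[OF _ Phi_nonzero[OF p]])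
    show "rat_eval (prim_root p m) (rat_poly (Phi p l)) = 0"
      using prim_root_ev_Phi[OF p not_dvd_1_prime[OF p], of l] unfolding Suc by simp
    show "P * R = rat_poly (Phi p l) \<Longrightarrow> degree P = 0 \<or> degree R = 0" for P R
      by (rule Phi_irreducible_rat[OF p])
  qed fact
  then obtain g where "f = rat_poly (Phi p l) * g" by (elim dvdE)
  then show ?thesis unfolding Suc using prim_root_ev_Phi[OF p b, of l] by (simp only: rat_eval_mult mult_zero_left)
qed

lemma prim_root_inverse:
  assumes p: "Factorial_Ring.prime p" and f: "rat_eval (prim_root p m) f \<noteq> 0"
  shows "\<exists>g. rat_eval (prim_root p m) f * rat_eval (prim_root p m) g = 1"
proof (cases m)
  case 0
  have z: "rat_eval 1 [:-1, 1:] = 0" by (simp add: rat_eval_pCons)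
  show ?thesis unfolding 0 prim_root_0
  proof (rule rat_eval_inverse[OF z])
    show "[:-1, 1:] \<noteq> (0 :: rat poly)" by simp
    show "rat_eval 1 f \<noteq> 0" using f unfolding 0 prim_root_0 .
    fix P R :: "rat poly" assume e: "P * R = [:-1, 1:]"
    then have "P \<noteq> 0" "R \<noteq> 0" by auto
    then have "degree P + degree R = 1" using arg_cong[OF e, of degree] by (simp add: degree_mult_eq)
    then show "degree P = 0 \<or> degree R = 0" by linarith
  qed
next
  case (Suc l)
  show ?thesis
  proof (rule rat_eval_inverse[OF _ Phi_nonzero[OF p] _ f])
    show "rat_eval (prim_root p m) (rat_poly (Phi p l)) = 0"
      using prim_root_ev_Phi[OF p not_dvd_1_prime[OF p], of l] unfolding Suc by simp
    show "P * R = rat_poly (Phi p l) \<Longrightarrow> degree P = 0 \<or> degree R = 0" for P R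
      by (rule Phi_irreducible_rat[OF p])
  qed
qed

abbreviation CC :: "complex ring" where "CC \<equiv> ring_of_type_algebra"

lemma CC_ops: "carrier CC = UNIV" "x \<oplus>\<^bsub>CC\<^esub> y = x + y" "x \<otimes>\<^bsub>CC\<^esub> y = x * y" "\<one>\<^bsub>CC\<^esub> = 1" "\<zero>\<^bsub>CC\<^esub> = 0"
  by (simp_all add: ring_of_type_algebra_def)

lemma CC_field: "field CC" by (rule field_from_type_algebra)

lemma CC_a_inv: "\<ominus>\<^bsub>CC\<^esub> x = - x"
proof -
  interpret field CC by (rule CC_field)
  show ?thesis by (rule minus_equality) (simp_all add: CC_ops)
qed

lemma CC_m_inv: assumes "x \<noteq> 0" shows "inv\<^bsub>CC\<^esub> x = inverse x"
proof -
  interpret field CC by (rule CC_field)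
  show ?thesis by (rule comm_inv_char) (use assms in \<open>simp_all add: CC_ops\<close>)
qed

lemma raise_level:
  assumes "p > 0" "m \<le> M" shows "\<exists>g. \<forall>b. rat_eval (prim_root p m ^ b) f = rat_eval (prim_root p M ^ b) g"
proof -
  obtain k where k: "M = m + k" using assms(2) le_Suc_ex by blast
  have "rat_eval (prim_root p M ^ b) (pcompose f ([:0, 1:] ^ (p ^ k))) = rat_eval (prim_root p m ^ b) f" for b
  proof -
    have "(prim_root p M ^ b) ^ (p ^ k) = prim_root p m ^ b"
      unfolding k prim_root_add[OF assms(1), of m k, symmetric] by (simp only: power_mult[symmetric] mult.commute)
    then show ?thesis by (simp only: rat_eval_pcompose rat_eval_power rat_eval_var)
  qed
  then show ?thesis by metis
qed

definition root_values :: "nat \<Rightarrow> complex set" where "root_values p = {rat_eval (prim_root p m) f | m f. True}"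

lemma root_values_I [intro]: "rat_eval (prim_root p m) f \<in> root_values p" by (auto simp: root_values_def)

lemma root_values_E:
  assumes "x \<in> root_values p" "p > 0" obtains m0 where "\<And>M. M \<ge> m0 \<Longrightarrow> \<exists>f. x = rat_eval (prim_root p M) f"
proof -
  obtain m f where x: "x = rat_eval (prim_root p m) f" using assms(1) by (auto simp: root_values_def)
  have "\<exists>g. x = rat_eval (prim_root p M) g" if "M \<ge> m" for M
    using raise_level[OF assms(2) that, of f] unfolding x by (metis power_one_right)
  then show ?thesis using that by blast
qed

lemma root_values_E2:
  assumes "x \<in> root_values p" "y \<in> root_values p" "p > 0" obtains m f g where "x = rat_eval (prim_root p m) f" "y = rat_eval (prim_root p m) g"
proof -
  obtain a where a: "\<And>M. M \<ge> a \<Longrightarrow> \<exists>f. x = rat_eval (prim_root p M) f" using root_values_E[OF assms(1,3)] by blast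
  obtain b where b: "\<And>M. M \<ge> b \<Longrightarrow> \<exists>f. y = rat_eval (prim_root p M) f" using root_values_E[OF assms(2,3)] by blast
  from a[of "max a b"] b[of "max a b"] that show ?thesis by auto
qed

lemma root_values_closed:
  assumes p: "Factorial_Ring.prime p" and x: "x \<in> root_values p"
  shows "y \<in> root_values p \<Longrightarrow> x + y \<in> root_values p" "y \<in> root_values p \<Longrightarrow> x * y \<in> root_values p" "- x \<in> root_values p" "inverse x \<in> root_values p"
proof -
  have p0: "p > 0" using p prime_gt_0_nat by blast
  show "x + y \<in> root_values p" if y: "y \<in> root_values p"
  proof -
    obtain m f g where e: "x = rat_eval (prim_root p m) f" "y = rat_eval (prim_root p m) g" using root_values_E2[OF x y p0] .
    show ?thesis unfolding e rat_eval_add[symmetric] by (rule root_values_I)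
  qed
  show "x * y \<in> root_values p" if y: "y \<in> root_values p"
  proof -
    obtain m f g where e: "x = rat_eval (prim_root p m) f" "y = rat_eval (prim_root p m) g" using root_values_E2[OF x y p0] .
    show ?thesis unfolding e rat_eval_mult[symmetric] by (rule root_values_I)
  qed
  obtain m f where e: "x = rat_eval (prim_root p m) f" using x by (auto simp: root_values_def)
  show "- x \<in> root_values p" unfolding e rat_eval_minus[symmetric] by (rule root_values_I)
  show "inverse x \<in> root_values p"
  proof (cases "x = 0")
    case True
    then show ?thesis using root_values_I[of p 0 0] by simp
  next
    case False
    then obtain g where "x * rat_eval (prim_root p m) g = 1" using prim_root_inverse[OF p, of m f] unfolding e by blast
    then have "inverse x = rat_eval (prim_root p m) g" by (rule inverse_unique)
    then show ?thesis using root_values_I[of p m g] by simp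
  qed
qed

lemma rat_KK: "of_rat c \<in> root_values p"
  using root_values_I[of p 0 "[:c:]"] by (simp add: rat_eval_pCons)

text \<open>The values of rational polynomials at the roots of unity are closed under inversion because the
  roots are algebraic, so they already form the generated field.\<close>

lemma cyc_field_eq:
  assumes p: "Factorial_Ring.prime p" shows "cyc_field p = root_values p"
proof (intro equalityI subsetI)
  have p0: "p > 0" using p prime_gt_0_nat by blast
  fix x assume "x \<in> cyc_field p"
  then show "x \<in> root_values p" unfolding cyc_field_def
  proof (induction rule: generate_field.induct)
    case one
    then show ?case using rat_KK[of 1 p] by (simp add: CC_ops)
  next
    case (incl h)
    then obtain m where "h ^ (p ^ m) = 1" by (auto simp: p_power_roots_def)
    then obtain j where "h = prim_root p m ^ j" using root_eq_rt_power[OF p0] by blast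
    then have "h = rat_eval (prim_root p m) ([:0, 1:] ^ j)" by (simp only: rat_eval_power rat_eval_var)
    then show ?case using root_values_I by simp
  next
    case (a_inv h) then show ?case using root_values_closed[OF p] by (simp add: CC_a_inv)
  next
    case (m_inv h) then show ?case using root_values_closed[OF p] by (simp add: CC_m_inv CC_ops)
  next
    case (eng_add h1 h2) then show ?case using root_values_closed[OF p] by (simp add: CC_ops)
  next
    case (eng_mult h1 h2) then show ?case using root_values_closed[OF p] by (simp add: CC_ops)
  qed
next
  have p0: "p > 0" using p prime_gt_0_nat by blast
  fix x assume "x \<in> root_values p"
  then obtain m f where x: "x = rat_eval (prim_root p m) f" by (auto simp: root_values_def)
  let ?L = "generate_field CC (p_power_roots p)"
  have one: "1 \<in> ?L" using generate_field.one[of CC "p_power_roots p"] by (simp only: CC_ops)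
  have add: "a + b \<in> ?L" if "a \<in> ?L" "b \<in> ?L" for a b
    using generate_field.eng_add[OF that] by (simp only: CC_ops)
  have mult: "a * b \<in> ?L" if "a \<in> ?L" "b \<in> ?L" for a b
    using generate_field.eng_mult[OF that] by (simp only: CC_ops)
  have neg: "- a \<in> ?L" if "a \<in> ?L" for a
    using generate_field.a_inv[OF that] by (simp only: CC_a_inv)
  have zero: "0 \<in> ?L" using add[OF one neg[OF one]] by simp
  have inv: "inverse a \<in> ?L" if "a \<in> ?L" for a
    using generate_field.m_inv[OF that] zero by (cases "a = 0") (simp_all add: CC_m_inv CC_ops)
  have nat: "of_nat n \<in> ?L" for n by (induction n) (simp_all add: zero one add)
  have int: "of_int n \<in> ?L" for n by (cases n rule: int_cases2) (simp_all add: nat neg)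
  have rat: "of_rat c \<in> ?L" for c
  proof -
    obtain n d where "quotient_of c = (n, d)" by (cases "quotient_of c")
    then have c: "c = of_int n / of_int d" by (rule quotient_of_div)
    have "(of_rat c :: complex) = of_int n / of_int d" unfolding c by (simp add: of_rat_divide)
    then have "(of_rat c :: complex) = of_int n * inverse (of_int d)" by (simp only: divide_inverse)
    then show ?thesis using mult[OF int inv[OF int]] by simp
  qed
  have "prim_root p m \<in> p_power_roots p" using prim_root_power_1[OF p0] by (auto simp: p_power_roots_def)
  then have prim_root: "prim_root p m \<in> ?L" by (rule generate_field.incl)
  have "rat_eval (prim_root p m) f \<in> ?L"
  proof (induction f)
    case 0 show ?case by (simp add: zero)
  next
    case (pCons a f)
    show ?case unfolding rat_eval_pCons by (intro add mult rat prim_root pCons)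
  qed
  then show "x \<in> cyc_field p" unfolding x cyc_field_def .
qed

section \<open>The Galois group and the cyclotomic character\<close>

lemma gal_carrier_iff: "g \<in> carrier (gal_group L K) \<longleftrightarrow> g \<in> extensional L \<and> bij_betw g L L \<and>
   (\<forall>x\<in>L. \<forall>y\<in>L. g (x * y) = g x * g y \<and> g (x + y) = g x + g y) \<and> g 1 = 1 \<and> (\<forall>x\<in>K. g x = x)"
proof -
  have "g \<in> ring_hom (CC\<lparr>carrier := L\<rparr>) (CC\<lparr>carrier := L\<rparr>) \<longleftrightarrow> 
    (\<forall>x\<in>L. \<forall>y\<in>L. g (x * y) = g x * g y \<and> g (x + y) = g x + g y) \<and> g 1 = 1" if "bij_betw g L L"
    using bij_betw_imp_funcset[OF that] by (auto simp: ring_hom_def CC_ops)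
  then show ?thesis by (auto simp: gal_group_def Bij_def)
qed

lemma gal_mult: "g \<in> carrier (gal_group L K) \<Longrightarrow> h \<in> carrier (gal_group L K) \<Longrightarrow> g \<otimes>\<^bsub>gal_group L K\<^esub> h = compose L g h"
  by (simp add: gal_group_def BijGroup_def)

lemma gal_one: "\<one>\<^bsub>gal_group L K\<^esub> = (\<lambda>x\<in>L. x)"
  by (simp add: gal_group_def BijGroup_def)

lemma gal_group_group:
  assumes one: "1 \<in> L" and cl: "\<And>x y. x \<in> L \<Longrightarrow> y \<in> L \<Longrightarrow> x + y \<in> L \<and> x * y \<in> L" and K: "K \<subseteq> L"
  shows "group (gal_group L K)"
proof (rule groupI)
  fix g h k assume g: "g \<in> carrier (gal_group L K)" and h: "h \<in> carrier (gal_group L K)"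
  note gi = g[unfolded gal_carrier_iff] and hi = h[unfolded gal_carrier_iff]
  have hL: "h x \<in> L" if "x \<in> L" for x using hi that bij_betwE by blast
  show "g \<otimes>\<^bsub>gal_group L K\<^esub> h \<in> carrier (gal_group L K)"
    unfolding gal_mult[OF g h] gal_carrier_iff
  proof (intro conjI ballI)
    show "bij_betw (compose L g h) L L" using gi hi by (intro bij_betw_compose) auto
  qed (use gi hi hL one cl K in \<open>auto simp: compose_def\<close>)
  show "g \<otimes>\<^bsub>gal_group L K\<^esub> h \<otimes>\<^bsub>gal_group L K\<^esub> k = g \<otimes>\<^bsub>gal_group L K\<^esub> (h \<otimes>\<^bsub>gal_group L K\<^esub> k)"
    if k: "k \<in> carrier (gal_group L K)"
  proof -
    interpret B: group "BijGroup L" by (rule group_BijGroup)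
    have "g \<in> carrier (BijGroup L)" "h \<in> carrier (BijGroup L)" "k \<in> carrier (BijGroup L)"
      using g h k by (auto simp: gal_group_def BijGroup_def)
    then show ?thesis using B.m_assoc[of g h k] by (simp add: gal_group_def)
  qed
next
  show "\<one>\<^bsub>gal_group L K\<^esub> \<in> carrier (gal_group L K)"
    unfolding gal_one gal_carrier_iff using one cl K by (auto simp: bij_betw_def inj_on_def)
next
  fix g assume g: "g \<in> carrier (gal_group L K)"
  note gi = g[unfolded gal_carrier_iff]
  have ext: "g \<in> extensional L" and bij: "bij_betw g L L" using gi by blast+
  show "\<one>\<^bsub>gal_group L K\<^esub> \<otimes>\<^bsub>gal_group L K\<^esub> g = g"
    using g Id_compose[OF bij_betw_imp_funcset[OF bij] ext]
    by (simp add: gal_group_def BijGroup_def id_Bij)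
  define h where "h = (\<lambda>x\<in>L. inv_into L g x)"
  have hL: "h x \<in> L" and gh: "g (h x) = x" if "x \<in> L" for x
    using that bij by (auto simp: h_def bij_betw_def inv_into_into f_inv_into_f)
  have hg: "h (g x) = x" if "x \<in> L" for x
    using that bij by (auto simp: h_def bij_betw_def)
  have gL: "g x \<in> L" if "x \<in> L" for x using bij that bij_betwE by blast
  have h: "h \<in> carrier (gal_group L K)"
    unfolding gal_carrier_iff
  proof (intro conjI ballI)
    show "h \<in> extensional L" by (simp add: h_def)
    show "bij_betw h L L" by (rule bij_betwI[of h L L g]) (use hL gL hg gh in auto)
    fix x y assume x: "x \<in> L" and y: "y \<in> L"
    have "g (h x * h y) = x * y" using gi gh hL x y by auto
    then show "h (x * y) = h x * h y" using hg[of "h x * h y"] cl hL x y by simp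
    have "g (h x + h y) = x + y" using gi gh hL x y by auto
    then show "h (x + y) = h x + h y" using hg[of "h x + h y"] cl hL x y by simp
  next
    show "h 1 = 1" using hg[OF one] gi by simp
    fix x assume "x \<in> K" then show "h x = x" using hg[of x] gi K by auto
  qed
  have "h \<otimes>\<^bsub>gal_group L K\<^esub> g = \<one>\<^bsub>gal_group L K\<^esub>"
    unfolding gal_mult[OF h g] gal_one using hg by (auto simp: compose_def fun_eq_iff)
  then show "\<exists>h\<in>carrier (gal_group L K). h \<otimes>\<^bsub>gal_group L K\<^esub> g = \<one>\<^bsub>gal_group L K\<^esub>" using h by blast
qed

locale cyclotomic =
  fixes p :: nat assumes prime: "Factorial_Ring.prime p"
begin

lemma p0 [simp]: "p > 0" using prime prime_gt_0_nat by blast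

abbreviation "L \<equiv> cyc_field p"
abbreviation "Gal \<equiv> G_cyc p"

lemma L_eq: "L = root_values p" by (rule cyc_field_eq[OF prime])

lemma L_closed: "x \<in> L \<Longrightarrow> y \<in> L \<Longrightarrow> x + y \<in> L \<and> x * y \<in> L"
  unfolding L_eq using root_values_closed[OF prime] by blast

lemma L_rat: "of_rat c \<in> L" unfolding L_eq by (rule rat_KK)
lemma L_1: "1 \<in> L" using L_rat[of 1] by simp
lemma L_ev: "rat_eval (prim_root p m) f \<in> L" unfolding L_eq by (rule root_values_I)
lemma L_rt: "prim_root p m \<in> L" using L_ev[of m "[:0, 1:]"] by (simp only: rat_eval_var)
lemma L_rats: "\<rat> \<subseteq> L" using L_rat by (auto elim: Rats_cases)

lemma group_Gal: "group Gal" using L_1 L_closed L_rats by (rule gal_group_group)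

sublocale Gal: group Gal by (rule group_Gal)

lemma gal:
  assumes "g \<in> carrier Gal"
  shows "g \<in> extensional L" "bij_betw g L L" "g 1 = 1" "g (of_rat c) = of_rat c"
    "x \<in> L \<Longrightarrow> y \<in> L \<Longrightarrow> g (x + y) = g x + g y" "x \<in> L \<Longrightarrow> y \<in> L \<Longrightarrow> g (x * y) = g x * g y"
    "x \<in> L \<Longrightarrow> g x \<in> L"
  using assms bij_betwE[of g L L] unfolding gal_carrier_iff by auto

lemma gal_power: assumes "g \<in> carrier Gal" "x \<in> L" shows "x ^ n \<in> L \<and> g (x ^ n) = g x ^ n"
  using assms by (induction n) (simp_all add: gal L_1 L_closed)

lemma gal_ev: assumes g: "g \<in> carrier Gal" shows "g (rat_eval (prim_root p m) f) = rat_eval (g (prim_root p m)) f"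
proof (induction f)
  case 0 show ?case using gal(4)[OF g, of 0] by simp
next
  case (pCons a f)
  show ?case unfolding rat_eval_pCons pCons.IH[symmetric]
    using g L_rat[of a] L_closed[OF L_rt L_ev, of m m f] L_rt L_ev
    by (simp add: gal)
qed

lemma ex_exponent:
  assumes g: "g \<in> carrier Gal" shows "\<exists>a\<in>unit_res p m. g (prim_root p m) = prim_root p m ^ nat a"
proof -
  let ?z = "prim_root p m"
  have "g ?z ^ (p ^ m) = 1"
    using gal_power[OF g L_rt, of m "p ^ m"] gal(3)[OF g] prim_root_power_1[OF p0, of m] by simp
  then obtain j where j: "g ?z = ?z ^ j" using root_eq_rt_power[OF p0] by blast
  have cop: "coprime (int j) (int p ^ m)"
  proof (cases m)
    case (Suc l)
    have "\<not> p dvd j"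
    proof
      assume "p dvd j"
      then obtain c where c: "j = p * c" by blast
      have "g (?z ^ (p ^ l)) = g ?z ^ (p ^ l)" using gal_power[OF g L_rt, of m "p ^ l"] by blast
      also have "\<dots> = (?z ^ (p ^ m)) ^ c"
        unfolding j unfolding c unfolding Suc by (simp only: power_mult[symmetric] power_Suc mult_ac)
      finally have "g (?z ^ (p ^ l)) = (?z ^ (p ^ m)) ^ c" .
      then have "g (?z ^ (p ^ l)) = g 1" using gal(3)[OF g] prim_root_power_1[OF p0, of m] by simp
      then have "?z ^ (p ^ l) = ?z ^ 0"
        using gal(2)[OF g] gal_power[OF g L_rt, of m "p ^ l"] L_1 by (auto simp: bij_betw_def dest: inj_onD)
      then have "p ^ l mod p ^ m = 0" by (simp only: prim_root_power_eq_iff[OF p0] mod_0)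
      moreover have "p ^ l < p ^ m" unfolding Suc using prime_gt_1_nat[OF prime] by simp
      ultimately have "p ^ l = 0" by simp
      then show False using p0 by simp
    qed
    then show ?thesis using coprime_prime_power_int[OF prime, of m "int j"] Suc by simp
  qed simp
  have "int j mod int p ^ m \<in> unit_res p m" using cop by (rule unit_res_mod[OF p0])
  moreover have "nat (int j mod int p ^ m) = j mod p ^ m" by (metis nat_int of_nat_mod of_nat_power)
  then have "g ?z = ?z ^ nat (int j mod int p ^ m)" unfolding j by (simp add: prim_root_power_eq_iff)
  ultimately show ?thesis by blast
qed

definition cyc_exp :: "(complex \<Rightarrow> complex) \<Rightarrow> nat \<Rightarrow> int" where
  "cyc_exp g m = (SOME a. a \<in> unit_res p m \<and> g (prim_root p m) = prim_root p m ^ nat a)"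

lemma cyc_exp: assumes "g \<in> carrier Gal" shows "cyc_exp g m \<in> unit_res p m" "g (prim_root p m) = prim_root p m ^ nat (cyc_exp g m)"
  using someI_ex[of "\<lambda>a. a \<in> unit_res p m \<and> g (prim_root p m) = prim_root p m ^ nat a"] ex_exponent[OF assms, of m]
  unfolding cyc_exp_def by blast+

lemma nat_mod_pow: "a \<ge> 0 \<Longrightarrow> nat (a mod int p ^ m) = nat a mod p ^ m"
  by (simp add: nat_mod_distrib nat_power_eq)

lemma prim_root_power_nat: "a \<ge> 0 \<Longrightarrow> prim_root p m ^ nat (a mod int p ^ m) = prim_root p m ^ nat a"
  by (simp add: prim_root_power_eq_iff nat_mod_pow)

lemma exponent_unique:
  assumes "0 \<le> a" "a < int p ^ m" "0 \<le> b" "b < int p ^ m" "prim_root p m ^ nat a = prim_root p m ^ nat b"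
  shows "a = b"
proof -
  have "nat a mod p ^ m = nat b mod p ^ m" using assms(5) by (simp only: prim_root_power_eq_iff[OF p0])
  moreover have "nat a < p ^ m" "nat b < p ^ m" using assms by (simp_all add: nat_less_iff)
  ultimately show ?thesis using assms by simp
qed

lemma cyc_exp_eqI:
  assumes "g \<in> carrier Gal" "0 \<le> a" "g (prim_root p m) = prim_root p m ^ nat a"
  shows "cyc_exp g m = a mod int p ^ m"
proof (rule exponent_unique)
  show "0 \<le> cyc_exp g m" "cyc_exp g m < int p ^ m" using cyc_exp(1)[OF assms(1), of m] by (auto simp: unit_res_def)
  show "0 \<le> a mod int p ^ m" "a mod int p ^ m < int p ^ m" by simp_all
  show "prim_root p m ^ nat (cyc_exp g m) = prim_root p m ^ nat (a mod int p ^ m)"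
    using cyc_exp(2)[OF assms(1), of m] assms(2,3) by (simp add: prim_root_power_nat)
qed

lemma cyc_exp_nonneg: "g \<in> carrier Gal \<Longrightarrow> 0 \<le> cyc_exp g m"
  using cyc_exp(1)[of g m] by (simp add: unit_res_def)

lemma cyc_exp_Suc: assumes g: "g \<in> carrier Gal" shows "cyc_exp g (Suc m) mod int p ^ m = cyc_exp g m"
proof (rule cyc_exp_eqI[OF g cyc_exp_nonneg[OF g], symmetric])
  have z: "prim_root p m = prim_root p (Suc m) ^ p" using prim_root_add[OF p0, of m 1] by simp
  have "g (prim_root p m) = (prim_root p (Suc m) ^ nat (cyc_exp g (Suc m))) ^ p"
    unfolding z using gal_power[OF g L_rt, of "Suc m" p] cyc_exp(2)[OF g, of "Suc m"] by simp
  then show "g (prim_root p m) = prim_root p m ^ nat (cyc_exp g (Suc m))"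
    unfolding z by (simp only: power_mult[symmetric] mult.commute)
qed

lemma cyc_exp_mult:
  assumes g: "g \<in> carrier Gal" and h: "h \<in> carrier Gal"
  shows "cyc_exp (g \<otimes>\<^bsub>Gal\<^esub> h) m = cyc_exp g m * cyc_exp h m mod int p ^ m"
proof (rule cyc_exp_eqI)
  show "g \<otimes>\<^bsub>Gal\<^esub> h \<in> carrier Gal" using g h by simp
  show "0 \<le> cyc_exp g m * cyc_exp h m" using cyc_exp_nonneg g h by simp
  have "(g \<otimes>\<^bsub>Gal\<^esub> h) (prim_root p m) = g (prim_root p m ^ nat (cyc_exp h m))"
    unfolding gal_mult[OF g h] compose_def using L_rt cyc_exp(2)[OF h] by simp
  also have "\<dots> = (prim_root p m ^ nat (cyc_exp g m)) ^ nat (cyc_exp h m)"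
    using gal_power[OF g L_rt] cyc_exp(2)[OF g] by simp
  also have "\<dots> = prim_root p m ^ nat (cyc_exp g m * cyc_exp h m)"
    using cyc_exp_nonneg[OF g] by (simp add: power_mult[symmetric] nat_mult_distrib)
  finally show "(g \<otimes>\<^bsub>Gal\<^esub> h) (prim_root p m) = prim_root p m ^ nat (cyc_exp g m * cyc_exp h m)" .
qed

text \<open>An automorphism is determined by its values on the roots of unity.\<close>

lemma cyc_exp_ext:
  assumes g: "g \<in> carrier Gal" and h: "h \<in> carrier Gal" and e: "\<And>m. cyc_exp g m = cyc_exp h m"
  shows "g = h"
proof (rule extensionalityI[OF gal(1)[OF g] gal(1)[OF h]])
  fix x assume "x \<in> L"
  then obtain m f where x: "x = rat_eval (prim_root p m) f" unfolding L_eq root_values_def by blast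
  show "g x = h x" unfolding x gal_ev[OF g] gal_ev[OF h] cyc_exp(2)[OF g] cyc_exp(2)[OF h] e ..
qed

lemma comm_Gal: "comm_group Gal"
proof (rule Gal.group_comm_groupI)
  fix g h assume g: "g \<in> carrier Gal" and h: "h \<in> carrier Gal"
  show "g \<otimes>\<^bsub>Gal\<^esub> h = h \<otimes>\<^bsub>Gal\<^esub> g"
  proof (rule cyc_exp_ext)
    show "cyc_exp (g \<otimes>\<^bsub>Gal\<^esub> h) m = cyc_exp (h \<otimes>\<^bsub>Gal\<^esub> g) m" for m
      unfolding cyc_exp_mult[OF g h] cyc_exp_mult[OF h g] by (simp only: mult.commute)
  qed (use g h in auto)
qed

lemma cyc_exp_one: "cyc_exp \<one>\<^bsub>Gal\<^esub> m = 1 mod int p ^ m"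
  by (rule cyc_exp_eqI[OF Gal.one_closed]) (simp_all add: gal_one L_rt)

lemma cyc_exp_carrier: assumes g: "g \<in> carrier Gal" shows "cyc_exp g \<in> carrier (Zp p)"
proof (rule Zp_carrierI[OF p0])
  show "cyc_exp g m mod int p ^ m = cyc_exp g m" for m using cyc_exp(1)[OF g, of m] by (simp add: unit_res_def)
  then show "[cyc_exp g (Suc m) = cyc_exp g m] (mod int p ^ m)" for m
    using cyc_exp_Suc[OF g, of m] by (simp only: cong_def)
qed

lemma cyc_exp_inv: assumes g: "g \<in> carrier Gal" shows "cyc_exp g \<otimes>\<^bsub>Zp p\<^esub> cyc_exp (inv\<^bsub>Gal\<^esub> g) = \<one>\<^bsub>Zp p\<^esub>"
proof
  fix m
  have "cyc_exp (g \<otimes>\<^bsub>Gal\<^esub> inv\<^bsub>Gal\<^esub> g) m = cyc_exp g m * cyc_exp (inv\<^bsub>Gal\<^esub> g) m mod int p ^ m" using g by (intro cyc_exp_mult) auto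
  then show "(cyc_exp g \<otimes>\<^bsub>Zp p\<^esub> cyc_exp (inv\<^bsub>Gal\<^esub> g)) m = \<one>\<^bsub>Zp p\<^esub> m" using g by (simp add: Zp_ops cyc_exp_one)
qed

lemma cyc_exp_Units: assumes g: "g \<in> carrier Gal" shows "cyc_exp g \<in> Units (Zp p)"
proof -
  interpret cring "Zp p" by (rule Zp_cring) simp
  have "cyc_exp (inv\<^bsub>Gal\<^esub> g) \<otimes>\<^bsub>Zp p\<^esub> cyc_exp g = \<one>\<^bsub>Zp p\<^esub>"
    using cyc_exp_inv[OF g] m_comm[OF cyc_exp_carrier[OF g] cyc_exp_carrier[OF Gal.inv_closed[OF g]]] by simp
  then show ?thesis unfolding Units_def using cyc_exp_carrier g cyc_exp_inv[OF g] Gal.inv_closed by blast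
qed

text \<open>The exponents with \<open>g \<zeta> = \<zeta> ^ (cyc_exp g m)\<close> form the \<open>p\<close>-adic unit that characterises \<open>\<kappa>(g)\<close>; its
  inverse is provided by the inverse automorphism.\<close>

lemma kappa_eq: assumes g: "g \<in> carrier Gal" shows "kappa p g = cyc_exp g"
  unfolding kappa_def
proof (rule the_equality)
  show "cyc_exp g \<in> Units (Zp p) \<and> (\<forall>m \<xi>. \<xi> ^ (p ^ m) = 1 \<longrightarrow> g \<xi> = \<xi> ^ nat (cyc_exp g m))"
  proof (intro conjI allI impI)
    show "cyc_exp g \<in> Units (Zp p)" by (rule cyc_exp_Units[OF g])
    fix m and \<xi> :: complex assume "\<xi> ^ (p ^ m) = 1"
    then obtain j where j: "\<xi> = prim_root p m ^ j" using root_eq_rt_power[OF p0] by blast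
    have "g \<xi> = (prim_root p m ^ nat (cyc_exp g m)) ^ j" unfolding j using gal_power[OF g L_rt] cyc_exp(2)[OF g] by simp
    then show "g \<xi> = \<xi> ^ nat (cyc_exp g m)" unfolding j by (simp only: power_mult[symmetric] mult.commute)
  qed
  fix a assume a: "a \<in> Units (Zp p) \<and> (\<forall>m \<xi>. \<xi> ^ (p ^ m) = 1 \<longrightarrow> g \<xi> = \<xi> ^ nat (a m))"
  then have ac: "a \<in> carrier (Zp p)" by (auto simp: Units_def)
  show "a = cyc_exp g"
  proof
    fix m
    have "g (prim_root p m) = prim_root p m ^ nat (a m)" using a prim_root_power_1[OF p0] by blast
    moreover have "0 \<le> a m" "a m mod int p ^ m = a m" using ac Zp_mod_self[OF ac] by (auto simp: Zp_carrier_iff)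
    ultimately show "a m = cyc_exp g m" using cyc_exp_eqI[OF g] by metis
  qed
qed

lemma sigma_welldef:
  assumes b: "\<not> p dvd b" and e: "rat_eval (prim_root p m) f = rat_eval (prim_root p m') f'"
  shows "rat_eval (prim_root p m ^ b) f = rat_eval (prim_root p m' ^ b) f'"
proof -
  let ?M = "max m m'"
  obtain g where g: "\<And>b. rat_eval (prim_root p m ^ b) f = rat_eval (prim_root p ?M ^ b) g" using raise_level[OF p0, of m ?M f] by auto
  obtain g' where g': "\<And>b. rat_eval (prim_root p m' ^ b) f' = rat_eval (prim_root p ?M ^ b) g'" using raise_level[OF p0, of m' ?M f'] by auto
  have "rat_eval (prim_root p ?M) (g - g') = 0" using e g[of 1] g'[of 1] by (simp add: rat_eval_diff)
  from conjugate_root[OF prime b this] show ?thesis unfolding g g' rat_eval_diff by simp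
qed

text \<open>The automorphism \<open>f(\<zeta>) \<mapsto> f(\<zeta> ^ b)\<close>, for an integer \<open>b\<close> prime to \<open>p\<close>. These automorphisms reach
  every residue class at every finite level, which is all that the inverse limit sees.\<close>

definition galois_elt :: "nat \<Rightarrow> complex \<Rightarrow> complex" where
  "galois_elt b = (\<lambda>x\<in>L. THE y. \<exists>m f. x = rat_eval (prim_root p m) f \<and> y = rat_eval (prim_root p m ^ b) f)"

lemma galois_elt_ev: assumes b: "\<not> p dvd b" shows "galois_elt b (rat_eval (prim_root p m) f) = rat_eval (prim_root p m ^ b) f"
proof -
  have "(THE y. \<exists>m' f'. rat_eval (prim_root p m) f = rat_eval (prim_root p m') f' \<and> y = rat_eval (prim_root p m' ^ b) f') = rat_eval (prim_root p m ^ b) f"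
  proof (rule the_equality)
    show "\<exists>m' f'. rat_eval (prim_root p m) f = rat_eval (prim_root p m') f' \<and> rat_eval (prim_root p m ^ b) f = rat_eval (prim_root p m' ^ b) f'" by blast
    fix y assume "\<exists>m' f'. rat_eval (prim_root p m) f = rat_eval (prim_root p m') f' \<and> y = rat_eval (prim_root p m' ^ b) f'"
    then obtain m' f' where e: "rat_eval (prim_root p m) f = rat_eval (prim_root p m') f'" "y = rat_eval (prim_root p m' ^ b) f'" by blast
    show "y = rat_eval (prim_root p m ^ b) f" unfolding e(2) by (rule sigma_welldef[OF b e(1), symmetric])
  qed
  then show ?thesis using L_ev by (simp add: galois_elt_def)
qed

lemma galois_elt_carrier: assumes b: "\<not> p dvd b" shows "galois_elt b \<in> carrier Gal"
  unfolding gal_carrier_iff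
proof (intro conjI ballI)
  note se = galois_elt_ev[OF b]
  have hom: "galois_elt b (x * y) = galois_elt b x * galois_elt b y \<and> galois_elt b (x + y) = galois_elt b x + galois_elt b y" if x: "x \<in> L" and y: "y \<in> L" for x y
  proof -
    obtain m f g where e: "x = rat_eval (prim_root p m) f" "y = rat_eval (prim_root p m) g" using root_values_E2[of x p y] x y p0 unfolding L_eq by metis
    show ?thesis unfolding e rat_eval_mult[symmetric] rat_eval_add[symmetric] se by (simp only: rat_eval_mult rat_eval_add)
  qed
  then show "galois_elt b (x * y) = galois_elt b x * galois_elt b y" "galois_elt b (x + y) = galois_elt b x + galois_elt b y" if "x \<in> L" "y \<in> L" for x y
    using that by blast+
  show "galois_elt b \<in> extensional L" by (simp add: galois_elt_def)
  have rat: "galois_elt b (of_rat c) = of_rat c" for c using se[of 0 "[:c:]"] by (simp add: rat_eval_pCons)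
  then show "galois_elt b 1 = 1" using rat[of 1] by simp
  show "galois_elt b x = x" if "x \<in> \<rat>" for x using that rat by (auto elim: Rats_cases)
  have into: "galois_elt b x \<in> L" if x: "x \<in> L" for x
  proof -
    obtain m f where e: "x = rat_eval (prim_root p m) f" using x unfolding L_eq root_values_def by blast
    have "rat_eval (prim_root p m ^ b) f = rat_eval (prim_root p m) (pcompose f ([:0, 1:] ^ b))" by (simp only: rat_eval_pcompose rat_eval_power rat_eval_var)
    then show ?thesis unfolding e se using L_ev by simp
  qed
  show "bij_betw (galois_elt b) L L"
  proof (rule bij_betwI')
    fix x y assume x: "x \<in> L" and y: "y \<in> L"
    show "galois_elt b x = galois_elt b y \<longleftrightarrow> x = y"
    proof
      assume e: "galois_elt b x = galois_elt b y"
      have my: "- y \<in> L" and "galois_elt b (- 1) = - 1" using root_values_closed(3)[OF prime] y rat[of "-1"] unfolding L_eq by auto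
      then have "galois_elt b (- y) = - galois_elt b y" using hom[of "-1" y] y L_rat[of "-1"] by simp
      then have z: "galois_elt b (x + - y) = 0" using hom[OF x my] e by simp
      have xy1: "x + - y \<in> L" using L_closed[OF x my] by blast
      have xy2: "inverse (x + - y) \<in> L" using xy1 unfolding L_eq by (rule root_values_closed(4)[OF prime])
      show "x = y"
      proof (rule ccontr)
        assume "x \<noteq> y"
        then have "(x + - y) * inverse (x + - y) = 1" by simp
        then have "galois_elt b (x + - y) * galois_elt b (inverse (x + - y)) = 1" using hom[OF xy1 xy2] rat[of 1] by simp
        then show False using z by simp
      qed
    qed simp
  next
    fix x assume "x \<in> L" then show "galois_elt b x \<in> L" by (rule into)
  next
    fix y assume "y \<in> L"
    then obtain m f where e: "y = rat_eval (prim_root p m) f" unfolding L_eq root_values_def by blast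
    have "coprime p b" using prime b by (rule prime_imp_coprime)
    then have "coprime b (p ^ m)" by (simp add: coprime_commute)
    from cong_solve_coprime_nat[OF this] obtain b' where "[b * b' = 1] (mod p ^ m)" by auto
    then have "prim_root p m ^ (b * b') = prim_root p m ^ 1" by (simp only: prim_root_power_eq_iff[OF p0] cong_def)
    then have "galois_elt b (rat_eval (prim_root p m) (pcompose f ([:0, 1:] ^ b'))) = y"
      unfolding se e by (simp only: rat_eval_pcompose rat_eval_power rat_eval_var power_mult[symmetric] power_one_right)
    then show "\<exists>x\<in>L. y = galois_elt b x" using L_ev by metis
  qed
qed

lemma galois_elt_rt: assumes "\<not> p dvd b" shows "galois_elt b (prim_root p m) = prim_root p m ^ b"
  using galois_elt_ev[OF assms, of m "[:0, 1:]"] by (simp only: rat_eval_var)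

lemma cyc_exp_sig: assumes "\<not> p dvd b" shows "cyc_exp (galois_elt b) m = int b mod int p ^ m"
  by (rule cyc_exp_eqI[OF galois_elt_carrier[OF assms]]) (use galois_elt_rt[OF assms] in simp_all)

lemma sigma_1p: "sigma_1p p \<in> carrier Gal" "cyc_exp (sigma_1p p) = Zp_of_int p (1 + int p)"
proof -
  have nd: "\<not> p dvd (1 + p)" using not_dvd_1_prime[OF prime] by (simp only: dvd_add_triv_right_iff not_False_eq_True)
  have aas: "cyc_exp (galois_elt (1 + p)) = Zp_of_int p (1 + int p)"
  proof
    fix m show "cyc_exp (galois_elt (1 + p)) m = Zp_of_int p (1 + int p) m"
      unfolding cyc_exp_sig[OF nd] by (simp only: Zp_of_int_def of_nat_add of_nat_1)
  qed
  have "sigma_1p p = galois_elt (1 + p)"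
    unfolding sigma_1p_def
  proof (rule the_equality)
    show "galois_elt (1 + p) \<in> carrier Gal \<and> kappa p (galois_elt (1 + p)) = Zp_of_int p (1 + int p)"
      using galois_elt_carrier[OF nd] kappa_eq[OF galois_elt_carrier[OF nd]] aas by simp
    fix g assume "g \<in> carrier Gal \<and> kappa p g = Zp_of_int p (1 + int p)"
    then show "g = galois_elt (1 + p)"
      using aas kappa_eq[of g] by (intro cyc_exp_ext galois_elt_carrier[OF nd]) auto
  qed
  then show "sigma_1p p \<in> carrier Gal" "cyc_exp (sigma_1p p) = Zp_of_int p (1 + int p)"
    using galois_elt_carrier[OF nd] aas by simp_all
qed

definition inv_exp :: "nat \<Rightarrow> (complex \<Rightarrow> complex) \<Rightarrow> int" where "inv_exp m g = cyc_exp (inv\<^bsub>Gal\<^esub> g) m"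

lemma inv_exp_one_iff: assumes g: "g \<in> carrier Gal" shows "inv_exp m g = 1 mod int p ^ m \<longleftrightarrow> g (prim_root p m) = prim_root p m"
proof -
  have e: "cyc_exp g m * cyc_exp (inv\<^bsub>Gal\<^esub> g) m mod int p ^ m = 1 mod int p ^ m"
    using fun_cong[OF cyc_exp_inv[OF g], of m] by (simp only: Zp_ops)
  have self: "cyc_exp h m mod int p ^ m = cyc_exp h m" if "h \<in> carrier Gal" for h
    using Zp_mod_self[OF cyc_exp_carrier[OF that]] .
  have 1: "inv_exp m g = 1 mod int p ^ m \<longleftrightarrow> cyc_exp g m = 1 mod int p ^ m"
  proof
    assume "inv_exp m g = 1 mod int p ^ m"
    then have "cyc_exp g m * (1 mod int p ^ m) mod int p ^ m = 1 mod int p ^ m" using e by (simp only: inv_exp_def)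
    then show "cyc_exp g m = 1 mod int p ^ m" using self[OF g] by (simp only: mod_mult_right_eq mult_1_right)
  next
    assume "cyc_exp g m = 1 mod int p ^ m"
    then have "(1 mod int p ^ m) * inv_exp m g mod int p ^ m = 1 mod int p ^ m" using e by (simp only: inv_exp_def)
    then show "inv_exp m g = 1 mod int p ^ m"
      using self[OF Gal.inv_closed[OF g]] by (simp only: inv_exp_def mod_mult_left_eq mult_1_left)
  qed
  have 2: "cyc_exp g m = 1 mod int p ^ m \<longleftrightarrow> g (prim_root p m) = prim_root p m"
  proof
    assume "cyc_exp g m = 1 mod int p ^ m"
    then have "g (prim_root p m) = prim_root p m ^ nat (1 mod int p ^ m)" using cyc_exp(2)[OF g, of m] by simp
    then show "g (prim_root p m) = prim_root p m" using prim_root_power_nat[of 1 m] by simp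
  next
    assume "g (prim_root p m) = prim_root p m"
    then show "cyc_exp g m = 1 mod int p ^ m" by (intro cyc_exp_eqI[OF g]) simp_all
  qed
  show ?thesis unfolding 1 2 ..
qed

lemma stabilizer_open_normal: "{g \<in> carrier Gal. g (prim_root p m) = prim_root p m} \<in> open_normal Gal (G_top p)"
  unfolding open_normal_def
proof (intro CollectI conjI)
  let ?S = "{g \<in> carrier Gal. g (prim_root p m) = prim_root p m}"
  interpret comm_group Gal by (rule comm_Gal)
  have S: "?S = {g \<in> carrier Gal. inv_exp m g = 1 mod int p ^ m}" using inv_exp_one_iff by blast
  have "subgroup ?S Gal"
  proof (rule Gal.subgroupI)
    have "\<one>\<^bsub>Gal\<^esub> (prim_root p m) = prim_root p m" using L_rt by (simp add: gal_one)
    then have "\<one>\<^bsub>Gal\<^esub> \<in> ?S" using Gal.one_closed by blast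
    then show "?S \<noteq> {}" by blast
    fix g assume g: "g \<in> ?S"
    then have gc: "g \<in> carrier Gal" and fx: "g (prim_root p m) = prim_root p m" by auto
    have "(inv\<^bsub>Gal\<^esub> g \<otimes>\<^bsub>Gal\<^esub> g) (prim_root p m) = \<one>\<^bsub>Gal\<^esub> (prim_root p m)" using gc by simp
    then have "(inv\<^bsub>Gal\<^esub> g) (prim_root p m) = prim_root p m"
      unfolding gal_mult[OF Gal.inv_closed[OF gc] gc] gal_one compose_def using L_rt fx by simp
    then show "inv\<^bsub>Gal\<^esub> g \<in> ?S" using gc by simp
    fix h assume h: "h \<in> ?S"
    then have "(g \<otimes>\<^bsub>Gal\<^esub> h) (prim_root p m) = prim_root p m"
      using g L_rt by (simp add: gal_mult compose_def)
    then show "g \<otimes>\<^bsub>Gal\<^esub> h \<in> ?S" using gc h by simp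
  qed blast
  then show "?S \<lhd> Gal" by (rule subgroup_imp_normal)
  let ?P = "product_topology (\<lambda>_. discrete_topology L) L"
  have "openin ?P {f \<in> topspace ?P. f (prim_root p m) \<in> {prim_root p m}}"
    by (rule openin_continuous_map_preimage[OF continuous_map_product_projection[OF L_rt]])
       (simp add: L_rt)
  then have "openin (G_top p) (carrier Gal \<inter> {f \<in> topspace ?P. f (prim_root p m) \<in> {prim_root p m}})"
    unfolding krull_top_def openin_subtopology by blast
  also have "carrier Gal \<inter> {f \<in> topspace ?P. f (prim_root p m) \<in> {prim_root p m}} = ?S"
    using gal(1,7) by (auto simp: PiE_iff)
  finally show "openin (G_top p) ?S" .
qed

text \<open>A basic neighbourhood of the identity fixes finitely many elements; all of them are polynomials in
  one root of unity, whose stabiliser is contained in the neighbourhood.\<close>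

lemma open_normal_basis:
  assumes U: "U \<in> open_normal Gal (G_top p)"
  shows "\<exists>m. {g \<in> carrier Gal. g (prim_root p m) = prim_root p m} \<subseteq> U"
proof -
  have "openin (G_top p) U" and "subgroup U Gal" using U normal_imp_subgroup unfolding open_normal_def by blast+
  then have oneU: "\<one>\<^bsub>Gal\<^esub> \<in> U" using subgroup.one_closed by blast
  let ?P = "product_topology (\<lambda>_. discrete_topology L) L"
  obtain W where W: "openin ?P W" "U = W \<inter> carrier Gal"
    using \<open>openin (G_top p) U\<close> unfolding krull_top_def openin_subtopology by blast
  have "\<one>\<^bsub>Gal\<^esub> \<in> W" using oneU W(2) by blast
  then obtain V where V: "finite {i \<in> L. V i \<noteq> topspace (discrete_topology L)}" "\<one>\<^bsub>Gal\<^esub> \<in> Pi\<^sub>E L V" "Pi\<^sub>E L V \<subseteq> W"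
    using W(1) unfolding openin_product_topology_alt by blast
  let ?F = "{i \<in> L. V i \<noteq> topspace (discrete_topology L)}"
  have "\<exists>m0. \<forall>M\<ge>m0. \<exists>f. x = rat_eval (prim_root p M) f" if "x \<in> ?F" for x
    using root_values_E[of x p] that unfolding L_eq by (metis (no_types, lifting) p0 mem_Collect_eq)
  then obtain lev where lev: "\<And>x M. x \<in> ?F \<Longrightarrow> lev x \<le> M \<Longrightarrow> \<exists>f. x = rat_eval (prim_root p M) f" by metis
  define M where "M = Max (insert 0 (lev ` ?F))"
  have M: "lev x \<le> M" if "x \<in> ?F" for x unfolding M_def using V(1) that by (intro Max_ge) auto
  have "g \<in> U" if g: "g \<in> carrier Gal" "g (prim_root p M) = prim_root p M" for g
  proof -
    have "g \<in> Pi\<^sub>E L V"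
      unfolding PiE_iff
    proof (intro conjI ballI)
      show "g \<in> extensional L" by (rule gal(1)[OF g(1)])
      fix x assume x: "x \<in> L"
      show "g x \<in> V x"
      proof (cases "x \<in> ?F")
        case True
        then obtain f where f: "x = rat_eval (prim_root p M) f" using lev M by blast
        have "g x = x" unfolding f gal_ev[OF g(1)] g(2) ..
        moreover have "\<one>\<^bsub>Gal\<^esub> x \<in> V x" using V(2) x by (rule PiE_mem)
        ultimately show ?thesis using x by (simp add: gal_one)
      next
        case False
        then have "V x = L" using x by simp
        then show ?thesis using gal(7)[OF g(1) x] by simp
      qed
    qed
    then show ?thesis using V(3) W(2) g(1) by blast
  qed
  then show ?thesis by blast
qed

lemma tower: "residue_tower p Gal (G_top p) inv_exp"
proof (rule residue_tower.intro)
  show "Factorial_Ring.prime p" by (rule prime)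
  show "comm_group Gal" by (rule comm_Gal)
  interpret comm_group Gal by (rule comm_Gal)
  show "inv_exp m g \<in> unit_res p m" if "g \<in> carrier Gal" for g m
    unfolding inv_exp_def using that by (intro cyc_exp(1)) simp
  show "inv_exp m (g \<otimes>\<^bsub>Gal\<^esub> h) = inv_exp m g * inv_exp m h mod int p ^ m" if "g \<in> carrier Gal" "h \<in> carrier Gal" for g h m
    unfolding inv_exp_def inv_mult[OF that] using that by (intro cyc_exp_mult) auto
  show "inv_exp (Suc m) g mod int p ^ m = inv_exp m g" if "g \<in> carrier Gal" for g m
    unfolding inv_exp_def using that by (intro cyc_exp_Suc) simp
  show "\<exists>g\<in>carrier Gal. inv_exp m g = b" if b: "b \<in> unit_res p m" for b m
  proof (cases m)
    case 0
    have "inv_exp m \<one>\<^bsub>Gal\<^esub> = b" using b 0 by (simp add: inv_exp_def cyc_exp_one unit_res_def)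
    then show ?thesis by blast
  next
    case (Suc l)
    have b': "0 \<le> b" "b < int p ^ m" "\<not> int p dvd b"
      using b coprime_prime_power_int[OF prime, of m b] Suc unfolding unit_res_def by auto
    then have nd: "\<not> p dvd nat b" by (metis int_dvd_int_iff int_nat_eq)
    have "inv_exp m (inv\<^bsub>Gal\<^esub> (galois_elt (nat b))) = b"
      using galois_elt_carrier[OF nd] cyc_exp_sig[OF nd, of m] b' by (simp add: inv_exp_def)
    then show ?thesis using Gal.inv_closed[OF galois_elt_carrier[OF nd]] by blast
  qed
  have eq: "{g \<in> carrier Gal. inv_exp m g = 1 mod int p ^ m} = {g \<in> carrier Gal. g (prim_root p m) = prim_root p m}" for m
    using inv_exp_one_iff by blast
  show "{g \<in> carrier Gal. inv_exp m g = 1 mod int p ^ m} \<in> open_normal Gal (G_top p)" for m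
    unfolding eq by (rule stabilizer_open_normal)
  show "\<exists>m. {g \<in> carrier Gal. inv_exp m g = 1 mod int p ^ m} \<subseteq> U" if "U \<in> open_normal Gal (G_top p)" for U
    unfolding eq using that by (rule open_normal_basis)
qed

end

section \<open>Existence and uniqueness of the pseudomeasure\<close>

context cyclotomic
begin

sublocale R: residue_tower p Gal "G_top p" inv_exp by (rule tower)

lemma Lambda_eq: "Lambda p = R.\<Lambda>" by (simp add: Lambda_def)

lemma Zp_inv_power:
  assumes g: "g \<in> carrier Gal"
  shows "cyc_exp g [^]\<^bsub>Zp p\<^esub> (- int n) = (\<lambda>m. inv_exp m g ^ n mod int p ^ m)"
proof -
  interpret Z: cring "Zp p" by (rule Zp_cring) simp
  let ?u = "cyc_exp g" and ?v = "cyc_exp (inv\<^bsub>Gal\<^esub> g)"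
  have u: "?u \<in> carrier (Zp p)" and v: "?v \<in> carrier (Zp p)"
    using cyc_exp_carrier[OF g] cyc_exp_carrier[OF Gal.inv_closed[OF g]] .
  have uv: "?u [^]\<^bsub>Zp p\<^esub> n \<otimes>\<^bsub>Zp p\<^esub> ?v [^]\<^bsub>Zp p\<^esub> n = \<one>\<^bsub>Zp p\<^esub>"
    using Z.nat_pow_distrib[OF u v, of n] cyc_exp_inv[OF g] by simp
  have vn: "?v [^]\<^bsub>Zp p\<^esub> n = (\<lambda>m. inv_exp m g ^ n mod int p ^ m)"
    unfolding Zp_pow[OF p0] inv_exp_def ..
  have inv: "inv\<^bsub>Zp p\<^esub> (?u [^]\<^bsub>Zp p\<^esub> n) = ?v [^]\<^bsub>Zp p\<^esub> n"
    using uv u v by (intro Z.comm_inv_char) auto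
  show ?thesis
  proof (cases "n = 0")
    case True
    have "?u [^]\<^bsub>Zp p\<^esub> (- int n) = ?v [^]\<^bsub>Zp p\<^esub> n" using True by (simp add: int_pow_def2)
    then show ?thesis unfolding vn .
  next
    case False
    then have "?u [^]\<^bsub>Zp p\<^esub> (- int n) = inv\<^bsub>Zp p\<^esub> (?u [^]\<^bsub>Zp p\<^esub> n)" by (simp add: int_pow_def2)
    then show ?thesis unfolding inv vn .
  qed
qed

lemma phi_elem_kappa:
  assumes "g \<in> carrier Gal"
  shows "R.\<phi> n (Lambda_elem p g) = kappa p g [^]\<^bsub>Zp p\<^esub> (- int n)"
  unfolding Lambda_elem_def R.\<phi>_elem[OF assms] kappa_eq[OF assms] Zp_inv_power[OF assms] ..

text \<open>The moments are the continuous algebra morphism that the statement describes: they are continuous,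
  and a continuous linear map is determined by its values on group elements, by density.\<close>

lemma kappa_pow_eq: "kappa_pow p (- int n) = R.\<phi> n"
  unfolding kappa_pow_def
proof (rule the_equality)
  show "R.\<phi> n \<in> extensional (carrier (Lambda p)) \<and>
     R.\<phi> n \<in> ring_hom (Lambda p) (Zp p) \<and>
     (\<forall>a\<in>carrier (Zp p). \<forall>x\<in>carrier (Lambda p). R.\<phi> n (a \<odot>\<^bsub>Lambda p\<^esub> x) = a \<otimes>\<^bsub>Zp p\<^esub> R.\<phi> n x) \<and>
     continuous_map (Lambda_top p) (Zp_top p) (R.\<phi> n) \<and>
     (\<forall>g\<in>carrier (G_cyc p). R.\<phi> n (Lambda_elem p g) = kappa p g [^]\<^bsub>Zp p\<^esub> (- int n))"
  proof (intro conjI ballI)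
    show "R.\<phi> n \<in> extensional (carrier (Lambda p))" unfolding Lambda_eq R.\<phi>_def by simp
    show "R.\<phi> n \<in> ring_hom (Lambda p) (Zp p)" unfolding Lambda_eq by (rule R.\<phi>_ring_hom)
    show "R.\<phi> n (a \<odot>\<^bsub>Lambda p\<^esub> x) = a \<otimes>\<^bsub>Zp p\<^esub> R.\<phi> n x"
      if "a \<in> carrier (Zp p)" "x \<in> carrier (Lambda p)" for a x
      using that unfolding Lambda_eq by (intro R.\<phi>_smult)
    show "continuous_map (Lambda_top p) (Zp_top p) (R.\<phi> n)"
      unfolding Lambda_top_def by (rule R.\<phi>_continuous)
    show "R.\<phi> n (Lambda_elem p g) = kappa p g [^]\<^bsub>Zp p\<^esub> (- int n)" if "g \<in> carrier (G_cyc p)" for g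
      using that by (rule phi_elem_kappa)
  qed
  fix \<psi> assume \<psi>: "\<psi> \<in> extensional (carrier (Lambda p)) \<and>
     \<psi> \<in> ring_hom (Lambda p) (Zp p) \<and>
     (\<forall>a\<in>carrier (Zp p). \<forall>x\<in>carrier (Lambda p). \<psi> (a \<odot>\<^bsub>Lambda p\<^esub> x) = a \<otimes>\<^bsub>Zp p\<^esub> \<psi> x) \<and>
     continuous_map (Lambda_top p) (Zp_top p) \<psi> \<and>
     (\<forall>g\<in>carrier (G_cyc p). \<psi> (Lambda_elem p g) = kappa p g [^]\<^bsub>Zp p\<^esub> (- int n))"
  show "\<psi> = R.\<phi> n"
  proof (rule R.\<phi>_unique)
    show "\<psi> \<in> extensional (carrier R.\<Lambda>)" "\<psi> \<in> ring_hom R.\<Lambda> (Zp p)"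
      using \<psi> unfolding Lambda_eq by blast+
    show "\<psi> (a \<odot>\<^bsub>R.\<Lambda>\<^esub> x) = a \<otimes>\<^bsub>Zp p\<^esub> \<psi> x" if "a \<in> carrier (Zp p)" "x \<in> carrier R.\<Lambda>" for a x
      using \<psi> that unfolding Lambda_eq by blast
    show "continuous_map R.\<Lambda>top (Zp_top p) \<psi>"
      using \<psi> unfolding Lambda_top_def by blast
    show "\<psi> (group_elem p Gal (G_top p) g) = R.\<phi> n (group_elem p Gal (G_top p) g)" if g: "g \<in> carrier Gal" for g
      using \<psi> phi_elem_kappa[OF g, of n] g unfolding Lambda_elem_def by simp
  qed
qed

abbreviation "h \<equiv> h_elem p"

sublocale \<Lambda>: cring "Lambda p" unfolding Lambda_eq by (rule R.\<Lambda>_cring)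
sublocale Z: domain "Zp p" by (rule Zp_domain[OF prime])

lemma phi_hom: "R.\<phi> n \<in> ring_hom (Lambda p) (Zp p)" unfolding Lambda_eq by (rule R.\<phi>_ring_hom)

lemma h_carrier: "h \<in> carrier (Lambda p)"
proof -
  have "Zp_of_int p (1 + int p) \<odot>\<^bsub>Lambda p\<^esub> Lambda_elem p (inv\<^bsub>Gal\<^esub> (sigma_1p p)) \<in> carrier (Lambda p)"
    unfolding Lambda_eq Lambda_elem_def using sigma_1p(1) Zp_of_int_carrier[OF p0]
    by (intro R.\<Lambda>_closed) auto
  then show ?thesis unfolding h_elem_def by (rule \<Lambda>.minus_closed[OF \<Lambda>.one_closed])
qed

lemma phi_h: "R.\<phi> n h = Zp_of_int p (1 - (1 + int p) ^ Suc n)"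
proof -
  interpret \<phi>: ring_hom_cring "Lambda p" "Zp p" "R.\<phi> n"
    by (intro ring_hom_cring.intro ring_hom_cring_axioms.intro \<Lambda>.cring_axioms Z.cring_axioms phi_hom)
  let ?c = "Zp_of_int p (1 + int p)" and ?e = "Lambda_elem p (inv\<^bsub>Gal\<^esub> (sigma_1p p))"
  have c: "?c \<in> carrier (Zp p)" by (rule Zp_of_int_carrier[OF p0])
  have s: "inv\<^bsub>Gal\<^esub> (sigma_1p p) \<in> carrier Gal" using sigma_1p(1) by simp
  have e: "?e \<in> carrier (Lambda p)" unfolding Lambda_eq Lambda_elem_def using s by (rule R.\<Lambda>_closed)
  have ce: "?c \<odot>\<^bsub>Lambda p\<^esub> ?e \<in> carrier (Lambda p)" using e c unfolding Lambda_eq by (rule R.\<Lambda>_closed)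
  have inv_exp: "inv_exp m (inv\<^bsub>Gal\<^esub> (sigma_1p p)) = (1 + int p) mod int p ^ m" for m
    unfolding inv_exp_def using sigma_1p by (simp add: Zp_of_int_def)
  have pe: "R.\<phi> n ?e = Zp_of_int p ((1 + int p) ^ n)"
    unfolding Lambda_elem_def R.\<phi>_elem[OF s] inv_exp Zp_of_int_def by (simp only: power_mod)
  have "R.\<phi> n (?c \<odot>\<^bsub>Lambda p\<^esub> ?e) = ?c \<otimes>\<^bsub>Zp p\<^esub> R.\<phi> n ?e"
    using e c unfolding Lambda_eq by (rule R.\<phi>_smult)
  also have "\<dots> = Zp_of_int p ((1 + int p) ^ Suc n)" unfolding pe Zp_of_int_mult[OF p0] power_Suc ..
  finally have pce: "R.\<phi> n (?c \<odot>\<^bsub>Lambda p\<^esub> ?e) = Zp_of_int p ((1 + int p) ^ Suc n)" .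
  have "R.\<phi> n h \<oplus>\<^bsub>Zp p\<^esub> R.\<phi> n (?c \<odot>\<^bsub>Lambda p\<^esub> ?e) = R.\<phi> n (h \<oplus>\<^bsub>Lambda p\<^esub> ?c \<odot>\<^bsub>Lambda p\<^esub> ?e)"
    using h_carrier ce by simp
  also have "h \<oplus>\<^bsub>Lambda p\<^esub> ?c \<odot>\<^bsub>Lambda p\<^esub> ?e = \<one>\<^bsub>Lambda p\<^esub>"
    unfolding h_elem_def using ce by (simp add: \<Lambda>.minus_eq \<Lambda>.a_assoc \<Lambda>.l_neg)
  also have "R.\<phi> n \<one>\<^bsub>Lambda p\<^esub> = \<one>\<^bsub>Zp p\<^esub>" by simp
  also have "\<one>\<^bsub>Zp p\<^esub> = Zp_of_int p (1 - (1 + int p) ^ Suc n) \<oplus>\<^bsub>Zp p\<^esub> Zp_of_int p ((1 + int p) ^ Suc n)"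
    unfolding Zp_ops Zp_of_int_def by (simp only: mod_add_eq diff_add_cancel)
  finally have "R.\<phi> n h \<oplus>\<^bsub>Zp p\<^esub> Zp_of_int p ((1 + int p) ^ Suc n) =
      Zp_of_int p (1 - (1 + int p) ^ Suc n) \<oplus>\<^bsub>Zp p\<^esub> Zp_of_int p ((1 + int p) ^ Suc n)" unfolding pce .
  then show ?thesis
    using Z.add.right_cancel[OF Zp_of_int_carrier[OF p0] \<phi>.hom_closed[OF h_carrier] Zp_of_int_carrier[OF p0]] by blast
qed

lemma phi_h_nonzero: "R.\<phi> n h \<in> Zp_nonzero p"
  unfolding phi_h
proof (rule Zp_of_int_nonzero[OF prime])
  have "(1 + int p) ^ Suc n > 1" using p0 by (intro one_less_power) auto
  then show "1 - (1 + int p) ^ Suc n \<noteq> 0" by linarith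
qed

lemma Lambda_eqI:
  assumes "x \<in> carrier (Lambda p)" "y \<in> carrier (Lambda p)" "\<And>n. R.\<phi> n x = R.\<phi> n y" shows "x = y"
  using assms unfolding Lambda_eq by (rule R.\<Lambda>_eqI)

lemma phi_regular:
  assumes s: "s \<in> carrier (Lambda p)" "\<And>n. R.\<phi> n s \<in> Zp_nonzero p"
  shows "regular_element (Lambda p) s"
proof -
  have "x = \<zero>\<^bsub>Lambda p\<^esub>" if x: "x \<in> carrier (Lambda p)" "s \<otimes>\<^bsub>Lambda p\<^esub> x = \<zero>\<^bsub>Lambda p\<^esub>" for x
  proof (rule Lambda_eqI[OF x(1) \<Lambda>.zero_closed])
    fix n
    have z: "R.\<phi> n \<zero>\<^bsub>Lambda p\<^esub> = \<zero>\<^bsub>Zp p\<^esub>" unfolding Lambda_eq by (rule R.\<phi>_zero)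
    have "R.\<phi> n s \<otimes>\<^bsub>Zp p\<^esub> R.\<phi> n x = \<zero>\<^bsub>Zp p\<^esub>"
      using ring_hom_mult[OF phi_hom s(1) x(1), of n] x(2) z by simp
    then show "R.\<phi> n x = R.\<phi> n \<zero>\<^bsub>Lambda p\<^esub>"
      using s(2)[of n] Z.integral ring_hom_closed[OF phi_hom x(1)] z by auto
  qed
  then show ?thesis unfolding regular_element_def using s(1) \<Lambda>.m_comm[OF s(1)] by metis
qed

abbreviation "S \<equiv> range (\<lambda>k::nat. h [^]\<^bsub>Lambda p\<^esub> k)"

lemma phi_S: "s \<in> S \<Longrightarrow> R.\<phi> n s \<in> Zp_nonzero p"
proof -
  assume "s \<in> S"
  then obtain k where k: "s = h [^]\<^bsub>Lambda p\<^esub> (k :: nat)" by blast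
  have "R.\<phi> n (h [^]\<^bsub>Lambda p\<^esub> k) \<in> Zp_nonzero p"
  proof (induction k)
    case 0
    have "R.\<phi> n \<one>\<^bsub>Lambda p\<^esub> = \<one>\<^bsub>Zp p\<^esub>" by (rule ring_hom_one[OF phi_hom])
    then show ?case by simp
  next
    case (Suc k)
    have "R.\<phi> n (h [^]\<^bsub>Lambda p\<^esub> Suc k) = R.\<phi> n (h [^]\<^bsub>Lambda p\<^esub> k) \<otimes>\<^bsub>Zp p\<^esub> R.\<phi> n h"
      using ring_hom_mult[OF phi_hom] h_carrier by simp
    then show ?case using Suc phi_h_nonzero[of n] Z.integral_iff by auto
  qed
  then show ?thesis unfolding k .
qed

lemma S_denominators: "regular_denominators (Lambda p) S"
proof (intro regular_denominators.intro regular_denominators_axioms.intro \<Lambda>.cring_axioms)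
  show "\<one>\<^bsub>Lambda p\<^esub> \<in> S" by (rule image_eqI[of _ _ 0]) simp_all
  show "s \<otimes>\<^bsub>Lambda p\<^esub> t \<in> S" if st: "s \<in> S" "t \<in> S" for s t
  proof -
    obtain j k where "s = h [^]\<^bsub>Lambda p\<^esub> (j::nat)" "t = h [^]\<^bsub>Lambda p\<^esub> (k::nat)" using st by blast
    then have "s \<otimes>\<^bsub>Lambda p\<^esub> t = h [^]\<^bsub>Lambda p\<^esub> (j + k)" by (simp add: \<Lambda>.nat_pow_mult h_carrier)
    then show ?thesis by blast
  qed
  show "regular_element (Lambda p) s" if s: "s \<in> S" for s
  proof (rule phi_regular)
    show "s \<in> carrier (Lambda p)" using s h_carrier by auto
  qed (rule phi_S[OF s])
qed

lemmas D_loc_frac_eq_iff = regular_denominators.loc_frac_eq_iff[OF S_denominators]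
lemmas D_carrier_localization = regular_denominators.carrier_localization[OF S_denominators]
lemmas D_S_carrier = regular_denominators.S_carrier[OF S_denominators]
lemmas Z_loc_frac_eq_iff = regular_denominators.loc_frac_eq_iff[OF Zp_denominators[OF prime]]

lemma kappa_pow_h_frac:
  assumes "a \<in> carrier (Lambda p)" "s \<in> S"
  shows "kappa_pow_h p (- int n) (loc_frac (Lambda p) S a s) = loc_frac (Zp p) (Zp_nonzero p) (R.\<phi> n a) (R.\<phi> n s)"
  unfolding kappa_pow_h_def kappa_pow_eq
proof (rule regular_denominators.loc_map_frac[OF S_denominators Zp_denominators[OF prime] phi_hom _ assms])
  show "R.\<phi> n ` S \<subseteq> Zp_nonzero p" by (rule image_subsetI) (rule phi_S)
qed

text \<open>After clearing denominators this is the joint injectivity of the moments on \<open>\<Lambda>\<close>, since no moment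
  of a power of \<open>h\<close> vanishes.\<close>

lemma kappa_pow_h_inj:
  assumes \<mu>: "\<mu> \<in> carrier (Lambda_h p)" and \<nu>: "\<nu> \<in> carrier (Lambda_h p)"
    and e: "\<And>n. kappa_pow_h p (- int n) \<mu> = kappa_pow_h p (- int n) \<nu>"
  shows "\<mu> = \<nu>"
proof -
  obtain a s where as: "a \<in> carrier (Lambda p)" "s \<in> S" "\<mu> = loc_frac (Lambda p) S a s"
    using \<mu> unfolding Lambda_h_def D_carrier_localization by blast
  obtain b t where bt: "b \<in> carrier (Lambda p)" "t \<in> S" "\<nu> = loc_frac (Lambda p) S b t"
    using \<nu> unfolding Lambda_h_def D_carrier_localization by blast
  note sc = D_S_carrier[OF as(2)] D_S_carrier[OF bt(2)]
  have "a \<otimes>\<^bsub>Lambda p\<^esub> t = b \<otimes>\<^bsub>Lambda p\<^esub> s"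
  proof (rule Lambda_eqI)
    show "a \<otimes>\<^bsub>Lambda p\<^esub> t \<in> carrier (Lambda p)" "b \<otimes>\<^bsub>Lambda p\<^esub> s \<in> carrier (Lambda p)"
      using as(1) bt(1) sc by auto
    fix n
    have cl: "R.\<phi> n a \<in> carrier (Zp p)" "R.\<phi> n b \<in> carrier (Zp p)"
      using as(1) bt(1) by (auto intro: ring_hom_closed[OF phi_hom])
    have "loc_frac (Zp p) (Zp_nonzero p) (R.\<phi> n a) (R.\<phi> n s) = loc_frac (Zp p) (Zp_nonzero p) (R.\<phi> n b) (R.\<phi> n t)"
      using e[of n] unfolding as(3) bt(3) kappa_pow_h_frac[OF as(1,2)] kappa_pow_h_frac[OF bt(1,2)] .
    then have "R.\<phi> n a \<otimes>\<^bsub>Zp p\<^esub> R.\<phi> n t = R.\<phi> n b \<otimes>\<^bsub>Zp p\<^esub> R.\<phi> n s"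
      unfolding Z_loc_frac_eq_iff[OF cl phi_S[OF as(2)] phi_S[OF bt(2)]] .
    then show "R.\<phi> n (a \<otimes>\<^bsub>Lambda p\<^esub> t) = R.\<phi> n (b \<otimes>\<^bsub>Lambda p\<^esub> s)"
      unfolding ring_hom_mult[OF phi_hom as(1) sc(2)] ring_hom_mult[OF phi_hom bt(1) sc(1)] .
  qed
  then show ?thesis unfolding as(3) bt(3) D_loc_frac_eq_iff[OF as(1) bt(1) as(2) bt(2)] .
qed

lemma zeta_value:
  assumes "n \<ge> 1"
  shows "rat_of_complex ((1 - of_nat p ^ (n - 1)) * riemann_zeta (1 - of_nat n)) =
    (1 - of_nat p ^ (n - 1)) * (- bern n / of_nat n)"
proof -
  have "(1 - of_nat p ^ (n - 1)) * riemann_zeta (1 - of_nat n) = of_rat ((1 - of_nat p ^ (n - 1)) * (- bern n / of_nat n))"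
    unfolding riemann_zeta_nonpos_int[OF assms]
    by (simp only: of_rat_mult[of "1 - of_nat p ^ (n - 1)"] of_rat_diff of_rat_power of_rat_1 of_rat_of_nat_eq)
  then show ?thesis unfolding rat_of_complex_def by (intro the_equality) auto
qed

lemma bernoulli_element:
  assumes odd: "odd p"
  shows "\<exists>l. l \<in> carrier (Lambda p) \<and> (\<forall>n. R.\<phi> n l = moment p (bern_meas p) n)"
proof -
  obtain x where x: "R.represents x (bern_meas p)" using R.represents_ex[OF coherent_bern_meas[OF prime odd]] by blast
  then show ?thesis using R.represents_carrier[OF x] R.\<phi>_rep[OF x] unfolding Lambda_eq by blast
qed

text \<open>The moment congruences hold modulo every \<open>p ^ m\<close> up to a fixed integer factor, which may be
  cancelled because \<open>\<int>\<^sub>p\<close> is torsion free.\<close>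

lemma bern_meas_value:
  assumes odd: "odd p" and n: "n \<ge> 1" and q: "quotient_of ((1 - of_nat p ^ (n - 1)) * (- bern n / of_nat n)) = (a, b)"
  shows "moment p (bern_meas p) (n - 1) \<otimes>\<^bsub>Zp p\<^esub> Zp_of_int p b = Zp_of_int p a \<otimes>\<^bsub>Zp p\<^esub> Zp_of_int p (1 - (1 + int p) ^ n)"
proof -
  let ?M = "\<lambda>m. \<Sum>x\<in>unit_res p m. bern_meas p m x * x ^ (n - 1)"
  obtain D where D: "D > 0" and Dm: "\<And>m. m \<ge> 1 \<Longrightarrow> \<exists>k. of_int D * (of_nat n * of_int (?M m)
     - ((1 + of_nat p) ^ n - 1) * (1 - of_nat p ^ (n - 1)) * bern n) = (of_int (int p ^ m * k) :: rat)"
    using bern_meas_moment[OF prime odd n] by blast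
  have b0: "b > 0" using q by (rule quotient_of_denom_pos)
  have ab: "(1 - of_nat p ^ (n - 1)) * (- bern n / of_nat n) = of_int a / of_int b" using q by (rule quotient_of_div)
  have n0: "(of_nat n :: rat) \<noteq> 0" using n by simp
  have ab': "(1 - of_nat p ^ (n - 1)) * bern n * of_int b = - of_int a * (of_nat n :: rat)"
    using ab b0 n0 by (simp add: field_simps)
  note mc = moment_carrier[OF p0 coherent_bern_meas[OF prime odd], of "n - 1"]
  note zc = Zp_of_int_carrier[OF p0]
  show ?thesis
  proof (rule Zp_torsion_free[OF prime _ _ , where D = "D * int n"])
    show "moment p (bern_meas p) (n - 1) \<otimes>\<^bsub>Zp p\<^esub> Zp_of_int p b \<in> carrier (Zp p)"
      "Zp_of_int p a \<otimes>\<^bsub>Zp p\<^esub> Zp_of_int p (1 - (1 + int p) ^ n) \<in> carrier (Zp p)"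
      using mc zc by auto
    show "D * int n \<noteq> 0" using D n by simp
    fix m :: nat assume m: "m \<ge> 1"
    obtain k where k: "of_int D * (of_nat n * of_int (?M m)
     - ((1 + of_nat p) ^ n - 1) * (1 - of_nat p ^ (n - 1)) * bern n) = (of_int (int p ^ m * k) :: rat)"
      using Dm[OF m] by blast
    have "(of_int (D * int n * (?M m * b) - D * int n * (a * (1 - (1 + int p) ^ n))) :: rat) =
      of_int D * (of_nat n * of_int (?M m)) * of_int b - of_int D * ((1 + of_nat p) ^ n - 1) * (- of_int a * of_nat n)"
      by (simp add: algebra_simps)
    also have "\<dots> = of_int b * (of_int D * (of_nat n * of_int (?M m)
     - ((1 + of_nat p) ^ n - 1) * (1 - of_nat p ^ (n - 1)) * bern n))"
      unfolding ab'[symmetric] by (simp add: algebra_simps)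
    also have "\<dots> = of_int (b * (int p ^ m * k))" unfolding k by simp
    finally have "D * int n * (?M m * b) - D * int n * (a * (1 - (1 + int p) ^ n)) = b * (int p ^ m * k)"
      by (simp only: of_int_eq_iff)
    then have "int p ^ m dvd D * int n * (?M m * b) - D * int n * (a * (1 - (1 + int p) ^ n))" by simp
    then have c: "[D * int n * (?M m * b) = D * int n * (a * (1 - (1 + int p) ^ n))] (mod int p ^ m)"
      by (simp only: cong_iff_dvd_diff)
    have l: "[(moment p (bern_meas p) (n - 1) \<otimes>\<^bsub>Zp p\<^esub> Zp_of_int p b) m = ?M m * b] (mod int p ^ m)"
      unfolding Zp_ops moment_def Zp_of_int_def by (simp only: cong_def mod_mod_trivial mod_mult_eq)
    have r: "[a * (1 - (1 + int p) ^ n) = (Zp_of_int p a \<otimes>\<^bsub>Zp p\<^esub> Zp_of_int p (1 - (1 + int p) ^ n)) m] (mod int p ^ m)"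
      unfolding Zp_ops Zp_of_int_def by (simp only: cong_def mod_mod_trivial mod_mult_eq)
    show "[D * int n * (moment p (bern_meas p) (n - 1) \<otimes>\<^bsub>Zp p\<^esub> Zp_of_int p b) m =
       D * int n * (Zp_of_int p a \<otimes>\<^bsub>Zp p\<^esub> Zp_of_int p (1 - (1 + int p) ^ n)) m] (mod int p ^ m)"
      using cong_trans[OF cong_mult[OF cong_refl l] cong_trans[OF c cong_mult[OF cong_refl r]]] .
  qed
qed

theorem zeta_pseudomeasure:
  assumes odd: "odd p"
  shows "regular_element (Lambda p) (h_elem p) \<and>
    (\<exists>!\<mu>. \<mu> \<in> carrier (Lambda_h p) \<and>
      (\<forall>n::nat. n \<ge> 1 \<longrightarrow>
        kappa_pow_h p (1 - int n) \<mu> =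
          Qp_of_rat p (rat_of_complex ((1 - of_nat p ^ (n - 1)) * riemann_zeta (1 - of_nat n)))))"
proof (intro conjI ex_ex1I)
  show "regular_element (Lambda p) h" by (rule phi_regular[OF h_carrier phi_h_nonzero])
next
  obtain l where l: "l \<in> carrier (Lambda p)" "\<And>n. R.\<phi> n l = moment p (bern_meas p) n"
    using bernoulli_element[OF odd] by blast
  have hS: "h \<in> S" by (rule image_eqI[of _ _ 1]) (simp_all add: h_carrier)
  \<comment> \<open>The Bernoulli measure carries the factor \<open>1 - (1 + p) ^ n\<close>, which division by \<open>h\<close> removes.\<close>
  let ?\<mu> = "loc_frac (Lambda p) S l h"
  have "?\<mu> \<in> carrier (Lambda_h p)" unfolding Lambda_h_def D_carrier_localization using l(1) hS by blast
  moreover have "kappa_pow_h p (1 - int n) ?\<mu> =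
          Qp_of_rat p (rat_of_complex ((1 - of_nat p ^ (n - 1)) * riemann_zeta (1 - of_nat n)))" if n: "n \<ge> 1" for n
  proof -
    obtain a b where q: "quotient_of ((1 - of_nat p ^ (n - 1)) * (- bern n / of_nat n)) = (a, b)" by (cases "quotient_of ((1 - of_nat p ^ (n - 1)) * (- bern n / of_nat n))")
    have e: "1 - int n = - int (n - 1)" using n by simp
    have "kappa_pow_h p (1 - int n) ?\<mu> = loc_frac (Zp p) (Zp_nonzero p) (R.\<phi> (n - 1) l) (R.\<phi> (n - 1) h)"
      unfolding e by (rule kappa_pow_h_frac[OF l(1) hS])
    also have "\<dots> = loc_frac (Zp p) (Zp_nonzero p) (Zp_of_int p a) (Zp_of_int p b)"
    proof (rule Z_loc_frac_eq_iff[THEN iffD2])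
      show "R.\<phi> (n - 1) l \<in> carrier (Zp p)" by (rule ring_hom_closed[OF phi_hom l(1)])
      show "Zp_of_int p a \<in> carrier (Zp p)" by (rule Zp_of_int_carrier[OF p0])
      show "R.\<phi> (n - 1) h \<in> Zp_nonzero p" by (rule phi_h_nonzero)
      have "b > 0" using q by (rule quotient_of_denom_pos)
      then show "Zp_of_int p b \<in> Zp_nonzero p" by (intro Zp_of_int_nonzero[OF prime]) simp
      have "Suc (n - 1) = n" using n by simp
      then show "R.\<phi> (n - 1) l \<otimes>\<^bsub>Zp p\<^esub> Zp_of_int p b = Zp_of_int p a \<otimes>\<^bsub>Zp p\<^esub> R.\<phi> (n - 1) h"
        unfolding phi_h l(2) using bern_meas_value[OF odd n q] by (simp only:)
    qed
    also have "\<dots> = Qp_of_rat p (rat_of_complex ((1 - of_nat p ^ (n - 1)) * riemann_zeta (1 - of_nat n)))"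
      unfolding zeta_value[OF n] Qp_of_rat_def q by simp
    finally show ?thesis .
  qed
  ultimately show "\<exists>\<mu>. \<mu> \<in> carrier (Lambda_h p) \<and>
      (\<forall>n::nat. n \<ge> 1 \<longrightarrow>
        kappa_pow_h p (1 - int n) \<mu> =
          Qp_of_rat p (rat_of_complex ((1 - of_nat p ^ (n - 1)) * riemann_zeta (1 - of_nat n))))" by blast
next
  fix \<mu> \<nu>
  assume \<mu>: "\<mu> \<in> carrier (Lambda_h p) \<and> (\<forall>n::nat. n \<ge> 1 \<longrightarrow> kappa_pow_h p (1 - int n) \<mu> =
          Qp_of_rat p (rat_of_complex ((1 - of_nat p ^ (n - 1)) * riemann_zeta (1 - of_nat n))))"
    and \<nu>: "\<nu> \<in> carrier (Lambda_h p) \<and> (\<forall>n::nat. n \<ge> 1 \<longrightarrow> kappa_pow_h p (1 - int n) \<nu> =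
          Qp_of_rat p (rat_of_complex ((1 - of_nat p ^ (n - 1)) * riemann_zeta (1 - of_nat n))))"
  show "\<mu> = \<nu>"
  proof (rule kappa_pow_h_inj)
    show "\<mu> \<in> carrier (Lambda_h p)" "\<nu> \<in> carrier (Lambda_h p)" using \<mu> \<nu> by blast+
    fix n
    have e: "1 - int (Suc n) = - int n" by simp
    have "kappa_pow_h p (1 - int (Suc n)) \<mu> = kappa_pow_h p (1 - int (Suc n)) \<nu>"
      using \<mu> \<nu> by (metis le_add1 plus_1_eq_Suc)
    then show "kappa_pow_h p (- int n) \<mu> = kappa_pow_h p (- int n) \<nu>" unfolding e .
  qed
qed

end

theorem mainTheorem2:
  fixes p :: nat
  assumes "Factorial_Ring.prime p" and "odd p"
  shows "regular_element (Lambda p) (h_elem p) \<and>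
    (\<exists>!\<mu>. \<mu> \<in> carrier (Lambda_h p) \<and>
      (\<forall>n::nat. n \<ge> 1 \<longrightarrow>
        kappa_pow_h p (1 - int n) \<mu> =
          Qp_of_rat p (rat_of_complex ((1 - of_nat p ^ (n - 1)) * riemann_zeta (1 - of_nat n)))))"
proof -
  interpret cyclotomic p by unfold_locales (rule assms(1))
  show ?thesis by (rule zeta_pseudomeasure[OF assms(2)])
qed

end
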